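(* Let $S$ be a regular $F$-finite domain. Let $R\subseteq S$ be an extension of Noetherian rings, with $R$ $F$-finite, such that $R$ is a direct summand of $S$. Then, for every $f\in R$, $R_f$ is generated by $\frac{1}{f}$ as a $D_R$-module.
   Context: Rings are commutative and contain a field of characteristic $p>0$. $R$ is $F$-finite if $R$ is a finitely generated module over itself via (iterates of) Frobenius. $R$ is a direct summand of $S$ if there is an $R$-linear $\beta:S\to R$ with $\beta|_R=\mathrm{id}_R$. Differential operators: $D_R=\bigcup_{m\geq 0}D^m_R\subseteq\mathrm{Hom}_{\mathbb{Z}}(R,R)$, where $D^0_R\cong R$ consists of multiplications by elements of $R$, and $\delta\in \mathrm{Hom}_{\mathbb{Z}}(R,R)$ lies in $D^m_R$ iff $[\delta,r]=\delta r-r\delta\in D^{m-1}_R$ for all $r\in R$. For $R$ $F$-finite, $D_R=\bigcup_e D^{(e)}_R$ with $D^{(e)}_R=\mathrm{Hom}_{R^{p^e}}(R,R)$. $R_f$ is a $D_R$-module by induction on order: $\delta\cdot\frac{v}{f^t}=\frac{\delta\cdot v}{f^t}$ for $\delta$ of order $0$, and in general $\delta\cdot \frac{v}{f^t}=\frac{\delta\cdot v-[\delta,f^t]\cdot\frac{v}{f^t}}{f^t}$. *)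

theory Defs
  imports
    "HOL-Algebra.Subrings"
    "HOL-Algebra.Ring_Divisibility"
    "HOL-Library.Extended_Nat"
    "HOL-Computational_Algebra.Primes"
begin

section \<open>Rings of characteristic $p$ and $F$-finiteness\<close>

text \<open>A subfield of \<open>R\<close> shares its unit with \<open>R\<close>, so that \<open>p \<cdot> 1 = 0\<close> in \<open>R\<close>
  says that the subfield has characteristic \<open>p\<close>. The qualified name avoids the relation
  \<open>Divisibility.prime\<close> on monoids.\<close>

definition contains_field_of_char :: "nat \<Rightarrow> ('a, 'm) ring_scheme \<Rightarrow> bool" where
  "contains_field_of_char p R \<longleftrightarrow>
     Factorial_Ring.prime p \<and> (\<exists>K. subfield K R) \<and> add_pow R p \<one>\<^bsub>R\<^esub> = \<zero>\<^bsub>R\<^esub>"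

text \<open>Finiteness of one Frobenius is equivalent to finiteness of any of its iterates.\<close>

definition F_finite :: "nat \<Rightarrow> ('a, 'm) ring_scheme \<Rightarrow> bool" where
  "F_finite p R \<longleftrightarrow>
     (\<exists>B. finite B \<and> B \<subseteq> carrier R \<and>
        (\<forall>x\<in>carrier R. \<exists>c\<in>B \<rightarrow> carrier R. x = (\<Oplus>\<^bsub>R\<^esub>b\<in>B. (c b [^]\<^bsub>R\<^esub> p) \<otimes>\<^bsub>R\<^esub> b)))"

text \<open>This is used for a subring \<open>R\<close> of \<open>S\<close> only.\<close>

definition direct_summand :: "('a, 'm) ring_scheme \<Rightarrow> ('a, 'm) ring_scheme \<Rightarrow> bool" where
  "direct_summand R S \<longleftrightarrow>
     (\<exists>\<beta>\<in>carrier S \<rightarrow> carrier R.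
        (\<forall>x\<in>carrier S. \<forall>y\<in>carrier S. \<beta> (x \<oplus>\<^bsub>S\<^esub> y) = \<beta> x \<oplus>\<^bsub>R\<^esub> \<beta> y) \<and>
        (\<forall>r\<in>carrier R. \<forall>x\<in>carrier S. \<beta> (r \<otimes>\<^bsub>S\<^esub> x) = r \<otimes>\<^bsub>R\<^esub> \<beta> x) \<and>
        (\<forall>r\<in>carrier R. \<beta> r = r))"

section \<open>Localization\<close>

text \<open>The fraction \<open>a / s\<close>, as the set of all pairs \<open>(b, t)\<close> equivalent to \<open>(a, s)\<close>.\<close>

definition fraction :: "('a, 'm) ring_scheme \<Rightarrow> 'a set \<Rightarrow> 'a \<Rightarrow> 'a \<Rightarrow> ('a \<times> 'a) set" where
  "fraction R M a s = {(b, t). b \<in> carrier R \<and> t \<in> M \<and>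
     (\<exists>u\<in>M. u \<otimes>\<^bsub>R\<^esub> (a \<otimes>\<^bsub>R\<^esub> t) = u \<otimes>\<^bsub>R\<^esub> (b \<otimes>\<^bsub>R\<^esub> s))}"

text \<open>As in \<open>HOL.Equiv_Relations\<close>, an operation on classes is the union, over all representatives,
  of the resulting classes, which are all equal (see \<open>localization_add\<close> and
  \<open>localization_mult\<close>).\<close>

definition localization :: "('a, 'm) ring_scheme \<Rightarrow> 'a set \<Rightarrow> ('a \<times> 'a) set ring" where
  "localization R M =
     \<lparr>carrier = {fraction R M a s | a s. a \<in> carrier R \<and> s \<in> M},
      monoid.mult = (\<lambda>X Y. \<Union>(a, s)\<in>X. \<Union>(b, t)\<in>Y. fraction R M (a \<otimes>\<^bsub>R\<^esub> b) (s \<otimes>\<^bsub>R\<^esub> t)),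
      one = fraction R M \<one>\<^bsub>R\<^esub> \<one>\<^bsub>R\<^esub>,
      zero = fraction R M \<zero>\<^bsub>R\<^esub> \<one>\<^bsub>R\<^esub>,
      add = (\<lambda>X Y. \<Union>(a, s)\<in>X. \<Union>(b, t)\<in>Y.
               fraction R M ((a \<otimes>\<^bsub>R\<^esub> t) \<oplus>\<^bsub>R\<^esub> (b \<otimes>\<^bsub>R\<^esub> s)) (s \<otimes>\<^bsub>R\<^esub> t))\<rparr>"

lemma UN_pair_const:
  assumes "(a, s) \<in> X" "\<And>a s. (a, s) \<in> X \<Longrightarrow> g a s = c"
  shows "(\<Union>(a, s)\<in>X. g a s) = c"
  using assms by fastforce

context cring
begin

context
  fixes M
  assumes M: "submonoid M R"
begin

lemma M_closed: "s \<in> M \<Longrightarrow> s \<in> carrier R" and M_mult: "s \<in> M \<Longrightarrow> t \<in> M \<Longrightarrow> s \<otimes> t \<in> M"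
  and M_one: "\<one> \<in> M"
  using submonoid.subset[OF M] submonoid.m_closed[OF M] submonoid.one_closed[OF M] by auto

lemmas M_simps = M_closed M_mult M_one

lemma fraction_self: "a \<in> carrier R \<Longrightarrow> s \<in> M \<Longrightarrow> (a, s) \<in> fraction R M a s"
  using M_one by (auto simp: fraction_def)

lemma fraction_eqI:
  assumes "a \<in> carrier R" "b \<in> carrier R" "s \<in> M" "t \<in> M" "u \<in> M"
    and eq: "u \<otimes> (a \<otimes> t) = u \<otimes> (b \<otimes> s)"
  shows "fraction R M a s = fraction R M b t"
proof -
  have sub: "fraction R M a s \<subseteq> fraction R M b t"
    if *: "a \<in> carrier R" "b \<in> carrier R" "s \<in> M" "t \<in> M" "u \<in> M" "u \<otimes> (a \<otimes> t) = u \<otimes> (b \<otimes> s)"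
    for a b s t
  proof (clarsimp simp: fraction_def)
    fix c r v assume c: "c \<in> carrier R" "r \<in> M" "v \<in> M" and v: "v \<otimes> (a \<otimes> r) = v \<otimes> (c \<otimes> s)"
    have car: "a \<in> carrier R" "b \<in> carrier R" "s \<in> carrier R" "t \<in> carrier R" "u \<in> carrier R"
      "c \<in> carrier R" "r \<in> carrier R" "v \<in> carrier R"
      using * c M_closed by auto
    have "(u \<otimes> v \<otimes> s) \<otimes> (b \<otimes> r) = (v \<otimes> r) \<otimes> (u \<otimes> (b \<otimes> s))" using car by (simp add: m_ac)
    also have "\<dots> = (u \<otimes> t) \<otimes> (v \<otimes> (a \<otimes> r))" using car *(6)[symmetric] by (simp add: m_ac)
    also have "\<dots> = (u \<otimes> v \<otimes> s) \<otimes> (c \<otimes> t)" unfolding v using car by (simp add: m_ac)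
    finally show "\<exists>w\<in>M. w \<otimes> (b \<otimes> r) = w \<otimes> (c \<otimes> t)" using * c M_mult by meson
  qed
  show ?thesis using sub[OF assms] sub[OF assms(2,1,4,3,5) eq[symmetric]] by (rule equalityI)
qed

lemma fraction_eq_iff:
  assumes "a \<in> carrier R" "b \<in> carrier R" "s \<in> M" "t \<in> M"
  shows "fraction R M a s = fraction R M b t \<longleftrightarrow> (\<exists>u\<in>M. u \<otimes> (a \<otimes> t) = u \<otimes> (b \<otimes> s))"
proof
  assume "fraction R M a s = fraction R M b t"
  then have "(b, t) \<in> fraction R M a s" using fraction_self assms by auto
  then show "\<exists>u\<in>M. u \<otimes> (a \<otimes> t) = u \<otimes> (b \<otimes> s)" by (auto simp: fraction_def)
qed (use fraction_eqI assms in blast)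

lemma localization_mult:
  assumes "a \<in> carrier R" "b \<in> carrier R" "s \<in> M" "t \<in> M"
  shows "fraction R M a s \<otimes>\<^bsub>localization R M\<^esub> fraction R M b t = fraction R M (a \<otimes> b) (s \<otimes> t)"
proof -
  have "fraction R M (a' \<otimes> b') (s' \<otimes> t') = fraction R M (a \<otimes> b) (s \<otimes> t)"
    if h: "(a', s') \<in> fraction R M a s" "(b', t') \<in> fraction R M b t" for a' b' s' t'
  proof -
    obtain u v where *: "u \<in> M" "v \<in> M" "a' \<in> carrier R" "b' \<in> carrier R" "s' \<in> M" "t' \<in> M"
      and u: "u \<otimes> (a \<otimes> s') = u \<otimes> (a' \<otimes> s)" and v: "v \<otimes> (b \<otimes> t') = v \<otimes> (b' \<otimes> t)"
      using h by (auto simp: fraction_def)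
    have car: "s \<in> carrier R" "t \<in> carrier R" "s' \<in> carrier R" "t' \<in> carrier R"
      "u \<in> carrier R" "v \<in> carrier R"
      using * assms M_closed by auto
    have "(u \<otimes> v) \<otimes> ((a' \<otimes> b') \<otimes> (s \<otimes> t)) = (u \<otimes> (a' \<otimes> s)) \<otimes> (v \<otimes> (b' \<otimes> t))"
      using car assms * by (simp add: m_ac)
    also have "\<dots> = (u \<otimes> v) \<otimes> ((a \<otimes> b) \<otimes> (s' \<otimes> t'))"
      unfolding u[symmetric] v[symmetric] using car assms * by (simp add: m_ac)
    finally show ?thesis
      using fraction_eqI[where u = "u \<otimes> v"] assms * M_mult by (meson m_closed)
  qed
  note * = this
  have "(\<Union>(a', s')\<in>fraction R M a s. \<Union>(b', t')\<in>fraction R M b t.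
      fraction R M (a' \<otimes> b') (s' \<otimes> t')) = fraction R M (a \<otimes> b) (s \<otimes> t)"
    by (intro UN_pair_const[OF fraction_self[OF assms(1,3)]]
        UN_pair_const[OF fraction_self[OF assms(2,4)]] *)
  then show ?thesis by (simp add: localization_def)
qed

lemma localization_add:
  assumes "a \<in> carrier R" "b \<in> carrier R" "s \<in> M" "t \<in> M"
  shows "fraction R M a s \<oplus>\<^bsub>localization R M\<^esub> fraction R M b t =
    fraction R M ((a \<otimes> t) \<oplus> (b \<otimes> s)) (s \<otimes> t)"
proof -
  have "fraction R M ((a' \<otimes> t') \<oplus> (b' \<otimes> s')) (s' \<otimes> t') =
      fraction R M ((a \<otimes> t) \<oplus> (b \<otimes> s)) (s \<otimes> t)"
    if h: "(a', s') \<in> fraction R M a s" "(b', t') \<in> fraction R M b t" for a' b' s' t'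
  proof -
    obtain u v where *: "u \<in> M" "v \<in> M" "a' \<in> carrier R" "b' \<in> carrier R" "s' \<in> M" "t' \<in> M"
      and u: "u \<otimes> (a \<otimes> s') = u \<otimes> (a' \<otimes> s)" and v: "v \<otimes> (b \<otimes> t') = v \<otimes> (b' \<otimes> t)"
      using h by (auto simp: fraction_def)
    have car: "s \<in> carrier R" "t \<in> carrier R" "s' \<in> carrier R" "t' \<in> carrier R"
      "u \<in> carrier R" "v \<in> carrier R"
      using * assms M_closed by auto
    have "(u \<otimes> v) \<otimes> (((a' \<otimes> t') \<oplus> (b' \<otimes> s')) \<otimes> (s \<otimes> t)) =
        (v \<otimes> t' \<otimes> t) \<otimes> (u \<otimes> (a' \<otimes> s)) \<oplus> (u \<otimes> s' \<otimes> s) \<otimes> (v \<otimes> (b' \<otimes> t))"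
      using car assms * by (simp add: m_ac l_distr r_distr)
    also have "\<dots> = (u \<otimes> v) \<otimes> (((a \<otimes> t) \<oplus> (b \<otimes> s)) \<otimes> (s' \<otimes> t'))"
      unfolding u[symmetric] v[symmetric] using car assms * by (simp add: m_ac l_distr r_distr)
    finally show ?thesis
      using car * assms by (intro fraction_eqI[where u = "u \<otimes> v"]) (auto simp: M_mult)
  qed
  note * = this
  have "(\<Union>(a', s')\<in>fraction R M a s. \<Union>(b', t')\<in>fraction R M b t.
      fraction R M ((a' \<otimes> t') \<oplus> (b' \<otimes> s')) (s' \<otimes> t')) =
      fraction R M ((a \<otimes> t) \<oplus> (b \<otimes> s)) (s \<otimes> t)"
    by (intro UN_pair_const[OF fraction_self[OF assms(1,3)]]
        UN_pair_const[OF fraction_self[OF assms(2,4)]] *)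
  then show ?thesis by (simp add: localization_def)
qed

lemma localization_carrier:
  "carrier (localization R M) = {fraction R M a s | a s. a \<in> carrier R \<and> s \<in> M}"
  "\<one>\<^bsub>localization R M\<^esub> = fraction R M \<one> \<one>" "\<zero>\<^bsub>localization R M\<^esub> = fraction R M \<zero> \<one>"
  by (simp_all add: localization_def)

lemma fraction_in_localization [simp]:
  "a \<in> carrier R \<Longrightarrow> s \<in> M \<Longrightarrow> fraction R M a s \<in> carrier (localization R M)"
  by (auto simp: localization_carrier)

lemma fraction_cancel:
  assumes "a \<in> carrier R" "s \<in> M" "u \<in> M"
  shows "fraction R M (u \<otimes> a) (u \<otimes> s) = fraction R M a s"
  using assms by (intro fraction_eqI[where u = \<one>]) (auto simp: M_simps m_ac)

lemma cring_localization: "cring (localization R M)"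
proof (rule cringI)
  let ?L = "localization R M"
  show "abelian_group ?L"
  proof (rule abelian_groupI)
    show "\<zero>\<^bsub>?L\<^esub> \<in> carrier ?L" by (auto simp: localization_carrier(3) M_one)
    fix x assume "x \<in> carrier ?L"
    then obtain a s where x: "x = fraction R M a s" "a \<in> carrier R" "s \<in> M"
      by (auto simp: localization_carrier)
    show "\<zero>\<^bsub>?L\<^esub> \<oplus>\<^bsub>?L\<^esub> x = x" using x M_closed
      by (simp add: localization_carrier(3) localization_add M_one)
    have "fraction R M (\<ominus> a) s \<oplus>\<^bsub>?L\<^esub> x = \<zero>\<^bsub>?L\<^esub>" unfolding x(1) localization_carrier(3)
      using x M_closed by (subst localization_add; (intro fraction_eqI[where u = \<one>])?)
        (auto simp: M_simps l_minus l_neg)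
    then show "\<exists>y\<in>carrier ?L. y \<oplus>\<^bsub>?L\<^esub> x = \<zero>\<^bsub>?L\<^esub>"
      using x by (intro bexI[of _ "fraction R M (\<ominus> a) s"]) auto
    fix y assume "y \<in> carrier ?L"
    then obtain b t where y: "y = fraction R M b t" "b \<in> carrier R" "t \<in> M"
      by (auto simp: localization_carrier)
    show "x \<oplus>\<^bsub>?L\<^esub> y \<in> carrier ?L" using x y by (auto simp: localization_add M_simps)
    show "x \<oplus>\<^bsub>?L\<^esub> y = y \<oplus>\<^bsub>?L\<^esub> x" using x y M_closed
      by (auto simp: localization_add a_comm m_comm)
    fix z assume "z \<in> carrier ?L"
    then obtain c r where z: "z = fraction R M c r" "c \<in> carrier R" "r \<in> M"
      by (auto simp: localization_carrier)
    show "(x \<oplus>\<^bsub>?L\<^esub> y) \<oplus>\<^bsub>?L\<^esub> z = x \<oplus>\<^bsub>?L\<^esub> (y \<oplus>\<^bsub>?L\<^esub> z)"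
      using x y z M_closed M_mult by (simp add: localization_add l_distr r_distr m_ac a_ac)
  qed
  show "comm_monoid ?L"
  proof (rule comm_monoidI)
    show "\<one>\<^bsub>?L\<^esub> \<in> carrier ?L" by (auto simp: localization_carrier(2) M_one)
    fix x assume "x \<in> carrier ?L"
    then obtain a s where x: "x = fraction R M a s" "a \<in> carrier R" "s \<in> M"
      by (auto simp: localization_carrier)
    show "\<one>\<^bsub>?L\<^esub> \<otimes>\<^bsub>?L\<^esub> x = x" using x M_closed
      by (simp add: localization_carrier(2) localization_mult M_one)
    fix y assume "y \<in> carrier ?L"
    then obtain b t where y: "y = fraction R M b t" "b \<in> carrier R" "t \<in> M"
      by (auto simp: localization_carrier)
    show "x \<otimes>\<^bsub>?L\<^esub> y \<in> carrier ?L" using x y by (auto simp: localization_mult M_simps)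
    show "x \<otimes>\<^bsub>?L\<^esub> y = y \<otimes>\<^bsub>?L\<^esub> x" using x y M_closed
      by (auto simp: localization_mult m_comm)
    fix z assume "z \<in> carrier ?L"
    then obtain c r where z: "z = fraction R M c r" "c \<in> carrier R" "r \<in> M"
      by (auto simp: localization_carrier)
    show "(x \<otimes>\<^bsub>?L\<^esub> y) \<otimes>\<^bsub>?L\<^esub> z = x \<otimes>\<^bsub>?L\<^esub> (y \<otimes>\<^bsub>?L\<^esub> z)"
      using x y z M_closed M_mult by (simp add: localization_mult m_ac)
  qed
  fix x y z assume "x \<in> carrier ?L" "y \<in> carrier ?L" "z \<in> carrier ?L"
  then obtain a s b t c r where x: "x = fraction R M a s" "a \<in> carrier R" "s \<in> M"
    and y: "y = fraction R M b t" "b \<in> carrier R" "t \<in> M"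
    and z: "z = fraction R M c r" "c \<in> carrier R" "r \<in> M"
    by (auto simp: localization_carrier)
  have "fraction R M ((a \<otimes> t \<oplus> b \<otimes> s) \<otimes> c) (s \<otimes> t \<otimes> r) =
      fraction R M (r \<otimes> ((a \<otimes> t \<oplus> b \<otimes> s) \<otimes> c)) (r \<otimes> (s \<otimes> t \<otimes> r))"
    using x y z M_closed M_mult by (simp add: fraction_cancel)
  also have "\<dots> = fraction R M ((a \<otimes> c) \<otimes> (t \<otimes> r) \<oplus> (b \<otimes> c) \<otimes> (s \<otimes> r)) ((s \<otimes> r) \<otimes> (t \<otimes> r))"
    using x y z M_closed by (simp add: l_distr r_distr m_ac)
  finally show "(x \<oplus>\<^bsub>?L\<^esub> y) \<otimes>\<^bsub>?L\<^esub> z = x \<otimes>\<^bsub>?L\<^esub> z \<oplus>\<^bsub>?L\<^esub> y \<otimes>\<^bsub>?L\<^esub> z"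
    using x y z M_closed M_mult by (simp add: localization_add localization_mult)
qed

end

end

definition powers :: "('a, 'm) ring_scheme \<Rightarrow> 'a \<Rightarrow> 'a set" where
  "powers R f = {f [^]\<^bsub>R\<^esub> n | n::nat. True}"

section \<open>Regular rings\<close>

definition krull_dim :: "('a, 'm) ring_scheme \<Rightarrow> enat" where
  "krull_dim R = Sup {enat n | n. \<exists>P. (\<forall>i\<le>n. primeideal (P i) R) \<and> (\<forall>i<n. P i \<subset> P (Suc i))}"

definition regular_local_ring :: "('a, 'm) ring_scheme \<Rightarrow> bool" where
  "regular_local_ring R \<longleftrightarrow> cring R \<and> noetherian_ring R \<and>
     (\<exists>\<mm>. maximalideal \<mm> R \<and> (\<forall>J. maximalideal J R \<longrightarrow> J = \<mm>) \<and>
        (\<exists>B. finite B \<and> B \<subseteq> carrier R \<and> enat (card B) = krull_dim R \<and> \<mm> = genideal R B))"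

definition regular_ring :: "('a, 'm) ring_scheme \<Rightarrow> bool" where
  "regular_ring R \<longleftrightarrow> cring R \<and> noetherian_ring R \<and>
     (\<forall>P. primeideal P R \<longrightarrow> regular_local_ring (localization R (carrier R - P)))"

section \<open>Differential operators\<close>

text \<open>Operators are extensional functions on the carrier, so that equal operators are equal
  functions.\<close>

definition additive_endos :: "('a, 'm) ring_scheme \<Rightarrow> ('a \<Rightarrow> 'a) set" where
  "additive_endos R = hom (add_monoid R) (add_monoid R) \<inter> extensional (carrier R)"

definition diff_comm :: "('a, 'm) ring_scheme \<Rightarrow> ('a \<Rightarrow> 'a) \<Rightarrow> 'a \<Rightarrow> 'a \<Rightarrow> 'a" where
  "diff_comm R \<delta> r = (\<lambda>x\<in>carrier R. \<delta> (r \<otimes>\<^bsub>R\<^esub> x) \<ominus>\<^bsub>R\<^esub> r \<otimes>\<^bsub>R\<^esub> \<delta> x)"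

primrec diff_ops_le :: "('a, 'm) ring_scheme \<Rightarrow> nat \<Rightarrow> ('a \<Rightarrow> 'a) set" where
  "diff_ops_le R 0 = {\<lambda>x\<in>carrier R. r \<otimes>\<^bsub>R\<^esub> x | r. r \<in> carrier R}"
| "diff_ops_le R (Suc m) =
     {\<delta> \<in> additive_endos R. \<forall>r\<in>carrier R. diff_comm R \<delta> r \<in> diff_ops_le R m}"

definition diff_ops :: "('a, 'm) ring_scheme \<Rightarrow> ('a \<Rightarrow> 'a) set" where
  "diff_ops R = (\<Union>m. diff_ops_le R m)"

text \<open>The action of an operator \<open>\<delta>\<close> of order at most \<open>m\<close> on the fraction \<open>a / s\<close>, by
  recursion on \<open>m\<close>. The multiplicative set \<open>M\<close> is arbitrary; for \<open>M = powers R f\<close> and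
  \<open>s = f^t\<close> this is the usual formula on \<open>R_f\<close>.\<close>

primrec frac_act ::
  "('a, 'm) ring_scheme \<Rightarrow> 'a set \<Rightarrow> nat \<Rightarrow> ('a \<Rightarrow> 'a) \<Rightarrow> 'a \<Rightarrow> 'a \<Rightarrow> ('a \<times> 'a) set" where
  "frac_act R M 0 \<delta> a s = fraction R M (\<delta> a) s"
| "frac_act R M (Suc m) \<delta> a s =
     fraction R M \<one>\<^bsub>R\<^esub> s \<otimes>\<^bsub>localization R M\<^esub>
       (fraction R M (\<delta> a) \<one>\<^bsub>R\<^esub> \<ominus>\<^bsub>localization R M\<^esub> frac_act R M m (diff_comm R \<delta> s) a s)"

text \<open>The result depends neither on the representative \<open>(a, s)\<close> nor on the bound for the order of
  \<open>\<delta>\<close>, see \<open>diff_act_frac\<close>.\<close>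

definition diff_act ::
  "('a, 'm) ring_scheme \<Rightarrow> 'a set \<Rightarrow> ('a \<Rightarrow> 'a) \<Rightarrow> ('a \<times> 'a) set \<Rightarrow> ('a \<times> 'a) set" where
  "diff_act R M \<delta> X = (\<Union>(a, s)\<in>X. frac_act R M (LEAST m. \<delta> \<in> diff_ops_le R m) \<delta> a s)"

context cring
begin

lemma powers_submonoid: "f \<in> carrier R \<Longrightarrow> submonoid (powers R f) R"
  by (unfold_locales) (auto simp: powers_def nat_pow_mult intro: exI[of _ 0] exI[of _ "_ + _"])

lemma additive_endosD:
  assumes "\<delta> \<in> additive_endos R"
  shows "x \<in> carrier R \<Longrightarrow> \<delta> x \<in> carrier R"
    and "x \<in> carrier R \<Longrightarrow> y \<in> carrier R \<Longrightarrow> \<delta> (x \<oplus> y) = \<delta> x \<oplus> \<delta> y"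
    and "\<delta> \<in> extensional (carrier R)"
  using assms by (auto simp: additive_endos_def hom_def)

lemma additive_endosI:
  assumes "\<And>x. x \<in> carrier R \<Longrightarrow> g x \<in> carrier R"
    and "\<And>x y. x \<in> carrier R \<Longrightarrow> y \<in> carrier R \<Longrightarrow> g (x \<oplus> y) = g x \<oplus> g y"
  shows "(\<lambda>x\<in>carrier R. g x) \<in> additive_endos R"
  using assms by (auto simp: additive_endos_def hom_def)

lemma diff_comm_endo:
  assumes "\<delta> \<in> additive_endos R" "r \<in> carrier R"
  shows "diff_comm R \<delta> r \<in> additive_endos R"
  unfolding diff_comm_def using additive_endosD(1,2)[OF assms(1)] assms(2)
  by (intro additive_endosI) (simp_all add: a_minus_def r_distr minus_add a_ac)

lemma diff_ops_le_endo: "\<delta> \<in> diff_ops_le R m \<Longrightarrow> \<delta> \<in> additive_endos R"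
  by (cases m) (auto simp: r_distr intro!: additive_endosI)

definition op_add where "op_add \<delta> \<epsilon> = (\<lambda>x\<in>carrier R. \<delta> x \<oplus> \<epsilon> x)"
definition op_lmult where "op_lmult r \<delta> = (\<lambda>x\<in>carrier R. r \<otimes> \<delta> x)"
definition op_rmult where "op_rmult \<delta> r = (\<lambda>x\<in>carrier R. \<delta> (r \<otimes> x))"

lemmas op_defs = op_add_def op_lmult_def op_rmult_def

lemma op_apply:
  assumes "x \<in> carrier R"
  shows "op_add \<delta> \<epsilon> x = \<delta> x \<oplus> \<epsilon> x" "op_lmult r \<delta> x = r \<otimes> \<delta> x" "op_rmult \<delta> r x = \<delta> (r \<otimes> x)"
    "diff_comm R \<delta> r x = \<delta> (r \<otimes> x) \<ominus> r \<otimes> \<delta> x"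
  using assms by (simp_all add: op_defs diff_comm_def)

lemma op_endos:
  assumes "\<delta> \<in> additive_endos R" "\<epsilon> \<in> additive_endos R" "r \<in> carrier R"
  shows "op_add \<delta> \<epsilon> \<in> additive_endos R" "op_lmult r \<delta> \<in> additive_endos R"
    "op_rmult \<delta> r \<in> additive_endos R"
proof -
  note [simp] = additive_endosD(1,2)[OF assms(1)] additive_endosD(1,2)[OF assms(2)] assms(3)
  show "op_add \<delta> \<epsilon> \<in> additive_endos R"
    unfolding op_defs by (rule additive_endosI) (simp_all add: a_ac)
  show "op_lmult r \<delta> \<in> additive_endos R" "op_rmult \<delta> r \<in> additive_endos R"
    unfolding op_defs by (rule additive_endosI; simp add: r_distr)+
qed

lemma minus_distrib: "r \<in> carrier R \<Longrightarrow> x \<in> carrier R \<Longrightarrow> y \<in> carrier R \<Longrightarrow>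
    r \<otimes> (x \<ominus> y) = r \<otimes> x \<ominus> r \<otimes> y"
  by (simp add: a_minus_def r_distr r_minus)

lemma diff_comm_op:
  assumes "\<delta> \<in> additive_endos R" "\<epsilon> \<in> additive_endos R" "r \<in> carrier R" "s \<in> carrier R"
  shows "diff_comm R (op_add \<delta> \<epsilon>) s = op_add (diff_comm R \<delta> s) (diff_comm R \<epsilon> s)"
    "diff_comm R (op_lmult r \<delta>) s = op_lmult r (diff_comm R \<delta> s)"
    "diff_comm R (op_rmult \<delta> r) s = op_rmult (diff_comm R \<delta> s) r"
    "diff_comm R \<delta> (r \<otimes> s) = op_add (op_rmult (diff_comm R \<delta> r) s) (op_lmult r (diff_comm R \<delta> s))"
proof -
  note [simp] = additive_endosD(1)[OF assms(1)] additive_endosD(1)[OF assms(2)] assms(3,4)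
  show "diff_comm R (op_add \<delta> \<epsilon>) s = op_add (diff_comm R \<delta> s) (diff_comm R \<epsilon> s)"
    unfolding diff_comm_def op_defs
    by (rule restrict_ext) (simp add: a_minus_def r_distr minus_add a_ac)
  show "diff_comm R (op_lmult r \<delta>) s = op_lmult r (diff_comm R \<delta> s)"
    unfolding diff_comm_def op_defs by (rule restrict_ext) (simp add: minus_distrib m_ac)
  show "diff_comm R (op_rmult \<delta> r) s = op_rmult (diff_comm R \<delta> s) r"
    unfolding diff_comm_def op_defs by (rule restrict_ext) (simp add: m_ac)
  show "diff_comm R \<delta> (r \<otimes> s) = op_add (op_rmult (diff_comm R \<delta> r) s) (op_lmult r (diff_comm R \<delta> s))"
    unfolding diff_comm_def op_defs
  proof (rule restrict_ext)
    fix x assume x: "x \<in> carrier R"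
    have "(\<delta> (r \<otimes> (s \<otimes> x)) \<ominus> r \<otimes> \<delta> (s \<otimes> x)) \<oplus> (r \<otimes> \<delta> (s \<otimes> x) \<ominus> r \<otimes> (s \<otimes> \<delta> x)) =
        \<delta> (r \<otimes> (s \<otimes> x)) \<ominus> r \<otimes> (s \<otimes> \<delta> x)"
      using x by (simp add: a_minus_def a_assoc r_neg1)
    then show "\<delta> (r \<otimes> s \<otimes> x) \<ominus> r \<otimes> s \<otimes> \<delta> x =
        (\<lambda>x\<in>carrier R. (\<lambda>x\<in>carrier R. \<delta> (r \<otimes> x) \<ominus> r \<otimes> \<delta> x) (s \<otimes> x)) x \<oplus>
        (\<lambda>x\<in>carrier R. r \<otimes> (\<lambda>x\<in>carrier R. \<delta> (s \<otimes> x) \<ominus> s \<otimes> \<delta> x) x) x"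
      using x by (simp add: minus_distrib m_assoc)
  qed
qed

lemma op_mult_in_diff_ops_le:
  assumes "r \<in> carrier R"
  shows "\<delta> \<in> diff_ops_le R m \<Longrightarrow> op_lmult r \<delta> \<in> diff_ops_le R m \<and> op_rmult \<delta> r \<in> diff_ops_le R m"
proof (induction m arbitrary: \<delta>)
  case 0
  then obtain c where c: "\<delta> = (\<lambda>x\<in>carrier R. c \<otimes> x)" "c \<in> carrier R" by auto
  have "op_lmult r \<delta> = (\<lambda>x\<in>carrier R. (r \<otimes> c) \<otimes> x)" "op_rmult \<delta> r = (\<lambda>x\<in>carrier R. (r \<otimes> c) \<otimes> x)"
    unfolding c(1) op_defs using assms c(2) by (auto intro!: restrict_ext simp: m_ac)
  then show ?case unfolding diff_ops_le.simps using assms c(2) by blast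
next
  case (Suc m)
  then have \<delta>: "\<delta> \<in> additive_endos R" by simp
  show ?case
    using Suc assms op_endos(2,3)[OF \<delta> \<delta> assms] by (simp add: diff_comm_op(2,3)[OF \<delta> \<delta> assms])
qed

lemma diff_ops_le_Suc: "\<delta> \<in> diff_ops_le R m \<Longrightarrow> \<delta> \<in> diff_ops_le R (Suc m)"
proof (induction m arbitrary: \<delta>)
  case 0
  then obtain c where c: "\<delta> = (\<lambda>x\<in>carrier R. c \<otimes> x)" "c \<in> carrier R" by auto
  have "diff_comm R \<delta> r \<in> diff_ops_le R 0" if "r \<in> carrier R" for r
  proof -
    have "diff_comm R \<delta> r = (\<lambda>x\<in>carrier R. \<zero> \<otimes> x)"
      unfolding c(1) diff_comm_def using that c(2)
      by (intro restrict_ext) (simp add: m_ac r_right_minus_eq)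
    then show ?thesis by auto
  qed
  then show ?case using diff_ops_le_endo[OF 0] by simp
next
  case (Suc m)
  then show ?case using diff_ops_le_endo[OF Suc.prems] by simp
qed

context
  fixes M
  assumes M: "submonoid M R"
begin

interpretation L: cring "localization R M"
  by (rule cring_localization[OF M])

lemmas M_simps' = M_closed[OF M] M_mult[OF M] M_one[OF M]
lemmas loc_simps = localization_mult[OF M] localization_add[OF M] fraction_in_localization[OF M]

lemma loc_minus:
  assumes "a \<in> carrier R" "b \<in> carrier R"
  shows "fraction R M a \<one> \<ominus>\<^bsub>localization R M\<^esub> fraction R M b \<one> = fraction R M (a \<ominus> b) \<one>"
proof -
  have "\<ominus>\<^bsub>localization R M\<^esub> fraction R M b \<one> = fraction R M (\<ominus> b) \<one>"
    using assms
    by (intro L.minus_equality) (simp_all add: M_simps' loc_simps l_neg localization_carrier(3)[OF M])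
  then show ?thesis using assms by (simp add: a_minus_def M_simps' loc_simps)
qed

lemma M_endo: "\<delta> \<in> additive_endos R \<Longrightarrow> s \<in> M \<Longrightarrow> diff_comm R \<delta> s \<in> additive_endos R"
  by (intro diff_comm_endo M_simps')

lemma frac_act_closed:
  assumes "\<delta> \<in> additive_endos R" "a \<in> carrier R" "s \<in> M"
  shows "frac_act R M m \<delta> a s \<in> carrier (localization R M)"
  using assms
  by (induction m arbitrary: \<delta>)
    (auto simp: additive_endosD(1) M_simps' loc_simps M_endo intro!: L.m_closed L.minus_closed)

lemma frac_act_add:
  assumes "\<delta> \<in> additive_endos R" "\<epsilon> \<in> additive_endos R" "a \<in> carrier R" "s \<in> M"
  shows "frac_act R M m (op_add \<delta> \<epsilon>) a s =
    frac_act R M m \<delta> a s \<oplus>\<^bsub>localization R M\<^esub> frac_act R M m \<epsilon> a s"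
  using assms
proof (induction m arbitrary: \<delta> \<epsilon>)
  case 0
  have "fraction R M (\<delta> a \<oplus> \<epsilon> a) s = fraction R M (s \<otimes> (\<delta> a \<oplus> \<epsilon> a)) (s \<otimes> s)"
    using 0 by (simp add: fraction_cancel[OF M] additive_endosD(1))
  then show ?case using 0
    by (simp add: op_add_def loc_simps additive_endosD(1) r_distr m_comm M_simps')
next
  case (Suc m)
  have s: "s \<in> carrier R" using Suc M_simps' by auto
  have 1: "fraction R M (\<delta> a \<oplus> \<epsilon> a) \<one> =
      fraction R M (\<delta> a) \<one> \<oplus>\<^bsub>localization R M\<^esub> fraction R M (\<epsilon> a) \<one>"
    using Suc.prems by (simp add: loc_simps additive_endosD(1) M_simps')
  have 2: "frac_act R M m (diff_comm R (op_add \<delta> \<epsilon>) s) a s =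
      frac_act R M m (diff_comm R \<delta> s) a s \<oplus>\<^bsub>localization R M\<^esub> frac_act R M m (diff_comm R \<epsilon> s) a s"
    using Suc s by (simp add: diff_comm_op(1)[where r = s] diff_comm_endo)
  let ?L = "localization R M"
  have alg: "E \<otimes>\<^bsub>?L\<^esub> ((P \<oplus>\<^bsub>?L\<^esub> Q) \<ominus>\<^bsub>?L\<^esub> (Y \<oplus>\<^bsub>?L\<^esub> Z)) =
      E \<otimes>\<^bsub>?L\<^esub> (P \<ominus>\<^bsub>?L\<^esub> Y) \<oplus>\<^bsub>?L\<^esub> E \<otimes>\<^bsub>?L\<^esub> (Q \<ominus>\<^bsub>?L\<^esub> Z)"
    if "E \<in> carrier ?L" "P \<in> carrier ?L" "Q \<in> carrier ?L" "Y \<in> carrier ?L" "Z \<in> carrier ?L" for E P Q Y Z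
    using that by (simp add: a_minus_def L.r_distr L.minus_add L.a_ac)
  show ?case unfolding frac_act.simps 2 op_apply(1)[OF Suc.prems(3)] 1
    using Suc.prems s
    by (intro alg frac_act_closed fraction_in_localization[OF M])
      (auto simp: additive_endosD(1) diff_comm_endo M_simps')
qed

lemma frac_act_lmult:
  assumes "\<delta> \<in> additive_endos R" "a \<in> carrier R" "s \<in> M" "r \<in> carrier R"
  shows "frac_act R M m (op_lmult r \<delta>) a s =
    fraction R M r \<one> \<otimes>\<^bsub>localization R M\<^esub> frac_act R M m \<delta> a s"
  using assms
proof (induction m arbitrary: \<delta>)
  case 0
  then show ?case by (simp add: op_lmult_def loc_simps additive_endosD(1) M_simps')
next
  case (Suc m)
  have s: "s \<in> carrier R" using Suc M_simps' by auto
  have 1: "fraction R M (r \<otimes> \<delta> a) \<one> = fraction R M r \<one> \<otimes>\<^bsub>localization R M\<^esub> fraction R M (\<delta> a) \<one>"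
    using Suc.prems by (simp add: loc_simps additive_endosD(1) M_simps')
  have 2: "frac_act R M m (op_lmult r (diff_comm R \<delta> s)) a s =
      fraction R M r \<one> \<otimes>\<^bsub>localization R M\<^esub> frac_act R M m (diff_comm R \<delta> s) a s"
    using Suc s by (simp add: diff_comm_endo)
  show ?case
    unfolding frac_act.simps diff_comm_op(2)[OF Suc.prems(1,1,4) s] op_apply(2)[OF Suc.prems(2)] 1 2
    using Suc.prems s
    by (simp add: diff_comm_endo frac_act_closed additive_endosD(1) M_simps'
        fraction_in_localization[OF M] cring.minus_distrib[OF L.is_cring, symmetric] L.m_lcomm)
qed

lemma frac_act_rmult:
  assumes "\<delta> \<in> additive_endos R" "a \<in> carrier R" "s \<in> M" "r \<in> carrier R"
  shows "frac_act R M m (op_rmult \<delta> r) a s = frac_act R M m \<delta> (r \<otimes> a) s"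
  using assms
  by (induction m arbitrary: \<delta>)
    (simp_all add: diff_comm_op(3) diff_comm_endo M_simps' op_apply)

lemma frac_act_whole:
  assumes "\<delta> \<in> diff_ops_le R m" "a \<in> carrier R" "s \<in> M"
  shows "frac_act R M m \<delta> (s \<otimes> a) s = fraction R M (\<delta> a) \<one>"
  using assms
proof (induction m arbitrary: \<delta>)
  case 0
  then obtain c where c: "\<delta> = (\<lambda>x\<in>carrier R. c \<otimes> x)" "c \<in> carrier R" by auto
  have "fraction R M (s \<otimes> (c \<otimes> a)) (s \<otimes> \<one>) = fraction R M (c \<otimes> a) \<one>"
    using 0 c(2) by (intro fraction_cancel[OF M]) (auto simp: M_simps')
  then show ?case using 0 c by (simp add: M_simps' m_lcomm)
next
  case (Suc m)
  have s: "s \<in> carrier R" using Suc M_simps' by auto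
  note \<delta> = diff_ops_le_endo[OF Suc.prems(1)]
  have "frac_act R M (Suc m) \<delta> (s \<otimes> a) s = fraction R M \<one> s \<otimes>\<^bsub>localization R M\<^esub>
      fraction R M (\<delta> (s \<otimes> a) \<ominus> (\<delta> (s \<otimes> a) \<ominus> s \<otimes> \<delta> a)) \<one>"
    using Suc s \<delta> by (simp add: loc_minus additive_endosD(1) op_apply(4))
  also have "\<delta> (s \<otimes> a) \<ominus> (\<delta> (s \<otimes> a) \<ominus> s \<otimes> \<delta> a) = s \<otimes> \<delta> a"
    using s Suc.prems \<delta> by (simp add: a_minus_def minus_add additive_endosD(1) r_neg2 minus_minus)
  also have "fraction R M \<one> s \<otimes>\<^bsub>localization R M\<^esub> fraction R M (s \<otimes> \<delta> a) \<one> =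
      fraction R M (s \<otimes> \<delta> a) (s \<otimes> \<one>)"
    using s Suc.prems \<delta> by (simp add: loc_simps additive_endosD(1) M_simps')
  also have "\<dots> = fraction R M (\<delta> a) \<one>"
    using s Suc.prems \<delta> by (intro fraction_cancel[OF M]) (auto simp: M_simps' additive_endosD(1))
  finally show ?case .
qed

lemma frac_act_cancel:
  assumes "\<delta> \<in> diff_ops_le R m" "a \<in> carrier R" "s \<in> M" "u \<in> M"
  shows "frac_act R M m \<delta> (u \<otimes> a) (u \<otimes> s) = frac_act R M m \<delta> a s"
  using assms
proof (induction m arbitrary: \<delta>)
  case 0
  then obtain c where c: "\<delta> = (\<lambda>x\<in>carrier R. c \<otimes> x)" "c \<in> carrier R" by auto
  have "fraction R M (u \<otimes> (c \<otimes> a)) (u \<otimes> s) = fraction R M (c \<otimes> a) s"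
    using 0 c(2) by (intro fraction_cancel[OF M]) auto
  then show ?case using 0 c by (simp add: M_simps' m_lcomm)
next
  case (Suc m)
  let ?L = "localization R M"
  have su: "s \<in> carrier R" "u \<in> carrier R" using Suc M_simps' by auto
  note \<delta> = diff_ops_le_endo[OF Suc.prems(1)]
  note [simp] = additive_endosD(1)[OF \<delta>] su Suc.prems(2-4) diff_comm_endo[OF \<delta>] frac_act_closed
    M_simps' fraction_in_localization[OF M]
  let ?Y = "frac_act R M m (diff_comm R \<delta> s) a s"
  have c: "diff_comm R \<delta> r \<in> diff_ops_le R m" if "r \<in> carrier R" for r
    using Suc.prems that by simp
  have Y: "?Y \<in> carrier ?L" by simp
  have "frac_act R M m (diff_comm R \<delta> (u \<otimes> s)) (u \<otimes> a) (u \<otimes> s) =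
      frac_act R M m (diff_comm R \<delta> (u \<otimes> s)) a s"
    by (rule Suc.IH) (simp_all add: c)
  also have "\<dots> = frac_act R M m (diff_comm R \<delta> u) (s \<otimes> a) s \<oplus>\<^bsub>?L\<^esub> fraction R M u \<one> \<otimes>\<^bsub>?L\<^esub> ?Y"
    unfolding diff_comm_op(4)[OF \<delta> \<delta> su(2,1)]
    using op_endos(3)[OF diff_comm_endo[OF \<delta> su(2)] \<delta> su(1)]
      op_endos(2)[OF diff_comm_endo[OF \<delta> su(1)] \<delta> su(2)]
    by (simp add: frac_act_add frac_act_lmult frac_act_rmult)
  also have "frac_act R M m (diff_comm R \<delta> u) (s \<otimes> a) s = fraction R M (\<delta> (u \<otimes> a) \<ominus> u \<otimes> \<delta> a) \<one>"
    by (subst frac_act_whole) (simp_all add: c, simp add: diff_comm_def)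
  also have "\<dots> = fraction R M (\<delta> (u \<otimes> a)) \<one> \<ominus>\<^bsub>?L\<^esub> fraction R M u \<one> \<otimes>\<^bsub>?L\<^esub> fraction R M (\<delta> a) \<one>"
    by (simp add: loc_minus loc_simps)
  finally have 1: "frac_act R M m (diff_comm R \<delta> (u \<otimes> s)) (u \<otimes> a) (u \<otimes> s) =
      (fraction R M (\<delta> (u \<otimes> a)) \<one> \<ominus>\<^bsub>?L\<^esub> fraction R M u \<one> \<otimes>\<^bsub>?L\<^esub> fraction R M (\<delta> a) \<one>)
      \<oplus>\<^bsub>?L\<^esub> fraction R M u \<one> \<otimes>\<^bsub>?L\<^esub> ?Y" .
  have alg: "P \<ominus>\<^bsub>?L\<^esub> ((P \<ominus>\<^bsub>?L\<^esub> Q) \<oplus>\<^bsub>?L\<^esub> Z) = Q \<ominus>\<^bsub>?L\<^esub> Z"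
    if "P \<in> carrier ?L" "Q \<in> carrier ?L" "Z \<in> carrier ?L" for P Q Z
    using that by (simp add: a_minus_def L.minus_add L.a_assoc L.r_neg2)
  have "frac_act R M (Suc m) \<delta> (u \<otimes> a) (u \<otimes> s) = fraction R M \<one> (u \<otimes> s) \<otimes>\<^bsub>?L\<^esub>
      (fraction R M u \<one> \<otimes>\<^bsub>?L\<^esub> (fraction R M (\<delta> a) \<one> \<ominus>\<^bsub>?L\<^esub> ?Y))"
    unfolding frac_act.simps 1 using Y
    by (simp add: alg cring.minus_distrib[OF L.is_cring] L.m_closed)
  also have "\<dots> = (fraction R M \<one> (u \<otimes> s) \<otimes>\<^bsub>?L\<^esub> fraction R M u \<one>) \<otimes>\<^bsub>?L\<^esub>
      (fraction R M (\<delta> a) \<one> \<ominus>\<^bsub>?L\<^esub> ?Y)"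
    using Y by (simp add: L.m_assoc)
  also have "fraction R M \<one> (u \<otimes> s) \<otimes>\<^bsub>?L\<^esub> fraction R M u \<one> = fraction R M (u \<otimes> \<one>) (u \<otimes> s)"
    by (simp add: localization_mult[OF M])
  also have "\<dots> = fraction R M \<one> s" by (intro fraction_cancel[OF M]) auto
  finally show ?case by simp
qed

lemma frac_act_Suc:
  assumes "\<delta> \<in> diff_ops_le R m" "a \<in> carrier R" "s \<in> M"
  shows "frac_act R M (Suc m) \<delta> a s = frac_act R M m \<delta> a s"
  using assms
proof (induction m arbitrary: \<delta>)
  case 0
  then obtain c where c: "\<delta> = (\<lambda>x\<in>carrier R. c \<otimes> x)" "c \<in> carrier R" by auto
  have s: "s \<in> carrier R" using 0 M_simps' by auto
  have "diff_comm R \<delta> s a = \<zero>" unfolding c(1) diff_comm_def using 0 c(2) s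
    by (simp add: m_ac r_right_minus_eq)
  moreover have "fraction R M \<zero> s = \<zero>\<^bsub>localization R M\<^esub>"
    unfolding localization_carrier(3)[OF M] using 0 s
    by (intro fraction_eqI[OF M, where u = \<one>]) (auto simp: M_simps')
  moreover have "\<delta> a = c \<otimes> a" using c(1) 0 by simp
  ultimately show ?case unfolding frac_act.simps
    using 0 c(2) s by (simp add: loc_simps M_simps' a_minus_def)
next
  case (Suc m)
  have s: "s \<in> carrier R" using Suc M_simps' by auto
  have "frac_act R M (Suc m) (diff_comm R \<delta> s) a s = frac_act R M m (diff_comm R \<delta> s) a s"
    using Suc s by (intro Suc.IH) auto
  then show ?case by (simp only: frac_act.simps(2)[of R M "Suc m" \<delta>] frac_act.simps(2)[of R M m \<delta>])
qed

lemma diff_act_frac: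
  assumes "\<delta> \<in> diff_ops_le R m" "a \<in> carrier R" "s \<in> M"
  shows "diff_act R M \<delta> (fraction R M a s) = frac_act R M m \<delta> a s"
proof -
  define k where "k = (LEAST m. \<delta> \<in> diff_ops_le R m)"
  have k: "\<delta> \<in> diff_ops_le R k" unfolding k_def by (rule LeastI[where P = "\<lambda>m. \<delta> \<in> diff_ops_le R m", OF assms(1)])
  have "k \<le> m" unfolding k_def by (rule Least_le[where P = "\<lambda>m. \<delta> \<in> diff_ops_le R m", OF assms(1)])
  then have "\<delta> \<in> diff_ops_le R m \<and> frac_act R M m \<delta> a s = frac_act R M k \<delta> a s"
  proof (induction m rule: dec_induct)
    case base
    show ?case using k by simp
  next
    case (step n)
    then show ?case using diff_ops_le_Suc frac_act_Suc assms by metis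
  qed
  moreover have "(\<Union>(b, t)\<in>fraction R M a s. frac_act R M k \<delta> b t) = frac_act R M k \<delta> a s"
  proof (rule UN_pair_const[OF fraction_self[OF M assms(2,3)]])
    fix b t assume "(b, t) \<in> fraction R M a s"
    then obtain u where u: "b \<in> carrier R" "t \<in> M" "u \<in> M" "u \<otimes> (a \<otimes> t) = u \<otimes> (b \<otimes> s)"
      by (auto simp: fraction_def)
    have "frac_act R M k \<delta> b t = frac_act R M k \<delta> ((u \<otimes> s) \<otimes> b) ((u \<otimes> s) \<otimes> t)"
      using u assms k by (simp add: frac_act_cancel M_simps')
    also have "(u \<otimes> s) \<otimes> b = (u \<otimes> t) \<otimes> a"
      using u(1-3) assms(2,3) M_simps'(1) u(4)[symmetric] by (simp add: m_assoc m_comm[of s] m_comm[of t])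
    also have "(u \<otimes> s) \<otimes> t = (u \<otimes> t) \<otimes> s"
      using u assms M_simps'(1) by (simp add: m_ac)
    also have "frac_act R M k \<delta> ((u \<otimes> t) \<otimes> a) ((u \<otimes> t) \<otimes> s) = frac_act R M k \<delta> a s"
      using u assms k by (intro frac_act_cancel) (auto simp: M_simps')
    finally show "frac_act R M k \<delta> b t = frac_act R M k \<delta> a s" .
  qed
  ultimately show ?thesis by (simp add: diff_act_def k_def)
qed

end

end

definition diff_submodule :: "('a, 'm) ring_scheme \<Rightarrow> 'a set \<Rightarrow> ('a \<times> 'a) set set \<Rightarrow> bool" where
  "diff_submodule R M N \<longleftrightarrow>
     subgroup N (add_monoid (localization R M)) \<and>
     (\<forall>\<delta>\<in>diff_ops R. \<forall>x\<in>N. diff_act R M \<delta> x \<in> N)"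

definition diff_span ::
  "('a, 'm) ring_scheme \<Rightarrow> 'a set \<Rightarrow> ('a \<times> 'a) set set \<Rightarrow> ('a \<times> 'a) set set" where
  "diff_span R M X = \<Inter>{N. diff_submodule R M N \<and> X \<subseteq> N}"

end

theory Submission
  imports Defs
begin

text \<open>The idea. Suppose that for each \<open>k\<close> some \<open>\<delta>\<close> in \<open>D\<^sub>R\<close> takes \<open>1/f\<close> to \<open>1/f^(p^k)\<close>. Then \<open>1/f\<close>
  generates \<open>R\<^sub>f\<close>, because every fraction is a multiple of some \<open>1/f^(p^k)\<close> (\<open>diff_span_inverse\<close>). An
  additive map \<open>\<delta> : R \<rightarrow> R\<close> that is linear over the \<open>q\<close>-th powers, \<open>q = p^e\<close>, lies in \<open>D\<^sub>R\<close> when \<open>R\<close> is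
  \<open>F\<close>-finite (\<open>power_linear_diff_op\<close>), and it takes \<open>1/f = f^(q-1)/f^q\<close> to \<open>\<delta>(f^(q-1))/f^q\<close>. So it must
  take \<open>f^(q-1)\<close> to \<open>f^(q-p^k)\<close>. If \<open>\<delta>\<close> does this on \<open>S\<close> and \<open>\<beta> : S \<rightarrow> R\<close> splits the inclusion, then
  \<open>\<beta> \<circ> \<delta>\<close> does it on \<open>R\<close>, because \<open>\<beta>\<close> is \<open>R\<close>-linear and fixes the powers of \<open>f\<close>. Thus the whole
  problem lies on the regular ring \<open>S\<close>.

  On \<open>S\<close>, call \<open>\<theta>\<close> a Cartier map of level \<open>e\<close> if it is additive and \<open>\<theta>(a^q s) = a \<theta>(s)\<close>, and let
  \<open>M\<^sub>e\<close> be the ideal of all \<open>\<theta>(f^(q-1))\<close>. These ideals decrease, and \<open>M\<^sub>e\<^sub>+\<^sub>1\<close> arises from \<open>M\<^sub>e\<close> by a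
  fixed \<open>p\<close>-inverse linear operation; the argument of Hartshorne, Speiser, Lyubeznik and Gabber shows
  that such a sequence becomes stationary (\<open>cartier_ideals_stabilize\<close>). Regularity enters through
  Kunz's theorem: Frobenius is flat, so that, as \<open>S\<close> is \<open>F\<close>-finite, the identity of \<open>S\<close> is a finite sum
  \<open>s = \<Sum> \<eta>\<^sub>j(s)^q t\<^sub>j\<close> with Cartier maps \<open>\<eta>\<^sub>j\<close> (\<open>factorizable_identity\<close>). Put \<open>s = f^(q-1)\<close>, write each
  \<open>\<eta>\<^sub>j(f^(q-1))\<close>, which lies in \<open>M\<^sub>e = M\<^sub>e\<^sub>+\<^sub>k\<close>, as \<open>\<theta>\<^sub>j(f^(q p^k - 1))\<close>, and raise the equation to the
  power \<open>p^k\<close>: the result is a linear operator over the \<open>q p^k\<close>-th powers that takes \<open>f^(q p^k - 1)\<close> to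
  \<open>f^(q p^k - p^k)\<close> (\<open>ex_power_linear_of_stable\<close>).

  Kunz's theorem is proved by counting lengths. For primes \<open>Q \<subset> Q'\<close> without a prime between them,
  any list that generates \<open>S/Q\<close> generically over its \<open>p\<close>-th powers is at least \<open>p\<close> times as long as
  some such list for \<open>S/Q'\<close> (\<open>frobenius_rank_step\<close>). Along a chain of \<open>d = dim S\<^sub>P\<close> steps from \<open>0\<close> to
  \<open>P\<close>, this bounds the rank of \<open>S\<close> over its \<open>p\<close>-th powers from below by \<open>p^d n\<close>, where \<open>n\<close> is the
  rank for \<open>S/P\<close>. On the other hand \<open>P\<close> is generated at \<open>P\<close> by \<open>d\<close> elements, and by Nakayama's lemma
  their monomials of exponents less than \<open>p\<close>, multiplied by \<open>n\<close> elements that generate \<open>S/P\<close> generically, are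
  \<open>p^d n\<close> generators at \<open>P\<close>. As they cannot be fewer, they are a basis
  (\<open>ex_local_frobenius_basis\<close>).

  Most statements about \<open>S\<^sub>P\<close> are expressed through multipliers outside \<open>P\<close> instead of fractions.\<close>

section \<open>Submodules for a twisted action\<close>

text \<open>The ring acts on itself by \<open>a \<cdot> x = \<sigma>(a) x\<close>. With \<open>\<sigma> = id\<close> the submodules are the ideals; with the
  Frobenius endomorphism they are the submodules over the subring of \<open>p\<close>-th powers. Closure under
  negation follows, as \<open>-x = \<sigma>(-1) x\<close>.\<close>

definition twisted_submodule :: "('a, 'm) ring_scheme \<Rightarrow> ('a \<Rightarrow> 'a) \<Rightarrow> 'a set \<Rightarrow> bool" where
  "twisted_submodule R \<sigma> X \<longleftrightarrow> X \<subseteq> carrier R \<and> \<zero>\<^bsub>R\<^esub> \<in> X \<and> (\<forall>x\<in>X. \<forall>y\<in>X. x \<oplus>\<^bsub>R\<^esub> y \<in> X) \<and>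
     (\<forall>a\<in>carrier R. \<forall>x\<in>X. \<sigma> a \<otimes>\<^bsub>R\<^esub> x \<in> X)"

text \<open>The contraction to \<open>R\<close> of the localization of \<open>X\<close> at \<open>P\<close>. Hence \<open>Y \<subseteq> saturation R \<sigma> P X\<close> says that
  \<open>Y\<close> is contained in \<open>X\<close> locally at \<open>P\<close>.\<close>

definition saturation ::
  "('a, 'm) ring_scheme \<Rightarrow> ('a \<Rightarrow> 'a) \<Rightarrow> 'a set \<Rightarrow> 'a set \<Rightarrow> 'a set" where
  "saturation R \<sigma> P X = {s \<in> carrier R. \<exists>c\<in>carrier R - P. \<sigma> c \<otimes>\<^bsub>R\<^esub> s \<in> X}"

text \<open>The base \<open>X\<close> is a parameter because spans are needed modulo a prime, and because spans of long lists
  are studied one generator at a time.\<close>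

primrec twisted_span ::
  "('a, 'm) ring_scheme \<Rightarrow> ('a \<Rightarrow> 'a) \<Rightarrow> 'a set \<Rightarrow> 'a list \<Rightarrow> 'a set" where
  "twisted_span R \<sigma> X [] = X"
| "twisted_span R \<sigma> X (w # ws) =
     {\<sigma> a \<otimes>\<^bsub>R\<^esub> w \<oplus>\<^bsub>R\<^esub> y | a y. a \<in> carrier R \<and> y \<in> twisted_span R \<sigma> X ws}"

text \<open>A chain of submodules between \<open>X\<close> and \<open>Y\<close> whose \<open>n\<close> steps stay strict after localization at \<open>P\<close>.
  The longest such chains measure the length of the localization of \<open>Y/X\<close>.\<close>

primrec local_chain ::
  "('a, 'm) ring_scheme \<Rightarrow> ('a \<Rightarrow> 'a) \<Rightarrow> 'a set \<Rightarrow> nat \<Rightarrow> 'a set \<Rightarrow> 'a set \<Rightarrow> bool" where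
  "local_chain R \<sigma> P 0 X Y \<longleftrightarrow> twisted_submodule R \<sigma> X \<and> twisted_submodule R \<sigma> Y \<and> X \<subseteq> Y"
| "local_chain R \<sigma> P (Suc n) X Y \<longleftrightarrow> twisted_submodule R \<sigma> Y \<and>
     (\<exists>Z. local_chain R \<sigma> P n X Z \<and> Z \<subseteq> Y \<and> \<not> Y \<subseteq> saturation R \<sigma> P Z)"

definition local_length_le ::
  "('a, 'm) ring_scheme \<Rightarrow> ('a \<Rightarrow> 'a) \<Rightarrow> 'a set \<Rightarrow> nat \<Rightarrow> 'a set \<Rightarrow> 'a set \<Rightarrow> bool" where
  "local_length_le R \<sigma> P n X Y \<longleftrightarrow> (\<forall>m. local_chain R \<sigma> P m X Y \<longrightarrow> m \<le> n)"

locale twisted_ring = cring R for R (structure) +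
  fixes \<sigma> :: "'a \<Rightarrow> 'a"
  assumes sigma_closed: "a \<in> carrier R \<Longrightarrow> \<sigma> a \<in> carrier R"
    and sigma_add: "a \<in> carrier R \<Longrightarrow> b \<in> carrier R \<Longrightarrow> \<sigma> (a \<oplus> b) = \<sigma> a \<oplus> \<sigma> b"
    and sigma_mult: "a \<in> carrier R \<Longrightarrow> b \<in> carrier R \<Longrightarrow> \<sigma> (a \<otimes> b) = \<sigma> a \<otimes> \<sigma> b"
    and sigma_one: "\<sigma> \<one> = \<one>"
begin

abbreviation "submod \<equiv> twisted_submodule R \<sigma>"
abbreviation "sat \<equiv> saturation R \<sigma>"
abbreviation "span_over \<equiv> twisted_span R \<sigma>"
abbreviation sum_mod (infixl "\<boxplus>" 65) where "X \<boxplus> Y \<equiv> set_add R X Y"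
abbreviation "chain \<equiv> local_chain R \<sigma>"

lemma sigma_zero: "\<sigma> \<zero> = \<zero>"
proof -
  have "\<sigma> \<zero> \<oplus> \<sigma> \<zero> = \<sigma> \<zero>" using sigma_add[of \<zero> \<zero>] by (simp add: sigma_closed)
  then show ?thesis using add.l_cancel_one' by (metis sigma_closed zero_closed)
qed

lemma sigma_minus: "a \<in> carrier R \<Longrightarrow> \<sigma> (\<ominus> a) = \<ominus> \<sigma> a"
  using sigma_add[of "\<ominus> a" a] minus_equality[of "\<sigma> (\<ominus> a)" "\<sigma> a"] by (simp add: l_neg sigma_closed sigma_zero)

context
  notes [simp] = sigma_closed sigma_one sigma_zero
begin

lemma submodI:
  assumes "X \<subseteq> carrier R" "\<zero> \<in> X" "\<And>x y. x \<in> X \<Longrightarrow> y \<in> X \<Longrightarrow> x \<oplus> y \<in> X"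
    "\<And>a x. a \<in> carrier R \<Longrightarrow> x \<in> X \<Longrightarrow> \<sigma> a \<otimes> x \<in> X"
  shows "submod X"
  using assms by (auto simp: twisted_submodule_def)

lemma submodD:
  assumes "submod X"
  shows "x \<in> X \<Longrightarrow> x \<in> carrier R" "\<zero> \<in> X" "x \<in> X \<Longrightarrow> y \<in> X \<Longrightarrow> x \<oplus> y \<in> X"
    "a \<in> carrier R \<Longrightarrow> x \<in> X \<Longrightarrow> \<sigma> a \<otimes> x \<in> X"
  using assms by (auto simp: twisted_submodule_def)

lemma submod_uminus:
  assumes "submod X" "x \<in> X"
  shows "\<ominus> x \<in> X"
proof -
  have "\<sigma> (\<ominus> \<one>) \<otimes> x = \<ominus> x" using submodD(1)[OF assms] by (simp add: sigma_minus l_minus)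
  then show ?thesis using submodD(4)[OF assms(1) _ assms(2)] by (metis a_inv_closed one_closed)
qed

lemma submod_minus:
  assumes "submod X" "x \<in> X" "y \<in> X"
  shows "x \<ominus> y \<in> X"
  using submod_uminus assms submodD(3) by (simp add: a_minus_def)

lemma submod_cancel:
  assumes "submod X" "x \<oplus> y \<in> X" "y \<in> X" "x \<in> carrier R"
  shows "x \<in> X"
proof -
  have "(x \<oplus> y) \<ominus> y = x" using assms submodD(1)[OF assms(1)] by (simp add: a_minus_def a_assoc r_neg)
  then show ?thesis using submod_minus[OF assms(1-3)] by simp
qed

lemma submod_Int: "submod X \<Longrightarrow> submod Y \<Longrightarrow> submod (X \<inter> Y)"
  by (auto simp: twisted_submodule_def)

lemma submod_carrier: "submod (carrier R)"
  by (auto simp: twisted_submodule_def)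

lemma set_add_iff: "z \<in> X \<boxplus> Y \<longleftrightarrow> (\<exists>x\<in>X. \<exists>y\<in>Y. z = x \<oplus> y)"
  by (auto simp: set_add_def')

lemma submod_set_add:
  assumes "submod X" "submod Y"
  shows "submod (X \<boxplus> Y)"
proof (rule submodI)
  show "X \<boxplus> Y \<subseteq> carrier R" using assms by (auto simp: set_add_iff submodD(1))
  show "\<zero> \<in> X \<boxplus> Y" unfolding set_add_iff using assms submodD(2) by (metis l_zero zero_closed)
  fix u v assume "u \<in> X \<boxplus> Y" "v \<in> X \<boxplus> Y"
  then obtain x y x' y' where *: "x \<in> X" "y \<in> Y" "x' \<in> X" "y' \<in> Y" "u = x \<oplus> y" "v = x' \<oplus> y'"
    unfolding set_add_iff by blast
  then have "u \<oplus> v = (x \<oplus> x') \<oplus> (y \<oplus> y')" using submodD(1) assms by (simp add: a_ac)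
  then show "u \<oplus> v \<in> X \<boxplus> Y" unfolding set_add_iff using * assms submodD(3) by metis
next
  fix a u assume a: "a \<in> carrier R" and "u \<in> X \<boxplus> Y"
  then obtain x y where *: "x \<in> X" "y \<in> Y" "u = x \<oplus> y" unfolding set_add_iff by blast
  then have "\<sigma> a \<otimes> u = \<sigma> a \<otimes> x \<oplus> \<sigma> a \<otimes> y" using a submodD(1) assms by (simp add: r_distr)
  then show "\<sigma> a \<otimes> u \<in> X \<boxplus> Y" unfolding set_add_iff using * a assms submodD(4) by metis
qed

lemma set_add_upper:
  assumes "submod X" "submod Y"
  shows "X \<subseteq> X \<boxplus> Y" "Y \<subseteq> X \<boxplus> Y"
proof -
  have "x \<in> X \<boxplus> Y" if "x \<in> X" for x
    unfolding set_add_iff using that assms submodD by (metis r_zero)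
  moreover have "y \<in> X \<boxplus> Y" if "y \<in> Y" for y
    unfolding set_add_iff using that assms submodD by (metis l_zero)
  ultimately show "X \<subseteq> X \<boxplus> Y" "Y \<subseteq> X \<boxplus> Y" by auto
qed

lemma set_add_least: "submod Z \<Longrightarrow> X \<subseteq> Z \<Longrightarrow> Y \<subseteq> Z \<Longrightarrow> X \<boxplus> Y \<subseteq> Z"
  by (auto simp: set_add_iff submodD(3) subset_iff)

lemma set_add_mono: "X \<subseteq> X' \<Longrightarrow> Y \<subseteq> Y' \<Longrightarrow> X \<boxplus> Y \<subseteq> X' \<boxplus> Y'"
  by (fastforce simp: set_add_iff)

lemma submod_mult_image:
  assumes X: "submod X" and u: "u \<in> carrier R"
  shows "submod ((\<otimes>) u ` X)"
proof (rule submodI)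
  show "(\<otimes>) u ` X \<subseteq> carrier R" using assms submodD(1) by auto
  show "\<zero> \<in> (\<otimes>) u ` X" using u submodD(2)[OF X] by (metis imageI r_null)
next
  fix x y assume "x \<in> (\<otimes>) u ` X" "y \<in> (\<otimes>) u ` X"
  then obtain a b where ab: "a \<in> X" "b \<in> X" "x = u \<otimes> a" "y = u \<otimes> b" by auto
  then have "x \<oplus> y = u \<otimes> (a \<oplus> b)" using u submodD(1)[OF X] by (simp add: r_distr)
  then show "x \<oplus> y \<in> (\<otimes>) u ` X" using ab submodD(3)[OF X] by auto
next
  fix a x assume a: "a \<in> carrier R" "x \<in> (\<otimes>) u ` X"
  then obtain b where b: "b \<in> X" "x = u \<otimes> b" by auto
  then have "\<sigma> a \<otimes> x = u \<otimes> (\<sigma> a \<otimes> b)" using u a submodD(1)[OF X] by (simp add: m_lcomm)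
  then show "\<sigma> a \<otimes> x \<in> (\<otimes>) u ` X" using b a submodD(4)[OF X] by auto
qed

section \<open>Spans\<close>

lemma span_ConsI: "a \<in> carrier R \<Longrightarrow> y \<in> span_over X ws \<Longrightarrow> \<sigma> a \<otimes> w \<oplus> y \<in> span_over X (w # ws)"
  by auto

lemma submod_span: "submod X \<Longrightarrow> set ws \<subseteq> carrier R \<Longrightarrow> submod (span_over X ws)"
proof (induction ws)
  case (Cons w ws)
  let ?V = "span_over X ws"
  have V: "submod ?V" and w: "w \<in> carrier R" using Cons by auto
  show ?case
  proof (rule submodI)
    show "span_over X (w # ws) \<subseteq> carrier R" using V w submodD(1) by auto
    have "\<sigma> \<zero> \<otimes> w \<oplus> \<zero> \<in> span_over X (w # ws)" using submodD(2)[OF V] by (intro span_ConsI) auto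
    then show "\<zero> \<in> span_over X (w # ws)" using w by simp
  next
    fix x y assume "x \<in> span_over X (w # ws)" "y \<in> span_over X (w # ws)"
    then obtain a b u v where *: "a \<in> carrier R" "b \<in> carrier R" "u \<in> ?V" "v \<in> ?V"
      and xy: "x = \<sigma> a \<otimes> w \<oplus> u" "y = \<sigma> b \<otimes> w \<oplus> v" by auto
    have "x \<oplus> y = \<sigma> (a \<oplus> b) \<otimes> w \<oplus> (u \<oplus> v)"
      unfolding xy using * w submodD(1)[OF V] by (simp add: sigma_add l_distr a_ac)
    then show "x \<oplus> y \<in> span_over X (w # ws)" using * submodD(3)[OF V] by auto
  next
    fix c x assume c: "c \<in> carrier R" and "x \<in> span_over X (w # ws)"
    then obtain a u where *: "a \<in> carrier R" "u \<in> ?V" and x: "x = \<sigma> a \<otimes> w \<oplus> u" by auto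
    have "\<sigma> c \<otimes> x = \<sigma> (c \<otimes> a) \<otimes> w \<oplus> \<sigma> c \<otimes> u"
      unfolding x using * c w submodD(1)[OF V] by (simp add: sigma_mult r_distr m_assoc)
    then show "\<sigma> c \<otimes> x \<in> span_over X (w # ws)" using * c submodD(4)[OF V] by auto
  qed
qed simp

lemma span_Cons_upper:
  assumes "submod X" "set (w # ws) \<subseteq> carrier R"
  shows "span_over X ws \<subseteq> span_over X (w # ws)" "w \<in> span_over X (w # ws)"
proof -
  have V: "submod (span_over X ws)" using submod_span assms by simp
  have w: "w \<in> carrier R" using assms by simp
  show "span_over X ws \<subseteq> span_over X (w # ws)"
  proof
    fix y assume y: "y \<in> span_over X ws"
    have "\<sigma> \<zero> \<otimes> w \<oplus> y \<in> span_over X (w # ws)" using y by (intro span_ConsI) auto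
    then show "y \<in> span_over X (w # ws)" using w y submodD(1)[OF V] by simp
  qed
  have "\<sigma> \<one> \<otimes> w \<oplus> \<zero> \<in> span_over X (w # ws)" using submodD(2)[OF V] by (intro span_ConsI) auto
  then show "w \<in> span_over X (w # ws)" using w by simp
qed

lemma span_upper:
  assumes X: "submod X" and ws: "set ws \<subseteq> carrier R"
  shows "X \<subseteq> span_over X ws" "set ws \<subseteq> span_over X ws"
proof -
  have "X \<subseteq> span_over X ws \<and> set ws \<subseteq> span_over X ws"
    using ws
  proof (induction ws)
    case (Cons w ws)
    then have "X \<subseteq> span_over X ws" "set ws \<subseteq> span_over X ws" by auto
    then show ?case using span_Cons_upper[OF X Cons.prems]
      by (simp only: list.set insert_subset) blast
  qed simp
  then show "X \<subseteq> span_over X ws" "set ws \<subseteq> span_over X ws" by auto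
qed

lemma span_least:
  assumes "submod Z" "X \<subseteq> Z" "set ws \<subseteq> Z"
  shows "span_over X ws \<subseteq> Z"
  using assms(2,3) by (induction ws) (auto intro!: submodD(3,4)[OF assms(1)])

lemma span_mono:
  assumes "submod X" "submod Y" "X \<subseteq> Y" "set vs \<subseteq> set ws" "set ws \<subseteq> carrier R"
  shows "span_over X vs \<subseteq> span_over Y ws"
  using assms span_upper[of Y ws] submod_span[of Y ws] by (intro span_least) auto

section \<open>Saturation at a prime\<close>

context
  fixes P
  assumes P: "primeideal P R"
begin

lemma denominators: "\<one> \<in> carrier R - P"
  "c \<in> carrier R - P \<Longrightarrow> d \<in> carrier R - P \<Longrightarrow> c \<otimes> d \<in> carrier R - P"
proof -
  show "\<one> \<in> carrier R - P"
    using P ideal.one_imp_carrier primeideal.I_notcarr primeideal.axioms(1) by fastforce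
  show "c \<otimes> d \<in> carrier R - P" if "c \<in> carrier R - P" "d \<in> carrier R - P"
    using that primeideal.I_prime[OF P, of c d] by auto
qed

lemma satI: "c \<in> carrier R - P \<Longrightarrow> s \<in> carrier R \<Longrightarrow> \<sigma> c \<otimes> s \<in> X \<Longrightarrow> s \<in> sat P X"
  by (auto simp: saturation_def)

lemma satE:
  assumes "s \<in> sat P X"
  obtains c where "c \<in> carrier R - P" "s \<in> carrier R" "\<sigma> c \<otimes> s \<in> X"
  using assms by (auto simp: saturation_def)

lemma sat_mono: "X \<subseteq> Y \<Longrightarrow> sat P X \<subseteq> sat P Y"
  by (auto simp: saturation_def)

lemma sat_upper: "submod X \<Longrightarrow> X \<subseteq> sat P X"
  using denominators(1) submodD(1,4) by (fastforce intro!: satI[of \<one>])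

lemma submod_sat:
  assumes X: "submod X"
  shows "submod (sat P X)"
proof (rule submodI)
  show "sat P X \<subseteq> carrier R" by (auto simp: saturation_def)
  show "\<zero> \<in> sat P X" using sat_upper[OF X] submodD(2)[OF X] by auto
next
  fix x y assume "x \<in> sat P X" "y \<in> sat P X"
  then obtain c d where *: "c \<in> carrier R - P" "d \<in> carrier R - P" "x \<in> carrier R" "y \<in> carrier R"
    and cx: "\<sigma> c \<otimes> x \<in> X" and dy: "\<sigma> d \<otimes> y \<in> X" by (metis satE)
  have cd: "c \<in> carrier R" "d \<in> carrier R" using * by auto
  have "\<sigma> d \<otimes> (\<sigma> c \<otimes> x) \<oplus> \<sigma> c \<otimes> (\<sigma> d \<otimes> y) \<in> X"
    by (intro submodD(3)[OF X] submodD(4)[OF X] cx dy cd)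
  also have "\<sigma> d \<otimes> (\<sigma> c \<otimes> x) \<oplus> \<sigma> c \<otimes> (\<sigma> d \<otimes> y) = \<sigma> (c \<otimes> d) \<otimes> (x \<oplus> y)"
    using cd *(3,4) by (simp add: sigma_mult r_distr m_ac)
  finally show "x \<oplus> y \<in> sat P X" using denominators(2)[OF *(1,2)] *(3,4) by (auto intro: satI)
next
  fix a x assume a: "a \<in> carrier R" and "x \<in> sat P X"
  then obtain c where *: "c \<in> carrier R - P" "x \<in> carrier R" "\<sigma> c \<otimes> x \<in> X" by (metis satE)
  then have "\<sigma> c \<otimes> (\<sigma> a \<otimes> x) \<in> X"
    using submodD(4)[OF X a *(3)] a by (simp add: m_lcomm)
  then show "\<sigma> a \<otimes> x \<in> sat P X" using * a by (auto intro: satI)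
qed

lemma sat_idem: "submod X \<Longrightarrow> sat P (sat P X) \<subseteq> sat P X"
proof
  fix x assume X: "submod X" and "x \<in> sat P (sat P X)"
  then obtain c d where *: "c \<in> carrier R - P" "d \<in> carrier R - P" "x \<in> carrier R"
    "\<sigma> d \<otimes> (\<sigma> c \<otimes> x) \<in> X" by (metis satE)
  then have "\<sigma> (d \<otimes> c) \<otimes> x \<in> X" by (simp add: sigma_mult m_assoc)
  then show "x \<in> sat P X" using * denominators(2) by (metis satI)
qed

lemma sat_trans: "submod Z \<Longrightarrow> X \<subseteq> sat P Y \<Longrightarrow> Y \<subseteq> sat P Z \<Longrightarrow> X \<subseteq> sat P Z"
  using sat_mono sat_idem by blast

text \<open>The product of finitely many denominators is again a denominator, as \<open>P\<close> is prime.\<close>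

lemma common_denominator:
  assumes "submod X" "finite B" "B \<subseteq> sat P X"
  shows "\<exists>c\<in>carrier R - P. \<forall>b\<in>B. \<sigma> c \<otimes> b \<in> X"
  using assms(2,3)
proof (induction B)
  case empty
  then show ?case using denominators(1) by auto
next
  case (insert b B)
  then obtain c d where *: "c \<in> carrier R - P" "d \<in> carrier R - P" "b \<in> carrier R"
    and c: "\<forall>b\<in>B. \<sigma> c \<otimes> b \<in> X" and d: "\<sigma> d \<otimes> b \<in> X" by (metis insert_subset satE)
  have car: "c \<in> carrier R" "d \<in> carrier R" using * by auto
  have "\<sigma> (c \<otimes> d) \<otimes> b' \<in> X" if b': "b' \<in> B" for b'
  proof -
    have "b' \<in> carrier R" using b' insert.prems by (auto simp: saturation_def)
    then have "\<sigma> (c \<otimes> d) \<otimes> b' = \<sigma> d \<otimes> (\<sigma> c \<otimes> b')" using car by (simp add: sigma_mult m_ac)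
    then show ?thesis using c b' submodD(4)[OF assms(1) car(2)] by simp
  qed
  moreover have "\<sigma> (c \<otimes> d) \<otimes> b \<in> X"
    using submodD(4)[OF assms(1) car(1) d] car *(3) by (simp add: sigma_mult m_assoc)
  ultimately show ?case using denominators(2)[OF *(1,2)] by auto
qed

section \<open>Chains that are strict at a prime\<close>

lemma chain_submod: "chain P n X Y \<Longrightarrow> submod X \<and> submod Y \<and> X \<subseteq> Y"
  by (induction n arbitrary: Y) auto

lemma chain_mono:
  "chain P n X Y \<Longrightarrow> submod X' \<Longrightarrow> submod Y' \<Longrightarrow> X' \<subseteq> X \<Longrightarrow> Y \<subseteq> Y' \<Longrightarrow> chain P n X' Y'"
proof (induction n arbitrary: Y Y')
  case (Suc n)
  then obtain Z where Z: "chain P n X Z" "Z \<subseteq> Y" "\<not> Y \<subseteq> sat P Z" by auto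
  have "chain P n X' Z" by (rule Suc.IH[OF Z(1)]) (use Suc.prems chain_submod[OF Z(1)] in auto)
  moreover have "Z \<subseteq> Y'" "\<not> Y' \<subseteq> sat P Z" using Z Suc.prems by blast+
  ultimately show ?case using Suc.prems by (simp only: local_chain.simps) blast
qed auto

lemma chain_SucD: "chain P (Suc n) X Y \<Longrightarrow> chain P n X Y"
  using chain_mono chain_submod by (metis local_chain.simps(2) order_refl)

lemma chain_le: "chain P n X Y \<Longrightarrow> m \<le> n \<Longrightarrow> chain P m X Y"
proof (induction n)
  case (Suc n)
  then show ?case by (cases "m = Suc n") (use chain_SucD in auto)
qed simp

lemma chain_concat: "chain P n Y Z \<Longrightarrow> chain P m X Y \<Longrightarrow> chain P (m + n) X Z"
proof (induction n arbitrary: Z)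
  case 0
  then show ?case using chain_mono chain_submod
    by (metis add_0_right local_chain.simps(1) order_refl)
qed auto

text \<open>Subadditivity of length: by the modular law, a strict step \<open>Z' \<subset> Z\<close> stays strict after intersecting
  with \<open>Y\<close> or after adding \<open>Y\<close>.\<close>

lemma chain_modular:
  assumes Y: "submod Y"
  shows "chain P n X Z \<Longrightarrow>
    \<exists>a b. n \<le> a + b \<and> chain P a (X \<inter> Y) (Z \<inter> Y) \<and> chain P b (X \<boxplus> Y) (Z \<boxplus> Y)"
proof (induction n arbitrary: Z)
  case 0
  then show ?case using Y by (intro exI[of _ 0]) (auto simp: submod_Int submod_set_add set_add_mono)
next
  case (Suc n)
  then obtain Z' where Z': "chain P n X Z'" "Z' \<subseteq> Z" and n: "\<not> Z \<subseteq> sat P Z'" and Z: "submod Z" by auto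
  then obtain a b where ab: "n \<le> a + b" "chain P a (X \<inter> Y) (Z' \<inter> Y)" "chain P b (X \<boxplus> Y) (Z' \<boxplus> Y)"
    using Suc.IH by blast
  have subs: "submod Z'" "submod (Z \<inter> Y)" "submod (Z \<boxplus> Y)" "submod X"
    using Z Z' Y chain_submod submod_Int submod_set_add by blast+
  have sub: "Z' \<inter> Y \<subseteq> Z \<inter> Y" "Z' \<boxplus> Y \<subseteq> Z \<boxplus> Y" using Z' set_add_mono by blast+
  have "\<not> Z \<inter> Y \<subseteq> sat P (Z' \<inter> Y) \<or> \<not> Z \<boxplus> Y \<subseteq> sat P (Z' \<boxplus> Y)"
  proof (rule ccontr, simp, elim conjE)
    assume h1: "Z \<inter> Y \<subseteq> sat P (Z' \<inter> Y)" and h2: "Z \<boxplus> Y \<subseteq> sat P (Z' \<boxplus> Y)"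
    have "z \<in> sat P Z'" if z: "z \<in> Z" for z
    proof -
      have "z \<in> sat P (Z' \<boxplus> Y)" using h2 set_add_upper(1)[OF Z Y] z by auto
      then obtain c z' y where c: "c \<in> carrier R - P" and eq: "\<sigma> c \<otimes> z = z' \<oplus> y"
        and z': "z' \<in> Z'" and y: "y \<in> Y" by (elim satE) (auto simp: set_add_iff)
      have car: "z' \<in> carrier R" "y \<in> carrier R" "z \<in> carrier R"
        using z' y z subs Y Z submodD(1) by blast+
      have "y \<oplus> z' = \<sigma> c \<otimes> z" unfolding eq using car by (simp add: a_comm)
      then have "y \<oplus> z' \<in> Z" using c z submodD(4)[OF Z] by auto
      then have "y \<in> Z" using submod_cancel[OF Z] z' Z'(2) car by blast
      then have "y \<in> sat P (Z' \<inter> Y)" using y h1 by auto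
      then have "y \<in> sat P Z'" using sat_mono[of "Z' \<inter> Y" Z'] by auto
      moreover have "z' \<in> sat P Z'" using z' sat_upper subs by auto
      ultimately have "\<sigma> c \<otimes> z \<in> sat P Z'" unfolding eq using submod_sat subs submodD(3) by blast
      then have "z \<in> sat P (sat P Z')" using c car by (rule_tac satI[of c]) auto
      then show ?thesis using sat_idem subs by auto
    qed
    then show False using n by blast
  qed
  then show ?case
  proof
    assume *: "\<not> Z \<inter> Y \<subseteq> sat P (Z' \<inter> Y)"
    then have "chain P (Suc a) (X \<inter> Y) (Z \<inter> Y)" using ab sub subs by auto
    moreover have "chain P b (X \<boxplus> Y) (Z \<boxplus> Y)"
      using chain_mono[OF ab(3)] sub subs chain_submod[OF ab(3)] by blast
    ultimately show ?thesis using ab(1) by (intro exI[of _ "Suc a"] exI[of _ b]) simp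
  next
    assume *: "\<not> Z \<boxplus> Y \<subseteq> sat P (Z' \<boxplus> Y)"
    then have "chain P (Suc b) (X \<boxplus> Y) (Z \<boxplus> Y)" using ab sub subs by auto
    moreover have "chain P a (X \<inter> Y) (Z \<inter> Y)"
      using chain_mono[OF ab(2)] sub subs chain_submod[OF ab(2)] by blast
    ultimately show ?thesis using ab(1) by (intro exI[of _ a] exI[of _ "Suc b"]) simp
  qed
qed

lemma set_add_absorb: "submod X \<Longrightarrow> submod Y \<Longrightarrow> X \<subseteq> Y \<Longrightarrow> X \<boxplus> Y = Y"
  "submod X \<Longrightarrow> submod Y \<Longrightarrow> X \<subseteq> Y \<Longrightarrow> Y \<boxplus> X = Y"
  using set_add_upper set_add_least by (metis order_refl subset_antisym)+

lemma chain_split: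
  assumes "chain P n X Z" "submod Y" "X \<subseteq> Y" "Y \<subseteq> Z"
  shows "\<exists>a b. n \<le> a + b \<and> chain P a X Y \<and> chain P b Y Z"
proof -
  have "submod X" "submod Z" using chain_submod[OF assms(1)] by auto
  then have "X \<inter> Y = X" "Z \<inter> Y = Y" "X \<boxplus> Y = Y" "Z \<boxplus> Y = Z"
    using assms set_add_absorb by auto
  then show ?thesis using chain_modular[OF assms(2,1)] by simp
qed

text \<open>Multiplication by \<open>u\<close> is injective modulo a prime \<open>Q\<close> that does not contain \<open>u\<close>, so that it
  preserves strict inclusions of submodules containing \<open>Q\<close>.\<close>

lemma chain_mult_image:
  assumes Q: "primeideal Q R" and u: "u \<in> carrier R - Q" and QX: "Q \<subseteq> X" and sQ: "submod Q"
  shows "chain P n X Y \<Longrightarrow> chain P n ((\<otimes>) u ` X \<boxplus> Q) ((\<otimes>) u ` Y \<boxplus> Q)"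
proof (induction n arbitrary: Y)
  case 0
  moreover have "u \<in> carrier R" using u by auto
  ultimately show ?case
    by (simp add: submod_set_add submod_mult_image sQ set_add_mono image_mono)
next
  case (Suc n)
  then obtain Z where Z: "chain P n X Z" "Z \<subseteq> Y" and n: "\<not> Y \<subseteq> sat P Z" and Y: "submod Y" by auto
  have sZ: "submod Z" "X \<subseteq> Z" using chain_submod[OF Z(1)] by auto
  let ?f = "\<lambda>X. (\<otimes>) u ` X \<boxplus> Q"
  have "\<not> ?f Y \<subseteq> sat P (?f Z)"
  proof
    assume h: "?f Y \<subseteq> sat P (?f Z)"
    have "y \<in> sat P Z" if y: "y \<in> Y" for y
    proof -
      have car: "y \<in> carrier R" using y Y submodD(1) by auto
      have "u \<otimes> y \<in> ?f Y" using set_add_upper(1)[OF submod_mult_image[OF Y] sQ] u y by auto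
      then obtain c z q where c: "c \<in> carrier R - P" and z: "z \<in> Z" and q: "q \<in> Q"
        and eq: "\<sigma> c \<otimes> (u \<otimes> y) = u \<otimes> z \<oplus> q"
        using h by (elim subsetD[THEN satE]) (auto simp: set_add_iff)
      have zq: "z \<in> carrier R" "q \<in> carrier R" using z q sZ sQ submodD(1) by blast+
      have "u \<otimes> (\<sigma> c \<otimes> y \<ominus> z) = \<sigma> c \<otimes> (u \<otimes> y) \<ominus> u \<otimes> z"
        using u c car zq by (simp add: minus_distrib m_lcomm)
      also have "\<dots> = q" unfolding eq using u zq by (simp add: a_minus_def a_comm[of "u \<otimes> z"] a_assoc r_neg)
      finally have "\<sigma> c \<otimes> y \<ominus> z \<in> Q"
        using primeideal.I_prime[OF Q, of u "\<sigma> c \<otimes> y \<ominus> z"] u c car zq q by auto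
      then have "(\<sigma> c \<otimes> y \<ominus> z) \<oplus> z \<in> Z" using QX sZ z submodD(3)[OF sZ(1)] by blast
      moreover have "(\<sigma> c \<otimes> y \<ominus> z) \<oplus> z = \<sigma> c \<otimes> y"
        using zq c car by (simp add: a_minus_def a_assoc l_neg)
      ultimately show ?thesis using c car by (auto intro: satI)
    qed
    then show False using n by blast
  qed
  moreover have "submod (?f Y)" using Y u sQ by (auto intro!: submod_set_add submod_mult_image)
  moreover have "?f Z \<subseteq> ?f Y" by (intro set_add_mono image_mono Z(2)) simp
  ultimately show ?case using Suc.IH[OF Z(1)] by auto
qed

end

end

end


section \<open>Ideals and cyclic quotients\<close>

lemma (in cring) twisted_ring_id: "twisted_ring R (\<lambda>x. x)"
  by unfold_locales auto

lemma (in cring) submodule_id_iff_ideal: "twisted_submodule R (\<lambda>x. x) X \<longleftrightarrow> ideal X R"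
proof
  interpret I: twisted_ring R "\<lambda>x. x" by (rule twisted_ring_id)
  show "ideal X R" if X: "twisted_submodule R (\<lambda>x. x) X"
  proof (rule idealI[OF ring_axioms])
    show "subgroup X (add_monoid R)"
      by (rule add.subgroupI)
        (use I.submodD(1-3)[OF X] I.submod_uminus[OF X] in \<open>blast+\<close>)
    show "x \<otimes> a \<in> X" "a \<otimes> x \<in> X" if "a \<in> X" "x \<in> carrier R" for a x
      using I.submodD(1)[OF X that(1)] I.submodD(4)[OF X that(2,1)] that(2) by (simp_all add: m_comm)
  qed
next
  assume "ideal X R"
  then interpret ideal X R .
  show "twisted_submodule R (\<lambda>x. x) X"
    using a_subset by (auto simp: twisted_submodule_def I_l_closed)
qed

context twisted_ring
begin

context
  notes [simp] = sigma_closed sigma_one sigma_zero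
begin

lemma ideal_submod: "ideal X R \<Longrightarrow> submod X"
  by (auto intro!: submodI simp: additive_subgroup.zero_closed[OF ideal.axioms(1)]
      additive_subgroup.a_closed[OF ideal.axioms(1)] ideal.I_l_closed ideal.Icarr)

definition colon :: "'a set \<Rightarrow> 'a \<Rightarrow> 'a set" where
  "colon X w = {a \<in> carrier R. \<sigma> a \<otimes> w \<in> X}"

lemma colon_ideal:
  assumes X: "submod X" and w: "w \<in> carrier R"
  shows "twisted_submodule R (\<lambda>x. x) (colon X w)"
proof -
  interpret I: twisted_ring R "\<lambda>x. x" by (rule twisted_ring_id)
  show ?thesis
  proof (rule I.submodI)
    show "\<zero> \<in> colon X w" using w submodD(2)[OF X] by (simp add: colon_def)
    show "colon X w \<subseteq> carrier R" by (auto simp: colon_def)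
  next
    fix a b assume "a \<in> colon X w" "b \<in> colon X w"
    then show "a \<oplus> b \<in> colon X w"
      using w submodD(3)[OF X] by (simp add: colon_def sigma_add l_distr)
  next
    fix a b assume "a \<in> carrier R" "b \<in> colon X w"
    then show "a \<otimes> b \<in> colon X w"
      using w submodD(4)[OF X] by (simp add: colon_def sigma_mult m_assoc)
  qed
qed

text \<open>The quotient of \<open>X + \<sigma>(R) w\<close> by \<open>X\<close> is cyclic, so that its submodules come from ideals of \<open>R\<close>
  and its length is that of a quotient of \<open>R\<close>.\<close>

lemma chain_colon:
  assumes P: "primeideal P R" and w: "w \<in> carrier R"
  shows "chain P n X Y \<Longrightarrow> Y \<subseteq> span_over X [w] \<Longrightarrow>
    local_chain R (\<lambda>x. x) P n (colon X w) (colon Y w)"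
proof (induction n arbitrary: Y)
  case 0
  then show ?case using colon_ideal w by (auto simp: colon_def)
next
  case (Suc n)
  then obtain Z where Z: "chain P n X Z" "Z \<subseteq> Y" and n: "\<not> Y \<subseteq> sat P Z" and Y: "submod Y" by auto
  have sZ: "submod Z" "X \<subseteq> Z" "submod X" using chain_submod[OF P Z(1)] by auto
  obtain y where y: "y \<in> Y" "y \<notin> sat P Z" using n by auto
  obtain a x where a: "a \<in> carrier R" "x \<in> X" and yeq: "y = \<sigma> a \<otimes> w \<oplus> x"
    using subsetD[OF Suc.prems(2) y(1)] by auto
  have xc: "x \<in> carrier R" using a sZ submodD(1) by auto
  have "\<sigma> a \<otimes> w \<in> Y"
    using submod_cancel[OF Y, of "\<sigma> a \<otimes> w" x] y(1) yeq a w Z(2) sZ by auto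
  then have "a \<in> colon Y w" using a by (simp add: colon_def)
  moreover have "a \<notin> saturation R (\<lambda>x. x) P (colon Z w)"
  proof
    assume "a \<in> saturation R (\<lambda>x. x) P (colon Z w)"
    then obtain c where c: "c \<in> carrier R - P" and ca: "\<sigma> (c \<otimes> a) \<otimes> w \<in> Z"
      by (auto simp: saturation_def colon_def)
    have "\<sigma> c \<otimes> y = \<sigma> (c \<otimes> a) \<otimes> w \<oplus> \<sigma> c \<otimes> x"
      unfolding yeq using c a w xc by (simp add: sigma_mult r_distr m_assoc)
    also have "\<dots> \<in> Z" using submodD(3)[OF sZ(1) ca submodD(4)[OF sZ(1)]] c a(2) sZ(2) by blast
    finally have "y \<in> sat P Z" using c yeq a xc w by (intro satI[OF P, of c]) auto
    then show False using y by simp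
  qed
  ultimately have "\<not> colon Y w \<subseteq> saturation R (\<lambda>x. x) P (colon Z w)" by blast
  moreover have "colon Z w \<subseteq> colon Y w" using Z(2) by (auto simp: colon_def)
  moreover have "local_chain R (\<lambda>x. x) P n (colon X w) (colon Z w)"
    using Suc.IH[OF Z(1)] Z(2) Suc.prems(2) by blast
  ultimately show ?case using colon_ideal[OF Y w] by auto
qed

text \<open>Each generator contributes a cyclic quotient that is annihilated by \<open>D\<close>, hence at most the length
  of \<open>R/D\<close>.\<close>

lemma local_length_span:
  assumes P: "primeideal P R" and X: "submod X" and ws: "set ws \<subseteq> carrier R"
    and D: "ideal D R" "\<And>d w. d \<in> D \<Longrightarrow> w \<in> set ws \<Longrightarrow> \<sigma> d \<otimes> w \<in> X"
    and l: "local_length_le R (\<lambda>x. x) P l D (carrier R)"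
  shows "local_length_le R \<sigma> P (length ws * l) X (span_over X ws)"
  unfolding local_length_le_def
proof (intro allI impI)
  interpret I: twisted_ring R "\<lambda>x. x" by (rule twisted_ring_id)
  show "chain P m X (span_over X ws) \<Longrightarrow> m \<le> length ws * l" for m
    using ws D(2)
  proof (induction ws arbitrary: m)
    case Nil
    show ?case
    proof (cases m)
      case (Suc k)
      then obtain Z where "chain P k X Z" "\<not> X \<subseteq> sat P Z" using Nil by auto
      then show ?thesis using chain_submod[OF P] sat_upper[OF P] by blast
    qed simp
  next
    case (Cons w ws)
    let ?V = "span_over X ws"
    have V: "submod ?V" "X \<subseteq> ?V" "?V \<subseteq> span_over X (w # ws)" and w: "w \<in> carrier R"
      using Cons.prems submod_span[OF X] span_upper[OF X] span_Cons_upper[OF X, of w ws] by auto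
    obtain a b where ab: "m \<le> a + b" "chain P a X ?V" "chain P b ?V (span_over X (w # ws))"
      using chain_split[OF P Cons.prems(1) V] by blast
    have "span_over X (w # ws) = span_over ?V [w]" by simp
    then have "local_chain R (\<lambda>x. x) P b (colon ?V w) (colon (span_over X (w # ws)) w)"
      using chain_colon[OF P w ab(3)] by simp
    moreover have "D \<subseteq> colon ?V w"
      using Cons.prems(3) V(2) ideal.Icarr[OF D(1)] by (auto simp: colon_def)
    moreover have "twisted_submodule R (\<lambda>x. x) D" using D(1) submodule_id_iff_ideal by simp
    ultimately have "local_chain R (\<lambda>x. x) P b D (carrier R)"
      using I.chain_mono[OF P] I.submod_carrier by (metis (no_types, lifting) colon_def mem_Collect_eq subsetI)
    then have "b \<le> l" using l by (simp add: local_length_le_def)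
    moreover have "a \<le> length ws * l" using Cons ab by auto
    ultimately show ?case using ab(1) by simp
  qed
qed

end

end

section \<open>Primes and finite local length in Noetherian rings\<close>

lemma (in noetherian_ring) maximal_ideal_in_family:
  assumes "\<A> \<noteq> {}" "\<And>I. I \<in> \<A> \<Longrightarrow> ideal I R"
  shows "\<exists>M\<in>\<A>. \<forall>I\<in>\<A>. M \<subseteq> I \<longrightarrow> I = M"
proof (rule subset_Zorn_nonempty[OF assms(1)])
  fix C assume C: "C \<noteq> {}" "subset.chain \<A> C"
  then have "subset.chain {I. ideal I R} C" using assms(2) by (auto simp: pred_on.chain_def)
  then have "\<Union>C \<in> C" using ideal_chain_is_trivial C by auto
  then show "\<Union>C \<in> \<A>" using C by (auto simp: pred_on.chain_def)
qed

locale noetherian_cring = noetherian_ring + cring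
begin

text \<open>An ideal that is maximal among those disjoint from \<open>N\<close> is prime.\<close>

lemma ex_prime_avoiding:
  assumes D: "ideal D R" and N: "submonoid N R" "D \<inter> N = {}"
  shows "\<exists>T. primeideal T R \<and> D \<subseteq> T \<and> T \<inter> N = {}"
proof -
  interpret I: twisted_ring R "\<lambda>x. x" by (rule twisted_ring_id)
  define F where "F T \<longleftrightarrow> ideal T R \<and> D \<subseteq> T \<and> T \<inter> N = {}" for T
  have "F D" using D N(2) by (simp add: F_def)
  then have "\<exists>T\<in>Collect F. \<forall>J\<in>Collect F. T \<subseteq> J \<longrightarrow> J = T"
    by (intro maximal_ideal_in_family) (auto simp: F_def)
  then obtain T where "F T" and max: "\<And>J. F J \<Longrightarrow> T \<subseteq> J \<Longrightarrow> J = T" by blast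
  then have iT: "ideal T R" "D \<subseteq> T" "T \<inter> N = {}" by (auto simp: F_def)
  then have sT: "I.submod T" by (simp add: submodule_id_iff_ideal)
  have meets: "\<exists>r\<in>carrier R. \<exists>t\<in>T. r \<otimes> a \<oplus> t \<in> N" if a: "a \<in> carrier R" "a \<notin> T" for a
  proof (rule ccontr)
    assume no: "\<not> ?thesis"
    let ?J = "I.span_over T [a]"
    have "I.submod ?J" using I.submod_span[OF sT, of "[a]"] a by simp
    moreover have "T \<subseteq> ?J" "a \<in> ?J" using I.span_upper[OF sT, of "[a]"] a by auto
    moreover have "?J \<inter> N = {}" using no by auto
    ultimately have "F ?J" "a \<in> ?J" "T \<subseteq> ?J"
      unfolding F_def submodule_id_iff_ideal using iT(2) by blast+
    then show False using max[of ?J] a(2) by blast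
  qed
  have "primeideal T R"
  proof (rule primeidealI[OF iT(1) is_cring])
    show "carrier R \<noteq> T" using iT(3) submonoid.one_closed[OF N(1)] by auto
  next
    fix a b assume ab: "a \<in> carrier R" "b \<in> carrier R" "a \<otimes> b \<in> T"
    show "a \<in> T \<or> b \<in> T"
    proof (rule ccontr)
      assume "\<not> ?thesis"
      then obtain r s t u where *: "r \<in> carrier R" "s \<in> carrier R" "t \<in> T" "u \<in> T"
        and rt: "r \<otimes> a \<oplus> t \<in> N" and su: "s \<otimes> b \<oplus> u \<in> N" using meets ab by metis
      have tu: "t \<in> carrier R" "u \<in> carrier R" using * I.submodD(1)[OF sT] by auto
      have "(r \<otimes> a \<oplus> t) \<otimes> (s \<otimes> b \<oplus> u) =
          (r \<otimes> s) \<otimes> (a \<otimes> b) \<oplus> (r \<otimes> a) \<otimes> u \<oplus> (s \<otimes> b \<oplus> u) \<otimes> t"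
        using ab tu * by (simp add: l_distr r_distr m_ac a_ac)
      also have "\<dots> \<in> T" using * ab tu
        by (intro I.submodD(3)[OF sT] I.submodD(4)[OF sT _ ab(3)] I.submodD(4)[OF sT _ *(3)]
            I.submodD(4)[OF sT _ *(4)]) auto
      finally show False using submonoid.m_closed[OF N(1) rt su] iT(3) by auto
    qed
  qed
  then show ?thesis using iT by auto
qed

text \<open>The intersection of a chain of primes is prime, so Zorn's lemma applies to the complements.\<close>

lemma ex_minimal_prime:
  assumes D: "ideal D R" "D \<noteq> carrier R"
  shows "\<exists>P. primeideal P R \<and> D \<subseteq> P \<and> (\<forall>T. primeideal T R \<longrightarrow> D \<subseteq> T \<longrightarrow> T \<subseteq> P \<longrightarrow> T = P)"
proof -
  define over where "over T \<longleftrightarrow> primeideal T R \<and> D \<subseteq> T" for T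
  have over_carrier: "T \<subseteq> carrier R" if "over T" for T
    using that ideal.Icarr[OF primeideal.axioms(1)] by (auto simp: over_def)
  define A where "A = {X. X \<subseteq> carrier R \<and> over (carrier R - X)}"
  have "submonoid {\<one>} R" by unfold_locales auto
  moreover have "D \<inter> {\<one>} = {}" using D ideal.one_imp_carrier by auto
  ultimately obtain T where T: "over T" using ex_prime_avoiding[OF D(1)] unfolding over_def by metis
  then have "carrier R - (carrier R - T) = T" using over_carrier by blast
  then have ne: "A \<noteq> {}" using T unfolding A_def by (metis (mono_tags) Diff_subset empty_iff mem_Collect_eq)
  have "\<exists>M\<in>A. \<forall>X\<in>A. M \<subseteq> X \<longrightarrow> X = M"
  proof (rule subset_Zorn_nonempty[OF ne])
    fix C assume C: "C \<noteq> {}" "subset.chain A C"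
    then have CA: "over (carrier R - X)" "X \<subseteq> carrier R" if "X \<in> C" for X
      using that by (auto simp: pred_on.chain_def A_def)
    have lin: "X \<subseteq> Y \<or> Y \<subseteq> X" if "X \<in> C" "Y \<in> C" for X Y
      using C(2) that by (auto simp: pred_on.chain_def)
    define T where "T = (\<Inter>X\<in>C. carrier R - X)"
    have idT: "ideal T R" unfolding T_def
      by (rule i_Intersect) (use C(1) CA(1) primeideal.axioms(1) in \<open>auto simp: over_def\<close>)
    obtain X where X: "X \<in> C" using C(1) by auto
    have "primeideal T R"
    proof (rule primeidealI[OF idT is_cring])
      have "carrier R \<noteq> carrier R - X"
        using primeideal.I_notcarr CA(1)[OF X] by (auto simp: over_def)
      then show "carrier R \<noteq> T" using X unfolding T_def by blast
    next
      fix a b assume ab: "a \<in> carrier R" "b \<in> carrier R" "a \<otimes> b \<in> T"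
      show "a \<in> T \<or> b \<in> T"
      proof (rule ccontr)
        assume "\<not> ?thesis"
        then obtain Y Z where "Y \<in> C" "Z \<in> C" "a \<in> Y" "b \<in> Z" using ab unfolding T_def by blast
        then obtain W where W: "W \<in> C" "a \<in> W" "b \<in> W" using lin by blast
        moreover have "a \<otimes> b \<in> carrier R - W" using ab(3) W(1) unfolding T_def by blast
        ultimately show False
          using primeideal.I_prime[of "carrier R - W" R a b] CA(1)[OF W(1)] ab by (auto simp: over_def)
      qed
    qed
    moreover have "D \<subseteq> T" unfolding T_def using CA(1) by (auto simp: over_def)
    moreover have "carrier R - \<Union>C = T" using X unfolding T_def by auto
    ultimately show "\<Union>C \<in> A" using CA(2) unfolding A_def over_def by auto
  qed
  then obtain M where "M \<in> A" and max: "\<And>X. X \<in> A \<Longrightarrow> M \<subseteq> X \<Longrightarrow> X = M" by auto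
  then have P: "over (carrier R - M)" and M: "M \<subseteq> carrier R" by (auto simp: A_def)
  have "T = carrier R - M" if T: "primeideal T R" "D \<subseteq> T" "T \<subseteq> carrier R - M" for T
  proof -
    have "carrier R - (carrier R - T) = T" using T(3) by blast
    then have "carrier R - T \<in> A" using T(1,2) by (simp add: A_def over_def)
    then have "carrier R - T = M" using max T(3) M by blast
    then show ?thesis using T(3) by blast
  qed
  then show ?thesis using P unfolding over_def by blast
qed

text \<open>Here \<open>P\<close> is minimal over \<open>D\<close>, so that \<open>P\<close> is the only prime of \<open>R\<^sub>P/D\<^sub>P\<close> and all its elements are
  nilpotent there. Otherwise some prime over \<open>D\<close> would avoid all the products \<open>x z^m\<close>.\<close>

lemma power_in_ideal_locally:
  assumes D: "ideal D R" "D \<subseteq> P" and P: "primeideal P R" and z: "z \<in> P"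
    and minP: "\<And>T. primeideal T R \<Longrightarrow> D \<subseteq> T \<Longrightarrow> T \<subseteq> P \<Longrightarrow> T = P"
  shows "\<exists>x\<in>carrier R - P. \<exists>m::nat. x \<otimes> z [^] m \<in> D"
proof (rule ccontr)
  assume no: "\<not> ?thesis"
  interpret I: twisted_ring R "\<lambda>x. x" by (rule twisted_ring_id)
  note den = I.denominators[OF P]
  have zc: "z \<in> carrier R" using z ideal.Icarr[OF primeideal.axioms(1)[OF P]] by auto
  let ?N = "{x \<otimes> z [^] m | x m::nat. x \<in> carrier R - P}"
  have N: "submonoid ?N R"
  proof
    show "?N \<subseteq> carrier R" using zc by auto
    show "\<one> \<in> ?N" using den(1) by (intro CollectI exI[of _ \<one>] exI[of _ "0::nat"]) simp
    fix a b assume "a \<in> ?N" "b \<in> ?N"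
    then obtain x y m n where *: "x \<in> carrier R - P" "y \<in> carrier R - P"
      "a = x \<otimes> z [^] (m::nat)" "b = y \<otimes> z [^] (n::nat)" by auto
    then have "a \<otimes> b = (x \<otimes> y) \<otimes> z [^] (m + n)"
      using zc by (simp add: nat_pow_mult[symmetric] m_ac)
    then show "a \<otimes> b \<in> ?N"
      using den(2)[OF *(1,2)] by (intro CollectI exI[of _ "x \<otimes> y"] exI[of _ "m + n"]) simp
  qed
  have "D \<inter> ?N = {}" using no by auto
  then obtain T where T: "primeideal T R" "D \<subseteq> T" "T \<inter> ?N = {}"
    using ex_prime_avoiding[OF D(1) N] by blast
  have Tc: "T \<subseteq> carrier R" using ideal.Icarr[OF primeideal.axioms(1)[OF T(1)]] by auto
  have "x \<in> ?N" if "x \<in> carrier R - P" for x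
    using that by (intro CollectI exI[of _ x] exI[of _ "0::nat"]) simp
  then have "T \<subseteq> P" using T(3) Tc by blast
  then have "T = P" using minP T by auto
  moreover have "z \<in> ?N"
    using den(1) zc by (intro CollectI exI[of _ \<one>] exI[of _ "1::nat"]) simp
  ultimately show False using z T(3) by auto
qed

text \<open>Choose \<open>y\<close> with the largest possible annihilator in \<open>R\<^sub>P/D\<^sub>P\<close>. If \<open>z \<in> P\<close> did not annihilate \<open>y\<close>,
  then \<open>z y\<close> would have the same annihilator, so that no power of \<open>z\<close> would annihilate \<open>y\<close>; but \<open>z\<close> is
  nilpotent there.\<close>

lemma ex_locally_simple_element:
  assumes D: "ideal D R" "D \<subseteq> P" and P: "primeideal P R"
    and minP: "\<And>T. primeideal T R \<Longrightarrow> D \<subseteq> T \<Longrightarrow> T \<subseteq> P \<Longrightarrow> T = P"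
  shows "\<exists>y\<in>carrier R - saturation R (\<lambda>x. x) P D. \<forall>z\<in>P. z \<otimes> y \<in> saturation R (\<lambda>x. x) P D"
proof -
  interpret I: twisted_ring R "\<lambda>x. x" by (rule twisted_ring_id)
  let ?S = "I.sat P D"
  have S: "I.submod ?S" using I.submod_sat[OF P] D submodule_id_iff_ideal by simp
  have Sc: "?S \<subseteq> carrier R" by (auto simp: saturation_def)
  let ?F = "I.colon ?S ` (carrier R - ?S)"
  have "\<one> \<notin> ?S" using D(2) by (auto simp: saturation_def)
  then have "?F \<noteq> {}" by auto
  moreover have "ideal J R" if "J \<in> ?F" for J
    using that I.colon_ideal[OF S] submodule_id_iff_ideal by auto
  ultimately have "\<exists>M\<in>?F. \<forall>I\<in>?F. M \<subseteq> I \<longrightarrow> I = M" by (rule maximal_ideal_in_family)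
  then obtain y where y: "y \<in> carrier R" "y \<notin> ?S"
    and max: "\<And>y'. y' \<in> carrier R - ?S \<Longrightarrow> I.colon ?S y \<subseteq> I.colon ?S y' \<Longrightarrow> I.colon ?S y' = I.colon ?S y"
  proof -
    assume h: "\<exists>M\<in>?F. \<forall>I\<in>?F. M \<subseteq> I \<longrightarrow> I = M"
    then obtain y where "y \<in> carrier R - ?S"
      and "\<forall>I\<in>?F. I.colon ?S y \<subseteq> I \<longrightarrow> I = I.colon ?S y" by blast
    then show ?thesis using that[of y] by blast
  qed
  have "z \<otimes> y \<in> ?S" if z: "z \<in> P" for z
  proof (rule ccontr)
    assume zy: "z \<otimes> y \<notin> ?S"
    have zc: "z \<in> carrier R" using z ideal.Icarr[OF primeideal.axioms(1)[OF P]] by auto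
    have "I.colon ?S y \<subseteq> I.colon ?S (z \<otimes> y)"
      using I.submodD(4)[OF S zc] zc y by (auto simp: I.colon_def m_lcomm[of _ z])
    then have eq: "I.colon ?S (z \<otimes> y) = I.colon ?S y" using max zc y zy by auto
    have "z [^] m \<otimes> y \<notin> ?S" for m :: nat
    proof (induction m)
      case (Suc m)
      show ?case
      proof
        assume "z [^] Suc m \<otimes> y \<in> ?S"
        then have "z [^] m \<in> I.colon ?S (z \<otimes> y)" using zc y by (simp add: I.colon_def m_assoc)
        then have "z [^] m \<in> I.colon ?S y" using eq by simp
        then show False using Suc by (simp add: I.colon_def)
      qed
    qed (use y in simp)
    moreover obtain x m where x: "x \<in> carrier R - P" "x \<otimes> z [^] (m::nat) \<in> D"
      using power_in_ideal_locally[OF D P z minP] by auto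
    have "(x \<otimes> z [^] m) \<otimes> y \<in> D" using x(2) D(1) y ideal.I_r_closed by metis
    then have "z [^] m \<otimes> y \<in> ?S" using x y zc by (intro I.satI[OF P, of x]) (auto simp: m_assoc)
    ultimately show False by blast
  qed
  then show ?thesis using y by blast
qed

text \<open>Noetherian induction: an element that is annihilated by \<open>P\<close> at \<open>P\<close> spans a submodule of length at
  most one, and the quotient by it has finite length. This is the statement that a Noetherian local
  ring of dimension zero is Artinian.\<close>

lemma finite_local_length:
  assumes P: "primeideal P R" and D: "ideal D R"
    and minP: "\<And>T. primeideal T R \<Longrightarrow> D \<subseteq> T \<Longrightarrow> T \<subseteq> P \<Longrightarrow> T = P"
  shows "\<exists>l. local_length_le R (\<lambda>x. x) P l D (carrier R)"
proof (rule ccontr)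
  interpret I: twisted_ring R "\<lambda>x. x" by (rule twisted_ring_id)
  let ?min = "\<lambda>D. \<forall>T. primeideal T R \<longrightarrow> D \<subseteq> T \<longrightarrow> T \<subseteq> P \<longrightarrow> T = P"
  define bad where "bad D \<longleftrightarrow> ideal D R \<and> ?min D \<and>
      \<not> (\<exists>l. local_length_le R (\<lambda>x. x) P l D (carrier R))" for D
  assume "\<not> ?thesis"
  then have "bad D" unfolding bad_def using D minP by blast
  then have "\<exists>M\<in>Collect bad. \<forall>I\<in>Collect bad. M \<subseteq> I \<longrightarrow> I = M"
    by (intro maximal_ideal_in_family) (auto simp: bad_def)
  then obtain D where "bad D" and max: "\<And>J. bad J \<Longrightarrow> D \<subseteq> J \<Longrightarrow> J = D" by blast
  then have D: "ideal D R" "I.submod D" and minP: "?min D"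
    and bad: "\<not> (\<exists>l. local_length_le R (\<lambda>x. x) P l D (carrier R))"
    unfolding bad_def using submodule_id_iff_ideal by auto
  let ?S = "I.sat P D"
  have S: "I.submod ?S" "D \<subseteq> ?S" using I.submod_sat[OF P] I.sat_upper[OF P] D by auto
  have "D \<subseteq> P"
  proof (rule ccontr)
    \<comment> \<open>Then the localization of \<open>R/D\<close> vanishes.\<close>
    assume "\<not> D \<subseteq> P"
    then obtain c where c: "c \<in> D" "c \<notin> P" by auto
    have "carrier R \<subseteq> I.sat P X" if X: "I.submod X" "D \<subseteq> X" for X
    proof
      fix s assume s: "s \<in> carrier R"
      have "c \<in> carrier R" using c ideal.Icarr[OF D(1)] by auto
      moreover have "c \<otimes> s \<in> X" using ideal.I_r_closed[OF D(1) c(1) s] X by auto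
      ultimately show "s \<in> I.sat P X" using c s by (intro I.satI[OF P, of c]) auto
    qed
    note sat_all = this
    have "m = 0" if m: "I.chain P m D (carrier R)" for m
    proof (cases m)
      case (Suc k)
      then obtain Z where "I.chain P k D Z" "\<not> carrier R \<subseteq> I.sat P Z" using m by auto
      then show ?thesis using I.chain_submod[OF P] sat_all by blast
    qed
    then have "local_length_le R (\<lambda>x. x) P 0 D (carrier R)" by (auto simp: local_length_le_def)
    then show False using bad by auto
  qed
  have "\<exists>y\<in>carrier R - ?S. \<forall>z\<in>P. z \<otimes> y \<in> ?S"
    by (rule ex_locally_simple_element[OF D(1) \<open>D \<subseteq> P\<close> P]) (rule minP[rule_format])
  then obtain y where y: "y \<in> carrier R" "y \<notin> ?S" and Py: "\<And>z. z \<in> P \<Longrightarrow> z \<otimes> y \<in> ?S" by auto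
  define J where "J = I.span_over ?S [y]"
  have J: "I.submod J" "?S \<subseteq> J" "y \<in> J" and J_least: "\<And>Z. I.submod Z \<Longrightarrow> ?S \<subseteq> Z \<Longrightarrow> y \<in> Z \<Longrightarrow> J \<subseteq> Z"
    and J_elem: "\<And>w. w \<in> J \<Longrightarrow> \<exists>r\<in>carrier R. \<exists>d\<in>?S. w = r \<otimes> y \<oplus> d"
    using I.submod_span[OF S(1), of "[y]"] I.span_upper[OF S(1), of "[y]"] y
      I.span_least[of _ ?S "[y]"] unfolding J_def by (simp, simp, simp, simp, auto)
  have "J \<noteq> D" using J(3) S(2) y(2) by blast
  moreover have "D \<subseteq> J" using S(2) J(2) by blast
  moreover have "?min J" using minP \<open>D \<subseteq> J\<close> by (meson order_trans)
  ultimately have "\<exists>l. local_length_le R (\<lambda>x. x) P l J (carrier R)"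
    using max[of J] J(1) unfolding bad_def submodule_id_iff_ideal by blast
  then obtain l where l: "local_length_le R (\<lambda>x. x) P l J (carrier R)"
    by blast
  have one: "a \<le> 1" if a: "I.chain P a D J" for a
  proof (rule ccontr)
    assume "\<not> a \<le> 1"
    then have "I.chain P 2 D J" using I.chain_le[OF P a, of 2] by simp
    then obtain X Z where Z: "I.submod Z" "Z \<subseteq> J" "\<not> J \<subseteq> I.sat P Z"
      and X: "I.chain P 0 D X" "X \<subseteq> Z" "\<not> Z \<subseteq> I.sat P X" by (auto simp: numeral_2_eq_2)
    have "D \<subseteq> X" "I.submod X" using X(1) by auto
    then have SX: "?S \<subseteq> I.sat P X" "?S \<subseteq> I.sat P Z" using I.sat_mono[OF P] X(2) by blast+
    obtain w where w: "w \<in> Z" "w \<notin> I.sat P X" using X by auto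
    obtain r d where r: "r \<in> carrier R" "d \<in> ?S" and weq: "w = r \<otimes> y \<oplus> d" using J_elem w Z by blast
    have "r \<notin> P"
    proof
      assume "r \<in> P"
      then have "w \<in> ?S" unfolding weq using Py r I.submodD(3)[OF S(1)] by auto
      then show False using w SX by auto
    qed
    have "w \<in> I.sat P Z" using w I.sat_upper[OF P Z(1)] by auto
    then have "r \<otimes> y \<in> I.sat P Z"
      using I.submod_cancel[OF I.submod_sat[OF P Z(1)], of "r \<otimes> y" d] weq r SX y by auto
    then have "y \<in> I.sat P (I.sat P Z)" using r \<open>r \<notin> P\<close> y by (rule_tac I.satI[OF P, of r]) auto
    then have "y \<in> I.sat P Z" using I.sat_idem[OF P Z(1)] by auto
    then have "J \<subseteq> I.sat P Z" by (rule J_least[OF I.submod_sat[OF P Z(1)] SX(2)])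
    then show False using Z by simp
  qed
  have "m \<le> Suc l" if m: "I.chain P m D (carrier R)" for m
  proof -
    have "J \<subseteq> carrier R" using I.submodD(1)[OF J(1)] by auto
    then obtain a b where "m \<le> a + b" "I.chain P a D J" "I.chain P b J (carrier R)"
      using I.chain_split[OF P m J(1) \<open>D \<subseteq> J\<close>] by blast
    then show ?thesis using one[of a] l by (auto simp: local_length_le_def)
  qed
  then have "local_length_le R (\<lambda>x. x) P (Suc l) D (carrier R)" by (auto simp: local_length_le_def)
  then show False using bad by auto
qed

end


context twisted_ring
begin

context
  notes [simp] = sigma_closed sigma_one sigma_zero
begin

lemma ex_longest_chain:
  assumes "local_length_le R \<sigma> P l X Y" "submod X" "submod Y" "X \<subseteq> Y"
  shows "\<exists>m. chain P m X Y \<and> local_length_le R \<sigma> P m X Y"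
proof -
  have 0: "chain P 0 X Y" using assms by simp
  have bd: "\<And>m. chain P m X Y \<Longrightarrow> m \<le> l" using assms(1) by (simp add: local_length_le_def)
  have "chain P (GREATEST m. chain P m X Y) X Y" by (rule GreatestI_nat[where P = "\<lambda>m. chain P m X Y", OF 0 bd])
  moreover have "m \<le> (GREATEST m. chain P m X Y)" if "chain P m X Y" for m
    by (rule Greatest_le_nat[where P = "\<lambda>m. chain P m X Y", OF that bd])
  ultimately show ?thesis unfolding local_length_le_def by blast
qed

text \<open>No entry lies, locally at \<open>Q\<close>, in the span over \<open>Q\<close> of the later ones. For the Frobenius action this
  is linear independence in the residue field of \<open>Q\<close> over its \<open>p\<close>-th powers.\<close>

primrec independent_mod :: "'a set \<Rightarrow> 'a list \<Rightarrow> bool" where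
  "independent_mod Q [] \<longleftrightarrow> True"
| "independent_mod Q (v # vs) \<longleftrightarrow> v \<notin> sat Q (span_over Q vs) \<and> independent_mod Q vs"

lemma dependent_split:
  "\<not> independent_mod Q ws \<Longrightarrow> \<exists>us v vs. ws = us @ v # vs \<and> v \<in> sat Q (span_over Q vs)"
proof (induction ws)
  case (Cons w ws)
  show ?case
  proof (cases "w \<in> sat Q (span_over Q ws)")
    case True
    then show ?thesis by (intro exI[of _ "[]"]) auto
  next
    case False
    then obtain us v vs where "ws = us @ v # vs \<and> v \<in> sat Q (span_over Q vs)"
      using Cons by auto
    then show ?thesis by (intro exI[of _ "w # us"] exI[of _ v] exI[of _ vs]) simp
  qed
qed simp

text \<open>Redundant entries are removed one by one. The last alternative identifies shortest generating lists
  as independent ones.\<close>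

lemma ex_independent_spanning:
  assumes Q: "primeideal Q R"
  shows "set ws \<subseteq> carrier R \<Longrightarrow> carrier R \<subseteq> sat Q (span_over Q ws) \<Longrightarrow>
    \<exists>vs. set vs \<subseteq> carrier R \<and> carrier R \<subseteq> sat Q (span_over Q vs) \<and> independent_mod Q vs \<and>
      (length vs < length ws \<or> vs = ws)"
proof (induction "length ws" arbitrary: ws rule: less_induct)
  case less
  note sQ = ideal_submod[OF primeideal.axioms(1)[OF Q]]
  show ?case
  proof (cases "independent_mod Q ws")
    case True
    then show ?thesis using less.prems by blast
  next
    case False
    then obtain us v vs where ws: "ws = us @ v # vs" and v: "v \<in> sat Q (span_over Q vs)"
      using dependent_split by blast
    have car: "set (us @ vs) \<subseteq> carrier R" "set vs \<subseteq> set (us @ vs)" using less.prems ws by auto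
    let ?V = "span_over Q (us @ vs)"
    have V: "submod ?V" "Q \<subseteq> ?V" "set (us @ vs) \<subseteq> ?V"
      using submod_span[OF sQ car(1)] span_upper[OF sQ car(1)] by auto
    have "span_over Q vs \<subseteq> ?V" using span_mono[OF sQ sQ _ car(2,1)] by simp
    then have "v \<in> sat Q ?V" using v sat_mono[OF Q] by blast
    then have "set ws \<subseteq> sat Q ?V" using sat_upper[OF Q V(1)] V(3) ws by auto
    then have "span_over Q ws \<subseteq> sat Q ?V"
      using sat_upper[OF Q V(1)] V(2) by (intro span_least submod_sat[OF Q V(1)]) auto
    then have "carrier R \<subseteq> sat Q ?V" using sat_trans[OF Q V(1)] less.prems(2) by blast
    moreover have "length (us @ vs) < length ws" using ws by simp
    ultimately show ?thesis using less.hyps[of "us @ vs"] car(1) by (metis order.strict_trans)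
  qed
qed

lemma span_map_mult:
  assumes Z: "submod Z" and y: "y \<in> carrier R"
  shows "set vs \<subseteq> carrier R \<Longrightarrow> x \<in> span_over Z (map (\<lambda>v. v \<otimes> y) vs) \<Longrightarrow>
    \<exists>u\<in>span_over {\<zero>} vs. \<exists>z\<in>Z. x = u \<otimes> y \<oplus> z"
proof (induction vs arbitrary: x)
  case Nil
  then show ?case using y submodD(1)[OF Z] by auto
next
  case (Cons v vs)
  then obtain a x' where a: "a \<in> carrier R" "x' \<in> span_over Z (map (\<lambda>v. v \<otimes> y) vs)"
    and x: "x = \<sigma> a \<otimes> (v \<otimes> y) \<oplus> x'" by auto
  have "\<exists>u\<in>span_over {\<zero>} vs. \<exists>z\<in>Z. x' = u \<otimes> y \<oplus> z"
    using Cons.IH[OF _ a(2)] Cons.prems(1) by simp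
  then obtain u z where u: "u \<in> span_over {\<zero>} vs" "z \<in> Z" "x' = u \<otimes> y \<oplus> z" by blast
  have "submod {\<zero>}" by (rule submodI) auto
  then have "u \<in> carrier R" using u(1) submod_span[of "{\<zero>}" vs] submodD(1) Cons.prems by auto
  moreover have "z \<in> carrier R" using u Z submodD(1) by auto
  ultimately have "x = (\<sigma> a \<otimes> v \<oplus> u) \<otimes> y \<oplus> z"
    unfolding x u(3) using a y Cons.prems by (simp add: l_distr m_assoc a_assoc)
  moreover have "\<sigma> a \<otimes> v \<oplus> u \<in> span_over {\<zero>} (v # vs)" using a u by (intro span_ConsI)
  ultimately show ?case using u(2) by blast
qed

text \<open>A relation between the \<open>v\<^sub>i y\<close> modulo \<open>Z\<close> has the form \<open>u y \<in> Z\<close>. As \<open>y\<close> is not in \<open>Z\<close> locally, \<open>u \<in> P\<close>,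
  and this is a relation between the \<open>v\<^sub>i\<close> modulo \<open>P\<close>.\<close>

lemma chain_span_mult:
  assumes P: "primeideal P R" and Z: "ideal Z R"
    and y: "y \<in> carrier R" "y \<notin> saturation R (\<lambda>x. x) P Z"
  shows "set vs \<subseteq> carrier R \<Longrightarrow> independent_mod P vs \<Longrightarrow>
    chain P (length vs) Z (span_over Z (map (\<lambda>v. v \<otimes> y) vs))"
proof (induction vs)
  case Nil
  then show ?case using ideal_submod[OF Z] by simp
next
  case (Cons v vs)
  note sZ = ideal_submod[OF Z] and sP = ideal_submod[OF primeideal.axioms(1)[OF P]]
  let ?m = "map (\<lambda>v. v \<otimes> y)"
  have car: "set (?m (v # vs)) \<subseteq> carrier R" "set (?m vs) \<subseteq> carrier R" "v \<in> carrier R" "set vs \<subseteq> carrier R"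
    using Cons.prems y by auto
  have "v \<otimes> y \<notin> sat P (span_over Z (?m vs))"
  proof
    assume "v \<otimes> y \<in> sat P (span_over Z (?m vs))"
    then obtain c where c: "c \<in> carrier R - P" "\<sigma> c \<otimes> (v \<otimes> y) \<in> span_over Z (?m vs)"
      by (metis satE[OF P])
    then obtain u z where u: "u \<in> span_over {\<zero>} vs" and z: "z \<in> Z"
      and eq: "\<sigma> c \<otimes> (v \<otimes> y) = u \<otimes> y \<oplus> z" using span_map_mult[OF sZ y(1) car(4)] by blast
    have z0: "submod {\<zero>}" by (rule submodI) auto
    have uc: "u \<in> carrier R" using u submod_span[OF z0 car(4)] submodD(1) by blast
    have zc: "z \<in> carrier R" using z sZ submodD(1) by blast
    have cc: "c \<in> carrier R" using c by simp
    let ?e = "\<sigma> c \<otimes> v \<ominus> u"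
    have e: "?e \<in> carrier R" using cc car(3) uc by simp
    have eu: "?e \<oplus> u = \<sigma> c \<otimes> v" using cc car(3) uc by (simp add: a_minus_def a_assoc l_neg)
    have "\<sigma> c \<otimes> (v \<otimes> y) = ?e \<otimes> y \<oplus> u \<otimes> y"
      using eu e uc y(1) cc car(3) by (simp add: l_distr[symmetric] m_assoc)
    then have "u \<otimes> y \<oplus> ?e \<otimes> y = u \<otimes> y \<oplus> z" unfolding eq using e uc y(1) by (simp add: a_comm)
    then have "?e \<otimes> y = z" using e uc y(1) zc by simp
    then have "?e \<in> P" using z e y by (auto simp: saturation_def)
    moreover have "P \<subseteq> span_over P vs" "span_over {\<zero>} vs \<subseteq> span_over P vs"
      using span_upper[OF sP car(4)] span_mono[OF z0 sP _ _ car(4)] submodD(2)[OF sP] by auto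
    ultimately have "\<sigma> c \<otimes> v \<in> span_over P vs"
      using submodD(3)[OF submod_span[OF sP car(4)]] u eu by (metis subsetD)
    then have "v \<in> sat P (span_over P vs)" by (rule satI[OF P c(1) car(3)])
    then show False using Cons.prems by simp
  qed
  moreover have "v \<otimes> y \<in> span_over Z (?m (v # vs))"
    "span_over Z (?m vs) \<subseteq> span_over Z (?m (v # vs))"
    using span_Cons_upper[OF sZ, of "v \<otimes> y" "?m vs"] car(1) by auto
  ultimately have "\<not> span_over Z (?m (v # vs)) \<subseteq> sat P (span_over Z (?m vs))" by blast
  moreover have "chain P (length vs) Z (span_over Z (?m vs))" using Cons by simp
  moreover have "submod (span_over Z (?m (v # vs)))" using submod_span[OF sZ car(1)] .
  ultimately show ?case using \<open>span_over Z (?m vs) \<subseteq> span_over Z (?m (v # vs))\<close>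
    unfolding length_Cons local_chain.simps by blast
qed

text \<open>A step of a chain of ideals is at least as long as the residue field of \<open>P\<close>, which has length at
  least \<open>length vs\<close> for the action through \<open>\<sigma>\<close>.\<close>

lemma chain_refine:
  assumes P: "primeideal P R" and vs: "set vs \<subseteq> carrier R" "independent_mod P vs"
  shows "local_chain R (\<lambda>x. x) P n X Y \<Longrightarrow> chain P (n * length vs) X Y"
proof (induction n arbitrary: Y)
  case 0
  then show ?case using ideal_submod submodule_id_iff_ideal by auto
next
  case (Suc n)
  interpret I: twisted_ring R "\<lambda>x. x" by (rule twisted_ring_id)
  obtain Z where Z: "local_chain R (\<lambda>x. x) P n X Z" "Z \<subseteq> Y" "\<not> Y \<subseteq> I.sat P Z" and Y: "I.submod Y"
    using Suc.prems by auto
  have iZ: "ideal Z R" and iY: "ideal Y R"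
    using I.chain_submod[OF P Z(1)] Y submodule_id_iff_ideal by auto
  obtain y where y: "y \<in> Y" "y \<notin> I.sat P Z" using Z by blast
  have yc: "y \<in> carrier R" using y I.submodD(1)[OF Y] by auto
  have "set (map (\<lambda>v. v \<otimes> y) vs) \<subseteq> Y" using vs(1) y(1) I.submodD(4)[OF Y] by auto
  then have "span_over Z (map (\<lambda>v. v \<otimes> y) vs) \<subseteq> Y"
    using Z(2) by (intro span_least ideal_submod[OF iY])
  then have "chain P (length vs) Z Y"
    using chain_mono[OF P chain_span_mult[OF P iZ yc y(2) vs]] ideal_submod iZ iY by blast
  from chain_concat[OF P this Suc.IH[OF Z(1)]] show ?case by (simp add: add.commute)
qed

end

end

section \<open>The Frobenius endomorphism\<close>

text \<open>If \<open>A\<close> and \<open>B\<close> are commuting operators and \<open>c i j = A^i B^j x\<close>, then this is \<open>(A + B)^n x\<close>. It is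
  used twice: for the powers of a sum of ring elements, and for iterated commutators of an operator
  with a ring element.\<close>

primrec pascal_sum :: "('a, 'm) ring_scheme \<Rightarrow> nat \<Rightarrow> (nat \<Rightarrow> nat \<Rightarrow> 'a) \<Rightarrow> 'a" where
  "pascal_sum R 0 c = c 0 0"
| "pascal_sum R (Suc n) c =
     pascal_sum R n (\<lambda>i j. c (Suc i) j) \<oplus>\<^bsub>R\<^esub> pascal_sum R n (\<lambda>i j. c i (Suc j))"

lemma (in cring) pascal_sum_binomial:
  assumes "\<And>i j. c i j \<in> carrier R"
  shows "pascal_sum R n c = (\<Oplus>k\<in>{..n}. add_pow R (n choose k) (c k (n - k)))"
  using assms
proof (induction n arbitrary: c)
  case (Suc n)
  note [simp] = Suc.prems
  let ?t = "\<lambda>k. add_pow R (Suc n choose k) (c k (Suc n - k))"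
  let ?u = "\<lambda>k. add_pow R (n choose Suc k) (c (Suc k) (n - k))"
  have "pascal_sum R n (\<lambda>i j. c i (Suc j)) = (\<Oplus>k\<in>{..n}. add_pow R (n choose k) (c k (Suc n - k)))"
    using Suc.IH[of "\<lambda>i j. c i (Suc j)"] by (simp add: Suc_diff_le cong: finsum_cong)
  also have "\<dots> = (\<Oplus>k\<in>{..Suc n}. add_pow R (n choose k) (c k (Suc n - k)))"
    by (subst finsum_Suc) (auto simp: binomial_eq_0)
  also have "\<dots> = (\<Oplus>k\<in>{..n}. ?u k) \<oplus> c 0 (Suc n)"
    by (subst finsum_Suc2) auto
  finally have b: "pascal_sum R n (\<lambda>i j. c i (Suc j)) = (\<Oplus>k\<in>{..n}. ?u k) \<oplus> c 0 (Suc n)" .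
  have "(\<Oplus>k\<in>{..Suc n}. ?t k) = (\<Oplus>k\<in>{..n}. ?t (Suc k)) \<oplus> c 0 (Suc n)"
    by (subst finsum_Suc2) auto
  also have "(\<Oplus>k\<in>{..n}. ?t (Suc k)) =
      (\<Oplus>k\<in>{..n}. add_pow R (n choose k) (c (Suc k) (n - k)) \<oplus> ?u k)"
    by (intro finsum_cong) (auto simp: add.nat_pow_mult)
  also have "\<dots> = (\<Oplus>k\<in>{..n}. add_pow R (n choose k) (c (Suc k) (n - k))) \<oplus> (\<Oplus>k\<in>{..n}. ?u k)"
    by (intro finsum_addf) auto
  finally show ?case
    using Suc.IH[of "\<lambda>i j. c (Suc i) j"] b by (simp add: a_assoc)
qed simp

lemma (in cring) pascal_sum_power:
  assumes "a \<in> carrier R" "b \<in> carrier R"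
  shows "x \<in> carrier R \<Longrightarrow> pascal_sum R n (\<lambda>i j. x \<otimes> (a [^] i \<otimes> b [^] j)) = x \<otimes> (a \<oplus> b) [^] n"
proof (induction n arbitrary: x)
  case (Suc n)
  have "(\<lambda>i j::nat. x \<otimes> (a [^] Suc i \<otimes> b [^] j)) = (\<lambda>i j. (x \<otimes> a) \<otimes> (a [^] i \<otimes> b [^] j))"
    "(\<lambda>(i::nat) j. x \<otimes> (a [^] i \<otimes> b [^] Suc j)) = (\<lambda>i j. (x \<otimes> b) \<otimes> (a [^] i \<otimes> b [^] j))"
    using assms Suc.prems by (auto simp: m_ac intro!: ext)
  then have "pascal_sum R (Suc n) (\<lambda>i j. x \<otimes> (a [^] i \<otimes> b [^] j)) =
      (x \<otimes> a) \<otimes> (a \<oplus> b) [^] n \<oplus> (x \<otimes> b) \<otimes> (a \<oplus> b) [^] n"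
    using Suc.IH[of "x \<otimes> a"] Suc.IH[of "x \<otimes> b"] assms Suc.prems by (simp del: nat_pow_Suc)
  also have "\<dots> = x \<otimes> (a \<oplus> b) [^] Suc n"
    using assms Suc.prems by (simp add: l_distr r_distr m_ac)
  finally show ?case .
qed (use assms in simp)

locale char_p_ring = cring R for R (structure) +
  fixes p :: nat
  assumes prime_p: "Factorial_Ring.prime p" and char_p: "add_pow R p \<one> = \<zero>"
begin

lemma p_multiple_zero:
  assumes "x \<in> carrier R" "p dvd n"
  shows "add_pow R n x = \<zero>"
proof -
  obtain m where n: "n = p * m" using assms by blast
  have "add_pow R p x = add_pow R p (\<one> \<otimes> x)" using assms by simp
  also have "\<dots> = \<zero>" using add_pow_ldistr[of \<one> x p] assms char_p by simp
  finally show ?thesis unfolding n using add.nat_pow_pow[OF assms(1), of m p] by simp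
qed

text \<open>The inner binomial coefficients of \<open>p\<close> are multiples of \<open>p\<close>.\<close>

lemma pascal_sum_p:
  assumes c: "\<And>i j. c i j \<in> carrier R"
  shows "pascal_sum R p c = c p 0 \<oplus> c 0 p"
proof -
  let ?t = "\<lambda>k. add_pow R (p choose k) (c k (p - k))"
  define m where "m = p - 2"
  have m: "p = Suc (Suc m)" using prime_ge_2_nat[OF prime_p] by (simp add: m_def)
  have z: "?t (Suc k) = \<zero>" if "k \<in> {..m}" for k
  proof (rule p_multiple_zero)
    show "p dvd p choose Suc k" using that m by (intro dvd_choose_prime prime_p) auto
  qed (rule c)
  have t: "?t \<in> A \<rightarrow> carrier R" for A using c by simp
  have t0: "?t 0 = c 0 p" "?t (Suc (Suc m)) = c p 0" using c by (simp_all add: m)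
  have "pascal_sum R p c = (\<Oplus>k\<in>{..Suc (Suc m)}. ?t k)"
    by (rule trans[OF pascal_sum_binomial[of c p, OF c] arg_cong[OF m, where f = "\<lambda>n. finsum R ?t {..n}"]])
  also have "\<dots> = c p 0 \<oplus> ((\<Oplus>k\<in>{..m}. ?t (Suc k)) \<oplus> c 0 p)"
    by (simp only: finsum_Suc[where n = "Suc m", OF t] finsum_Suc2[where n = m, OF t] t0)
  also have "(\<Oplus>k\<in>{..m}. ?t (Suc k)) = (\<Oplus>k\<in>{..m}. \<zero>)" using z by (intro finsum_cong) auto
  also have "\<dots> = \<zero>" by simp
  finally show ?thesis using c by simp
qed

lemma power_p_add:
  assumes "a \<in> carrier R" "b \<in> carrier R"
  shows "(a \<oplus> b) [^] p = a [^] p \<oplus> b [^] p"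
  using pascal_sum_power[OF assms one_closed, of p] pascal_sum_p[of "\<lambda>i j. \<one> \<otimes> (a [^] i \<otimes> b [^] j)"] assms
  by simp

lemma power_pe_add:
  assumes "a \<in> carrier R" "b \<in> carrier R"
  shows "(a \<oplus> b) [^] (p ^ e) = a [^] (p ^ e) \<oplus> b [^] (p ^ e)"
proof (induction e)
  case (Suc e)
  have "(a \<oplus> b) [^] (p ^ Suc e) = ((a \<oplus> b) [^] (p ^ e)) [^] p"
    using assms by (simp add: nat_pow_pow mult.commute)
  also have "\<dots> = (a [^] (p ^ e)) [^] p \<oplus> (b [^] (p ^ e)) [^] p"
    unfolding Suc using assms by (intro power_p_add) auto
  finally show ?case using assms by (simp add: nat_pow_pow mult.commute)
qed (use assms in simp)

lemma twisted_ring_frobenius: "twisted_ring R (\<lambda>a. a [^] (p ^ e))"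
  by unfold_locales (auto simp: power_pe_add nat_pow_distrib)

end

section \<open>The rank of Frobenius along a chain of primes\<close>

locale noetherian_char_p = noetherian_cring + char_p_ring
begin

text \<open>Write \<open>A\<close> for the localization of \<open>R/Q\<close> at \<open>Q'\<close>, a one-dimensional local domain, and let \<open>t\<close> be a
  nonzero element of its maximal ideal and \<open>L\<close> the length of \<open>A/tA\<close>. Consider lengths over the \<open>p\<close>-th
  powers of \<open>A\<close>. The ideal chain of \<open>A/t^p A\<close> has \<open>p L\<close> steps, each of which can be refined by
  \<open>length vs\<close> steps, so that \<open>A/t^p A\<close> has length at least \<open>p L \<cdot> length vs\<close>. On the other hand, let \<open>W\<close>
  be the span of \<open>ws\<close>. Then \<open>A/W\<close> has finite length and \<open>t^p\<close> acts injectively, so that \<open>A/W\<close> and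
  \<open>t^p A/t^p W\<close> have the same length, and therefore so have \<open>A/t^p A\<close> and \<open>W/t^p W\<close>. The latter is
  generated by \<open>ws\<close> and annihilated by \<open>t^p\<close>, hence of length at most \<open>L \<cdot> length ws\<close>.\<close>

lemma frobenius_rank_step:
  assumes Q: "primeideal Q R" and Q': "primeideal Q' R" and QQ': "Q \<subset> Q'"
    and between: "\<And>T. primeideal T R \<Longrightarrow> Q \<subseteq> T \<Longrightarrow> T \<subseteq> Q' \<Longrightarrow> T = Q \<or> T = Q'"
    and bs: "set bs \<subseteq> carrier R" "carrier R \<subseteq> twisted_span R (\<lambda>a. a [^] p) {\<zero>} bs"
    and ws: "set ws \<subseteq> carrier R"
      "carrier R \<subseteq> saturation R (\<lambda>a. a [^] p) Q (twisted_span R (\<lambda>a. a [^] p) Q ws)"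
    and vs: "set vs \<subseteq> carrier R" "twisted_ring.independent_mod R (\<lambda>a. a [^] p) Q' vs"
  shows "p * length vs \<le> length ws"
proof -
  interpret I: twisted_ring R "\<lambda>x. x" by (rule twisted_ring_id)
  interpret F: twisted_ring R "\<lambda>a. a [^] p" using twisted_ring_frobenius[of 1] by simp
  note iQ = primeideal.axioms(1)[OF Q]
  note sQ = F.ideal_submod[OF iQ] I.ideal_submod[OF iQ]
  have finite_length: "\<exists>l. local_length_le R (\<lambda>x. x) Q' l (I.span_over Q [c]) (carrier R) \<and>
      I.chain Q' l (I.span_over Q [c]) (carrier R)" if c: "c \<in> carrier R - Q" for c
  proof -
    have sp: "I.submod (I.span_over Q [c])" "Q \<subseteq> I.span_over Q [c]" "c \<in> I.span_over Q [c]"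
      using I.submod_span[OF sQ(2), of "[c]"] I.span_upper[OF sQ(2), of "[c]"] c by auto
    have "\<exists>l. local_length_le R (\<lambda>x. x) Q' l (I.span_over Q [c]) (carrier R)"
    proof (rule finite_local_length[OF Q'])
      show "ideal (I.span_over Q [c]) R" using sp(1) submodule_id_iff_ideal by simp
      fix T assume T: "primeideal T R" "I.span_over Q [c] \<subseteq> T" "T \<subseteq> Q'"
      then have "T = Q \<or> T = Q'" using between sp(2) by blast
      moreover have "c \<in> T" using T(2) sp(3) by blast
      ultimately show "T = Q'" using c by blast
    qed
    then obtain l where l: "local_length_le R (\<lambda>x. x) Q' l (I.span_over Q [c]) (carrier R)" by blast
    have "I.span_over Q [c] \<subseteq> carrier R" using I.submodD(1)[OF sp(1)] by blast
    from I.ex_longest_chain[OF l sp(1) I.submod_carrier this] show ?thesis by blast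
  qed
  obtain t where t: "t \<in> Q'" "t \<notin> Q" using QQ' by blast
  have tc: "t \<in> carrier R - Q" using t ideal.Icarr[OF primeideal.axioms(1)[OF Q']] by auto
  have tn: "t [^] n \<in> carrier R - Q" for n :: nat
    by (induction n) (use tc I.denominators[OF Q] in auto)
  define D where "D = I.span_over Q [t]"
  have D: "I.submod D" "ideal D R" "Q \<subseteq> D" "t \<in> D" "D \<subseteq> Q'"
    and D_elem: "\<And>d. d \<in> D \<Longrightarrow> \<exists>r\<in>carrier R. \<exists>q\<in>Q. d = r \<otimes> t \<oplus> q"
    using I.submod_span[OF sQ(2), of "[t]"] I.span_upper[OF sQ(2), of "[t]"] tc
      I.span_least[of Q' Q "[t]"] I.ideal_submod[OF primeideal.axioms(1)[OF Q']] QQ' t(1)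
    unfolding D_def submodule_id_iff_ideal[symmetric] by (simp, simp, simp, simp, simp, auto)
  obtain L where L: "local_length_le R (\<lambda>x. x) Q' L D (carrier R)" "I.chain Q' L D (carrier R)"
    using finite_length[OF tc] unfolding D_def by blast
  have "0 < L"
  proof -
    have "\<one> \<notin> I.sat Q' D" using D(5) by (auto simp: saturation_def)
    then have "\<not> carrier R \<subseteq> I.sat Q' D" by blast
    moreover have "D \<subseteq> carrier R" using I.submodD(1)[OF D(1)] by blast
    ultimately have "I.chain Q' (Suc 0) D (carrier R)"
      unfolding local_chain.simps using D(1) I.submod_carrier by blast
    then have "Suc 0 \<le> L" using L(1) unfolding local_length_le_def by blast
    then show ?thesis by simp
  qed
  \<comment> \<open>The chain of the ideals \<open>t^j R + Q\<close>, whose quotients all have length \<open>L\<close>.\<close>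
  define T where "T j = (\<otimes>) (t [^] j) ` carrier R <+>\<^bsub>R\<^esub> Q" for j :: nat
  have IT: "I.submod (T j)" for j
    unfolding T_def using tn sQ I.submod_carrier by (intro I.submod_set_add I.submod_mult_image) auto
  have powers: "I.chain Q' (j * L) (T j) (carrier R)" for j
  proof (induction j)
    case 0
    have "T 0 \<subseteq> carrier R" using IT[of 0] I.submodD(1) by blast
    then show ?case using IT I.submod_carrier by simp
  next
    case (Suc j)
    have "I.chain Q' L ((\<otimes>) (t [^] j) ` D <+>\<^bsub>R\<^esub> Q) (T j)"
      unfolding T_def by (rule I.chain_mult_image[OF Q' Q tn D(3) sQ(2) L(2)])
    moreover have "T (Suc j) \<subseteq> (\<otimes>) (t [^] j) ` D <+>\<^bsub>R\<^esub> Q"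
      unfolding T_def
    proof (intro I.set_add_mono order_refl image_subsetI)
      fix r assume r: "r \<in> carrier R"
      have "t [^] Suc j \<otimes> r = t [^] j \<otimes> (r \<otimes> t)" using r tc by (simp add: m_ac)
      moreover have "r \<otimes> t \<in> D" using I.submodD(4)[OF D(1) r D(4)] .
      ultimately show "t [^] Suc j \<otimes> r \<in> (\<otimes>) (t [^] j) ` D" by blast
    qed
    ultimately have "I.chain Q' L (T (Suc j)) (T j)"
      using I.chain_mono[OF Q'] IT by blast
    from I.chain_concat[OF Q' Suc this] show ?case by (simp add: add.commute)
  qed
  define W where "W = F.span_over Q ws"
  define TW where "TW = (\<otimes>) (t [^] p) ` W <+>\<^bsub>R\<^esub> Q"
  have W: "F.submod W" "Q \<subseteq> W" "set ws \<subseteq> W" "W \<subseteq> carrier R"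
    unfolding W_def using F.submod_span[OF sQ(1) ws(1)] F.span_upper[OF sQ(1) ws(1)] F.submodD(1) by auto
  have TW: "F.submod TW" "TW \<subseteq> W" "Q \<subseteq> TW" "(\<otimes>) (t [^] p) ` W \<subseteq> TW"
  proof -
    have *: "F.submod ((\<otimes>) (t [^] p) ` W)" using W tc by (intro F.submod_mult_image) auto
    show "F.submod TW" "Q \<subseteq> TW" "(\<otimes>) (t [^] p) ` W \<subseteq> TW"
      unfolding TW_def using F.submod_set_add[OF * sQ(1)] F.set_add_upper[OF * sQ(1)] by auto
    show "TW \<subseteq> W" unfolding TW_def using W(2) F.submodD(4)[OF W(1), of t] tc
      by (intro F.set_add_least[OF W(1)]) auto
  qed
  \<comment> \<open>One multiplier \<open>c\<close> outside \<open>Q\<close> moves all of \<open>R\<close> into \<open>W\<close>; this bounds the length of \<open>R/W\<close>.\<close>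
  have "set bs \<subseteq> F.sat Q W" using bs(1) ws(2) unfolding W_def by blast
  from F.common_denominator[OF Q W(1) finite_set this]
  obtain c where c: "c \<in> carrier R - Q" and cb: "\<And>b. b \<in> set bs \<Longrightarrow> c [^] p \<otimes> b \<in> W"
    by auto
  obtain lc where lc: "local_length_le R (\<lambda>x. x) Q' lc (I.span_over Q [c]) (carrier R)"
    using finite_length[OF c] by blast
  have Q_pow: "q [^] p \<otimes> b \<in> Q" if "q \<in> Q" "b \<in> carrier R" for q b
  proof -
    obtain m where "p = Suc m" using prime_p by (metis not0_implies_Suc not_prime_0)
    then have "q [^] p = q [^] m \<otimes> q" by simp
    then show ?thesis
      using that ideal.I_l_closed[OF iQ that(1), of "q [^] m"] ideal.Icarr[OF iQ that(1)]
        ideal.I_r_closed[OF iQ] by simp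
  qed
  have pow_sum: "(r \<otimes> d \<oplus> q) [^] p \<otimes> b \<in> X"
    if "F.submod X" "Q \<subseteq> X" "r \<in> carrier R" "d \<in> carrier R" "q \<in> Q" "b \<in> carrier R" "d [^] p \<otimes> b \<in> X"
    for r d q b X
  proof -
    have qc: "q \<in> carrier R" using that(5) ideal.Icarr[OF iQ] by blast
    have "(r \<otimes> d \<oplus> q) [^] p \<otimes> b = r [^] p \<otimes> (d [^] p \<otimes> b) \<oplus> q [^] p \<otimes> b"
      using that qc by (simp add: F.sigma_add F.sigma_mult l_distr m_assoc)
    then show ?thesis using F.submodD(3)[OF that(1) F.submodD(4)[OF that(1,3,7)]] Q_pow[OF that(5,6)] that(2)
      by auto
  qed
  have WB: "F.span_over W bs = carrier R"
  proof
    show "F.span_over W bs \<subseteq> carrier R" using F.submod_span[OF W(1) bs(1)] F.submodD(1) by blast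
    have "F.span_over {\<zero>} bs \<subseteq> F.span_over W bs"
      using F.submodD(2)[OF W(1)] F.submod_span[OF W(1) bs(1)] F.span_upper[OF W(1) bs(1)]
      by (intro F.span_least) auto
    then show "carrier R \<subseteq> F.span_over W bs" using bs(2) by blast
  qed
  have "local_length_le R (\<lambda>a. a [^] p) Q' (length bs * lc) W (F.span_over W bs)"
  proof (rule F.local_length_span[OF Q' W(1) bs(1) _ _ lc])
    show "ideal (I.span_over Q [c]) R"
      using I.submod_span[OF sQ(2), of "[c]"] c submodule_id_iff_ideal by simp
    fix d b assume "d \<in> I.span_over Q [c]" "b \<in> set bs"
    then show "d [^] p \<otimes> b \<in> W" using pow_sum[OF W(1,2)] c cb bs(1) by auto
  qed
  then have WC: "local_length_le R (\<lambda>a. a [^] p) Q' (length bs * lc) W (carrier R)" using WB by simp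
  obtain A where A: "F.chain Q' A W (carrier R)" and A_max: "local_length_le R (\<lambda>a. a [^] p) Q' A W (carrier R)"
    using F.ex_longest_chain[OF WC W(1) F.submod_carrier W(4)] by blast
  \<comment> \<open>Concatenating a longest chain from \<open>TW\<close> to \<open>T p\<close> with the refined ideal chain from \<open>T p\<close> to \<open>R\<close>, and
    splitting the result at \<open>W\<close> instead, makes the length \<open>A\<close> of \<open>R/W\<close> cancel.\<close>
  have "F.chain Q' A TW (T p)"
    unfolding TW_def T_def by (rule F.chain_mult_image[OF Q' Q tn W(2) sQ(1) A])
  moreover have "F.chain Q' (p * L * length vs) (T p) (carrier R)"
    by (rule F.chain_refine[OF Q' vs powers])
  ultimately have "F.chain Q' (A + p * L * length vs) TW (carrier R)"
    by (rule F.chain_concat[OF Q', rotated])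
  then obtain a b where ab: "A + p * L * length vs \<le> a + b" "F.chain Q' a TW W" "F.chain Q' b W (carrier R)"
    using F.chain_split[OF Q' _ W(1) TW(2) W(4)] by blast
  have "local_length_le R (\<lambda>a. a [^] p) Q' (length ws * L) TW (F.span_over TW ws)"
  proof (rule F.local_length_span[OF Q' TW(1) ws(1) D(2) _ L(1)])
    fix d w assume d: "d \<in> D" and w: "w \<in> set ws"
    then have "t [^] p \<otimes> w \<in> TW" using W(3) TW(4) by blast
    then show "d [^] p \<otimes> w \<in> TW" using pow_sum[OF TW(1,3)] D_elem[OF d] tc ws(1) w by auto
  qed
  moreover have "F.chain Q' a TW (F.span_over TW ws)"
  proof (rule F.chain_mono[OF Q' ab(2) TW(1) _ order_refl])
    show "F.submod (F.span_over TW ws)" by (rule F.submod_span[OF TW(1) ws(1)])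
    show "W \<subseteq> F.span_over TW ws" unfolding W_def
      by (rule F.span_mono[OF sQ(1) TW(1,3) order_refl ws(1)])
  qed
  ultimately have "a \<le> length ws * L" by (simp add: local_length_le_def)
  moreover have "b \<le> A" using A_max ab(3) by (simp add: local_length_le_def)
  ultimately have "p * L * length vs \<le> length ws * L" using ab(1) by linarith
  moreover have "p * L * length vs = p * length vs * L" by (simp add: ac_simps)
  ultimately have "p * length vs * L \<le> length ws * L" by (simp only:)
  then show ?thesis using \<open>0 < L\<close> by (rule mult_right_le_imp_le)
qed

end


section \<open>Freeness of Frobenius at a regular point\<close>

context twisted_ring
begin

context
  notes [simp] = sigma_closed sigma_one sigma_zero
begin

lemma submod_zero: "submod {\<zero>}"
  by (rule submodI) auto

lemma submod_mult_preimage: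
  assumes X: "submod X" and u: "u \<in> carrier R"
  shows "submod {s \<in> carrier R. u \<otimes> s \<in> X}"
proof (rule submodI)
  fix a x assume "a \<in> carrier R" "x \<in> {s \<in> carrier R. u \<otimes> s \<in> X}"
  then show "\<sigma> a \<otimes> x \<in> {s \<in> carrier R. u \<otimes> s \<in> X}"
    using u submodD(4)[OF X, of a "u \<otimes> x"] by (simp add: m_lcomm)
qed (use u submodD(2,3)[OF X] in \<open>auto simp: r_distr\<close>)

text \<open>Nakayama's lemma. The hypothesis on \<open>K\<close> says that it lies in the submodule generated by the products
  \<open>\<sigma>(x) r\<close> with \<open>x \<in> P\<close>. The generators
  \<open>bs\<close> of \<open>R\<close> over \<open>W\<close> are removed one at a time: an equation \<open>\<sigma>(c) b = \<sigma>(m) b + n\<close> with \<open>c \<notin> P\<close> and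
  \<open>m \<in> P\<close> makes \<open>\<sigma>(c - m) b = n\<close> redundant.\<close>

lemma nakayama:
  assumes P: "primeideal P R" and W: "submod W"
    and K: "submod K" "\<And>Z. submod Z \<Longrightarrow> (\<And>x r. x \<in> P \<Longrightarrow> r \<in> carrier R \<Longrightarrow> \<sigma> x \<otimes> r \<in> Z) \<Longrightarrow> K \<subseteq> Z"
    and WK: "carrier R \<subseteq> sat P (W \<boxplus> K)"
  shows "set bs \<subseteq> carrier R \<Longrightarrow> carrier R \<subseteq> sat P (span_over W bs) \<Longrightarrow> carrier R \<subseteq> sat P W"
proof (induction bs)
  case (Cons b bs)
  note iP = primeideal.axioms(1)[OF P]
  have b: "b \<in> carrier R" "set bs \<subseteq> carrier R" using Cons.prems by auto
  define N where "N = sat P (span_over W bs)"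
  have N0: "submod (span_over W bs)" using submod_span[OF W b(2)] .
  have N: "submod N" "span_over W bs \<subseteq> N" "W \<subseteq> N" "sat P N \<subseteq> N"
    unfolding N_def using submod_sat[OF P N0] sat_upper[OF P N0] span_upper[OF W b(2)] sat_idem[OF P N0]
    by auto
  define Z where "Z = {\<sigma> m \<otimes> b \<oplus> n | m n. m \<in> P \<and> n \<in> N}"
  have ZI: "\<sigma> m \<otimes> b \<oplus> n \<in> Z" if "m \<in> P" "n \<in> N" for m n using that unfolding Z_def by blast
  have ZE: "\<exists>m\<in>P. \<exists>n\<in>N. z = \<sigma> m \<otimes> b \<oplus> n" if "z \<in> Z" for z using that unfolding Z_def by blast
  have Pc: "m \<in> carrier R" if "m \<in> P" for m using that ideal.Icarr[OF iP] by blast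
  note sP = twisted_ring.submodD[OF twisted_ring_id twisted_ring.ideal_submod[OF twisted_ring_id iP]]
  have Nc: "n \<in> carrier R" if "n \<in> N" for n using that submodD(1)[OF N(1)] by blast
  have P0: "\<zero> \<in> P" using sP(2) .
  have N_sub: "N \<subseteq> Z"
  proof
    fix n assume n: "n \<in> N"
    then show "n \<in> Z" using ZI[OF P0 n] b Nc[OF n] by simp
  qed
  have Z: "submod Z"
  proof (rule submodI)
    show "Z \<subseteq> carrier R" using ZE Pc Nc b by fastforce
    show "\<zero> \<in> Z" using N_sub submodD(2)[OF N(1)] by blast
  next
    fix x y assume "x \<in> Z" "y \<in> Z"
    then obtain m n m' n' where *: "m \<in> P" "n \<in> N" "m' \<in> P" "n' \<in> N"
      and xy: "x = \<sigma> m \<otimes> b \<oplus> n" "y = \<sigma> m' \<otimes> b \<oplus> n'" using ZE by meson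
    have "x \<oplus> y = \<sigma> (m \<oplus> m') \<otimes> b \<oplus> (n \<oplus> n')"
      unfolding xy using * Pc Nc b by (simp add: sigma_add l_distr a_ac)
    then show "x \<oplus> y \<in> Z" using ZI[OF sP(3)[OF *(1,3)] submodD(3)[OF N(1) *(2,4)]] by simp
  next
    fix a x assume a: "a \<in> carrier R" and "x \<in> Z"
    then obtain m n where *: "m \<in> P" "n \<in> N" and x: "x = \<sigma> m \<otimes> b \<oplus> n" using ZE by meson
    have "\<sigma> a \<otimes> x = \<sigma> (a \<otimes> m) \<otimes> b \<oplus> \<sigma> a \<otimes> n"
      unfolding x using * a Pc Nc b by (simp add: sigma_mult r_distr m_assoc)
    then show "\<sigma> a \<otimes> x \<in> Z" using ZI[OF sP(4)[OF a *(1)] submodD(4)[OF N(1) a *(2)]] by simp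
  qed
  have "\<sigma> x \<otimes> r \<in> sat P Z" if x: "x \<in> P" and r: "r \<in> carrier R" for x r
  proof -
    have "r \<in> sat P (span_over W (b # bs))" using Cons.prems(2) r by blast
    then obtain c where c: "c \<in> carrier R - P" "\<sigma> c \<otimes> r \<in> span_over W (b # bs)" by (metis satE[OF P])
    then obtain a n where a: "a \<in> carrier R" and n: "n \<in> span_over W bs"
      and eq: "\<sigma> c \<otimes> r = \<sigma> a \<otimes> b \<oplus> n" by auto
    have n': "n \<in> N" using n N(2) by blast
    have "\<sigma> c \<otimes> (\<sigma> x \<otimes> r) = \<sigma> x \<otimes> (\<sigma> a \<otimes> b \<oplus> n)"
      unfolding eq[symmetric] using c r Pc[OF x] by (simp add: m_lcomm)
    also have "\<dots> = \<sigma> (a \<otimes> x) \<otimes> b \<oplus> \<sigma> x \<otimes> n"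
      using a b Nc[OF n'] Pc[OF x] by (simp add: sigma_mult r_distr m_ac)
    also have "\<dots> \<in> Z" by (rule ZI[OF sP(4)[OF a x] submodD(4)[OF N(1) Pc[OF x] n']])
    finally show ?thesis using satI[OF P c(1)] r Pc[OF x] by simp
  qed
  then have "K \<subseteq> sat P Z" by (intro K(2) submod_sat[OF P Z])
  moreover have "W \<subseteq> sat P Z" using N(3) N_sub sat_upper[OF P Z] by blast
  ultimately have "W \<boxplus> K \<subseteq> sat P Z" by (intro set_add_least submod_sat[OF P Z])
  then have "carrier R \<subseteq> sat P Z" using sat_trans[OF P Z WK] by blast
  then have "b \<in> sat P Z" using b by blast
  then obtain c where c: "c \<in> carrier R - P" and "\<sigma> c \<otimes> b \<in> Z" by (metis satE[OF P])
  then obtain m n where m: "m \<in> P" and n: "n \<in> N" and eq: "\<sigma> c \<otimes> b = \<sigma> m \<otimes> b \<oplus> n" using ZE by meson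
  have cm: "c \<ominus> m \<in> carrier R - P"
  proof -
    have "c \<ominus> m \<notin> P"
    proof
      assume "c \<ominus> m \<in> P"
      then have "(c \<ominus> m) \<oplus> m \<in> P" using sP(3) m by blast
      moreover have "(c \<ominus> m) \<oplus> m = c" using c Pc[OF m] by (simp add: a_minus_def a_assoc l_neg)
      ultimately show False using c by simp
    qed
    then show ?thesis using c Pc[OF m] by simp
  qed
  have "\<sigma> (c \<ominus> m) \<otimes> b = \<sigma> c \<otimes> b \<ominus> \<sigma> m \<otimes> b"
    using c Pc[OF m] b by (simp add: a_minus_def sigma_add sigma_minus l_distr l_minus)
  also have "\<dots> = n" unfolding eq using Nc[OF n] Pc[OF m] b
    by (simp add: a_minus_def a_comm[of "\<sigma> m \<otimes> b"] a_assoc r_neg)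
  finally have "b \<in> sat P N" using n satI[OF P cm b(1)] by simp
  then have "b \<in> N" using N(4) by blast
  then have "span_over W (b # bs) \<subseteq> N"
    using N(2) span_upper[OF W b(2)] by (intro span_least[OF N(1) N(3)]) auto
  then have "carrier R \<subseteq> sat P (span_over W bs)"
    using sat_trans[OF P N0 Cons.prems(2)] unfolding N_def by blast
  then show ?case using Cons.IH b by blast
qed simp

end

end

context char_p_ring
begin

abbreviation "frob \<equiv> \<lambda>a. a [^] p"

lemma twisted_ring_frob: "twisted_ring R frob"
  using twisted_ring_frobenius[of 1] by simp

definition power_multiples :: "'a \<Rightarrow> 'a list \<Rightarrow> 'a list" where
  "power_multiples x us = concat (map (\<lambda>j. map (\<lambda>u. x [^] j \<otimes> u) us) [0..<p])"

lemma length_power_multiples: "length (power_multiples x us) = p * length us"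
  by (simp add: power_multiples_def length_concat comp_def sum_list_triv)

lemma set_power_multiples: "set (power_multiples x us) = {x [^] j \<otimes> u | j u. j < p \<and> u \<in> set us}"
  by (fastforce simp: power_multiples_def)

text \<open>Let \<open>U\<close> be the span of \<open>us\<close>. If \<open>R = U + I + x R\<close> locally, then substituting this equation into its
  last term \<open>p\<close> times gives \<open>R = U + x U + \<dots> + x^(p-1) U + I + x^p R\<close>.\<close>

lemma spanning_power_multiples:
  assumes P: "primeideal P R" and I: "ideal I R" and x: "x \<in> carrier R" and us: "set us \<subseteq> carrier R"
    and span: "carrier R \<subseteq> saturation R frob P (twisted_span R frob (twisted_span R (\<lambda>x. x) I [x]) us)"
  shows "carrier R \<subseteq> saturation R frob P
    (twisted_span R frob (twisted_span R (\<lambda>x. x) I [x [^] p]) (power_multiples x us))"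
proof -
  interpret I: twisted_ring R "\<lambda>x. x" by (rule twisted_ring_id)
  interpret F: twisted_ring R frob by (rule twisted_ring_frob)
  define J where "J = I.span_over I [x [^] p]"
  have sI: "I.submod I" using I submodule_id_iff_ideal by simp
  have J: "ideal J R" "I \<subseteq> J" "x [^] p \<in> J"
    using I.submod_span[OF sI, of "[x [^] p]"] I.span_upper[OF sI, of "[x [^] p]"] x
    unfolding J_def submodule_id_iff_ideal[symmetric] by auto
  note sJ = F.ideal_submod[OF J(1)]
  have pm: "set (power_multiples x us) \<subseteq> carrier R" using x us by (auto simp: set_power_multiples)
  define V where "V = F.span_over J (power_multiples x us)"
  have V: "F.submod V" "J \<subseteq> V" "set (power_multiples x us) \<subseteq> V"
    unfolding V_def using F.submod_span[OF sJ pm] F.span_upper[OF sJ pm] by auto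
  have sV: "F.submod (F.sat P V)" "V \<subseteq> F.sat P V" using F.submod_sat[OF P V(1)] F.sat_upper[OF P V(1)] .
  have "x [^] (p - k) \<otimes> r \<in> F.sat P V" if "k \<le> p" "r \<in> carrier R" for k r
    using that
  proof (induction k arbitrary: r)
    case 0
    then have "x [^] p \<otimes> r \<in> J" using ideal.I_r_closed[OF J(1,3)] by simp
    then show ?case using V(2) sV(2) by auto
  next
    case (Suc k)
    define j where "j = p - Suc k"
    have j: "j < p" "p - k = Suc j" using Suc.prems by (auto simp: j_def)
    let ?Z = "{s \<in> carrier R. x [^] j \<otimes> s \<in> F.sat P V}"
    have Z: "F.submod ?Z" using F.submod_mult_preimage[OF sV(1)] x by simp
    have "I.span_over I [x] \<subseteq> ?Z"
    proof
      fix s assume "s \<in> I.span_over I [x]"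
      then obtain a i where s: "a \<in> carrier R" "i \<in> I" "s = a \<otimes> x \<oplus> i" by auto
      have ic: "i \<in> carrier R" using s ideal.Icarr[OF I] by blast
      have "x [^] j \<otimes> s = x [^] (p - k) \<otimes> a \<oplus> x [^] j \<otimes> i"
        unfolding s(3) j(2) using x s(1) ic by (simp add: r_distr m_ac)
      moreover have "x [^] j \<otimes> i \<in> F.sat P V"
        using ideal.I_l_closed[OF I s(2), of "x [^] j"] x J(2) V(2) sV(2) by auto
      ultimately show "s \<in> ?Z"
        using F.submodD(3)[OF sV(1) Suc.IH[OF _ s(1)]] Suc.prems x s ic by simp
    qed
    moreover have "set us \<subseteq> ?Z"
    proof
      fix u assume u: "u \<in> set us"
      then have "x [^] j \<otimes> u \<in> set (power_multiples x us)" using j unfolding set_power_multiples by blast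
      then show "u \<in> ?Z" using u us V(3) sV(2) by auto
    qed
    ultimately have sp: "F.span_over (I.span_over I [x]) us \<subseteq> ?Z" by (rule F.span_least[OF Z])
    have "r \<in> F.sat P (F.span_over (I.span_over I [x]) us)" using span Suc.prems by blast
    then obtain c where c: "c \<in> carrier R - P" "c [^] p \<otimes> r \<in> F.span_over (I.span_over I [x]) us"
      by (metis F.satE[OF P])
    then have "x [^] j \<otimes> (c [^] p \<otimes> r) \<in> F.sat P V" using sp by blast
    then have "c [^] p \<otimes> (x [^] j \<otimes> r) \<in> F.sat P V" using c x Suc.prems by (simp add: m_lcomm)
    then have "x [^] j \<otimes> r \<in> F.sat P (F.sat P V)" using c x Suc.prems by (rule_tac F.satI[OF P c(1)]) auto
    then show ?case using F.sat_idem[OF P V(1)] unfolding j_def by blast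
  qed
  from this[of p] show ?thesis unfolding V_def J_def by auto
qed

text \<open>The products of the entries of \<open>us\<close> with the monomials in \<open>xs\<close> of exponents less than \<open>p\<close>.\<close>

primrec monomial_multiples :: "'a list \<Rightarrow> 'a list \<Rightarrow> 'a list" where
  "monomial_multiples [] us = us"
| "monomial_multiples (x # xs) us = monomial_multiples xs (power_multiples x us)"

lemma length_monomial_multiples: "length (monomial_multiples xs us) = p ^ length xs * length us"
  by (induction xs arbitrary: us) (simp_all add: length_power_multiples)

lemma monomial_multiples_closed:
  "set xs \<subseteq> carrier R \<Longrightarrow> set us \<subseteq> carrier R \<Longrightarrow> set (monomial_multiples xs us) \<subseteq> carrier R"
proof (induction xs arbitrary: us)
  case (Cons x xs)
  then have "set (power_multiples x us) \<subseteq> carrier R" by (auto simp: set_power_multiples)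
  then show ?case using Cons by simp
qed simp

lemma spanning_monomial_multiples:
  assumes P: "primeideal P R"
  shows "ideal I R \<Longrightarrow> set xs \<subseteq> carrier R \<Longrightarrow> set us \<subseteq> carrier R \<Longrightarrow>
    carrier R \<subseteq> saturation R frob P (twisted_span R frob (twisted_span R (\<lambda>x. x) I xs) us) \<Longrightarrow>
    carrier R \<subseteq> saturation R frob P
      (twisted_span R frob (twisted_span R (\<lambda>x. x) I (map frob xs)) (monomial_multiples xs us))"
proof (induction xs arbitrary: I us)
  case (Cons x xs)
  interpret I: twisted_ring R "\<lambda>x. x" by (rule twisted_ring_id)
  interpret F: twisted_ring R frob by (rule twisted_ring_frob)
  have x: "x \<in> carrier R" "x [^] p \<in> carrier R" "set xs \<subseteq> carrier R" "set (map frob xs) \<subseteq> carrier R"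
    using Cons.prems by auto
  have swap: "I.span_over (I.span_over I [y]) ys = I.span_over (I.span_over I ys) [y]"
    if y: "y \<in> carrier R" "set ys \<subseteq> carrier R" for y ys
  proof (rule subset_antisym)
    have sI: "I.submod I" using Cons.prems submodule_id_iff_ideal by simp
    note a = I.submod_span[OF sI, of "[y]"] I.span_upper[OF sI, of "[y]"]
    note b = I.submod_span[OF sI y(2)] I.span_upper[OF sI y(2)]
    have y1: "set [y] \<subseteq> carrier R" using y by simp
    note a' = I.submod_span[OF a(1)[OF y1] y(2)] I.span_upper[OF a(1)[OF y1] y(2)]
    note b' = I.submod_span[OF b(1) y1] I.span_upper[OF b(1) y1]
    show "I.span_over (I.span_over I [y]) ys \<subseteq> I.span_over (I.span_over I ys) [y]"
      by (intro I.span_least b'(1) order_trans[OF b(2) b'(2)] b'(3) order_trans[OF b(3) b'(2)])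
    show "I.span_over (I.span_over I ys) [y] \<subseteq> I.span_over (I.span_over I [y]) ys"
      by (intro I.span_least a'(1) order_trans[OF a(2) a'(2)] a'(3) order_trans[OF a(3) a'(2)] y1)
  qed
  have Cons_eq: "I.span_over I (y # ys) = I.span_over (I.span_over I ys) [y]" for y ys by simp
  have iI: "ideal (I.span_over I ys) R" if "set ys \<subseteq> carrier R" for ys
    using I.submod_span[of I ys] that Cons.prems(1) submodule_id_iff_ideal by simp
  have "carrier R \<subseteq> F.sat P (F.span_over (I.span_over (I.span_over I xs) [x [^] p]) (power_multiples x us))"
    by (rule spanning_power_multiples[OF P iI[OF x(3)] x(1) Cons.prems(3) Cons.prems(4)[unfolded Cons_eq]])
  then have "carrier R \<subseteq> F.sat P (F.span_over (I.span_over (I.span_over I [x [^] p]) xs) (power_multiples x us))"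
    using swap[OF x(2,3)] by simp
  moreover have "set (power_multiples x us) \<subseteq> carrier R"
    using Cons.prems by (auto simp: set_power_multiples)
  moreover have "ideal (I.span_over I [x [^] p]) R" by (rule iI) (use x in simp)
  ultimately have "carrier R \<subseteq> F.sat P (F.span_over (I.span_over (I.span_over I [x [^] p]) (map frob xs))
      (monomial_multiples xs (power_multiples x us)))"
    using Cons.IH x(3) by blast
  then show ?case
    unfolding list.map monomial_multiples.simps Cons_eq[of "x [^] p" "map frob xs"] swap[OF x(2,4), symmetric] .
qed simp

end


text \<open>This is regularity of the local ring \<open>R\<^sub>P\<close> for a domain \<open>R\<close>, in the form in which it is used: the
  maximal ideal is generated by as many elements as a chain of primes from \<open>0\<close> to \<open>P\<close> that admits no
  refinement has steps.\<close>

definition regular_at :: "('a, 'm) ring_scheme \<Rightarrow> 'a set \<Rightarrow> bool" where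
  "regular_at R P \<longleftrightarrow> (\<exists>Q xs. Q 0 = {\<zero>\<^bsub>R\<^esub>} \<and> Q (length xs) = P \<and>
     (\<forall>i\<le>length xs. primeideal (Q i) R) \<and>
     (\<forall>i<length xs. Q i \<subset> Q (Suc i) \<and>
        (\<forall>T. primeideal T R \<longrightarrow> Q i \<subseteq> T \<longrightarrow> T \<subseteq> Q (Suc i) \<longrightarrow> T = Q i \<or> T = Q (Suc i))) \<and>
     set xs \<subseteq> P \<and> P \<subseteq> saturation R (\<lambda>x. x) P (twisted_span R (\<lambda>x. x) {\<zero>\<^bsub>R\<^esub>} xs))"

context noetherian_char_p
begin

text \<open>Iterates \<open>frobenius_rank_step\<close> down the chain. The next smaller prime needs an independent list at
  the larger one; it is extracted from \<open>bs\<close>, which generates at every prime.\<close>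

lemma frobenius_rank_chain:
  assumes primes: "\<And>i. i \<le> d \<Longrightarrow> primeideal (Q i) R" and strict: "\<And>i. i < d \<Longrightarrow> Q i \<subset> Q (Suc i)"
    and between: "\<And>i T. i < d \<Longrightarrow> primeideal T R \<Longrightarrow> Q i \<subseteq> T \<Longrightarrow> T \<subseteq> Q (Suc i) \<Longrightarrow> T = Q i \<or> T = Q (Suc i)"
    and bs: "set bs \<subseteq> carrier R" "carrier R \<subseteq> twisted_span R frob {\<zero>} bs"
    and n: "\<And>us. set us \<subseteq> carrier R \<Longrightarrow> carrier R \<subseteq> saturation R frob (Q d) (twisted_span R frob (Q d) us) \<Longrightarrow>
      n \<le> length us"
  shows "i \<le> d \<Longrightarrow> set ws \<subseteq> carrier R \<Longrightarrow>
    carrier R \<subseteq> saturation R frob (Q (d - i)) (twisted_span R frob (Q (d - i)) ws) \<Longrightarrow>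
    p ^ i * n \<le> length ws"
proof (induction i arbitrary: ws)
  case 0
  then show ?case using n by simp
next
  case (Suc i)
  interpret F: twisted_ring R frob by (rule twisted_ring_frob)
  have j: "d - Suc i < d" "Suc (d - Suc i) = d - i" using Suc.prems by auto
  have Q: "primeideal (Q (d - Suc i)) R" and Q': "primeideal (Q (d - i)) R" by (simp_all add: primes)
  note sQ' = F.ideal_submod[OF primeideal.axioms(1)[OF Q']]
  have "carrier R \<subseteq> F.span_over (Q (d - i)) bs"
    using bs(2) F.span_mono[OF F.submod_zero sQ' _ order_refl bs(1)] F.submodD(2)[OF sQ'] by blast
  then have "carrier R \<subseteq> F.sat (Q (d - i)) (F.span_over (Q (d - i)) bs)"
    using F.sat_upper[OF Q' F.submod_span[OF sQ' bs(1)]] by (rule order_trans)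
  then obtain vs where vs: "set vs \<subseteq> carrier R" "carrier R \<subseteq> F.sat (Q (d - i)) (F.span_over (Q (d - i)) vs)"
    "F.independent_mod (Q (d - i)) vs"
    using F.ex_independent_spanning[OF Q' bs(1)] by blast
  have "p ^ i * n \<le> length vs" using Suc.IH[OF _ vs(1,2)] Suc.prems(1) by simp
  moreover have "p * length vs \<le> length ws"
    by (rule frobenius_rank_step[OF Q Q' _ _ bs Suc.prems(2,3) vs(1,3)])
      (use strict[OF j(1)] between[OF j(1)] j(2) in auto)
  ultimately have "p * (p ^ i * n) \<le> length ws" using mult_le_mono2 order_trans by blast
  then show ?case by (simp add: mult.assoc)
qed

text \<open>The local part of Kunz's theorem. The list \<open>gs\<close> is made from a shortest generating list \<open>us\<close> at
  \<open>P\<close> and the parameters \<open>xs\<close>; it generates at \<open>P\<close> by Nakayama's lemma. By \<open>frobenius_rank_chain\<close> no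
  shorter list generates, even generically, and so \<open>gs\<close> is independent.\<close>

lemma ex_local_frobenius_basis:
  assumes bs: "set bs \<subseteq> carrier R" "carrier R \<subseteq> twisted_span R frob {\<zero>} bs"
    and reg: "regular_at R P" and P: "primeideal P R"
  shows "\<exists>c\<in>carrier R - P. \<exists>gs. set gs \<subseteq> carrier R \<and> twisted_ring.independent_mod R frob {\<zero>} gs \<and>
    (\<forall>s\<in>carrier R. c [^] p \<otimes> s \<in> twisted_span R frob {\<zero>} gs)"
proof -
  interpret I: twisted_ring R "\<lambda>x. x" by (rule twisted_ring_id)
  interpret F: twisted_ring R frob by (rule twisted_ring_frob)
  obtain Q xs where Q: "Q 0 = {\<zero>}" "Q (length xs) = P" "\<And>i. i \<le> length xs \<Longrightarrow> primeideal (Q i) R"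
    "\<And>i. i < length xs \<Longrightarrow> Q i \<subset> Q (Suc i)"
    "\<And>i T. i < length xs \<Longrightarrow> primeideal T R \<Longrightarrow> Q i \<subseteq> T \<Longrightarrow> T \<subseteq> Q (Suc i) \<Longrightarrow> T = Q i \<or> T = Q (Suc i)"
    and xs: "set xs \<subseteq> P" "P \<subseteq> I.sat P (I.span_over {\<zero>} xs)"
    using reg unfolding regular_at_def by auto
  note iP = primeideal.axioms(1)[OF P]
  have xsc: "set xs \<subseteq> carrier R" using xs(1) ideal.Icarr[OF iP] by blast
  note sP = F.ideal_submod[OF iP]
  define spanning where "spanning us \<longleftrightarrow> set us \<subseteq> carrier R \<and> carrier R \<subseteq> F.sat P (F.span_over P us)" for us
  have "carrier R \<subseteq> F.span_over P bs"
    using bs(2) F.span_mono[OF F.submod_zero sP _ order_refl bs(1)] F.submodD(2)[OF sP] by blast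
  then have "spanning bs"
    unfolding spanning_def using F.sat_upper[OF P F.submod_span[OF sP bs(1)]] bs(1) by blast
  then obtain us where us: "spanning us" and us_min: "\<And>vs. spanning vs \<Longrightarrow> length us \<le> length vs"
    using ex_has_least_nat[of spanning bs length] by blast
  have usc: "set us \<subseteq> carrier R" using us spanning_def by blast
  define X where "X = I.span_over {\<zero>} xs"
  have X: "I.submod X" "ideal X R"
    using I.submod_span[OF I.submod_zero xsc] submodule_id_iff_ideal by (simp_all add: X_def)
  note sX = F.ideal_submod[OF X(2)]
  have up: "F.submod (F.span_over X us)" "X \<subseteq> F.span_over X us" "set us \<subseteq> F.span_over X us"
    using F.submod_span[OF sX usc] F.span_upper[OF sX usc] by auto
  have pm: "p = Suc (p - 1)" using prime_gt_0_nat[OF prime_p] by simp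
  have "F.span_over P us \<subseteq> F.sat P (F.span_over X us)"
  proof (rule F.span_least[OF F.submod_sat[OF P up(1)]])
    show "P \<subseteq> F.sat P (F.span_over X us)"
    proof
      fix y assume "y \<in> P"
      then have "y \<in> I.sat P X" using xs(2) unfolding X_def by blast
      then obtain c where c: "c \<in> carrier R - P" "y \<in> carrier R" "c \<otimes> y \<in> X" by (metis I.satE[OF P])
      have "c [^] p \<otimes> y = c [^] (p - 1) \<otimes> (c \<otimes> y)"
        using c by (subst pm) (simp add: m_assoc)
      also have "\<dots> \<in> X" using ideal.I_l_closed[OF X(2) c(3)] c by simp
      finally show "y \<in> F.sat P (F.span_over X us)" using up(2) c by (intro F.satI[OF P c(1)]) auto
    qed
    show "set us \<subseteq> F.sat P (F.span_over X us)" using up(3) F.sat_upper[OF P up(1)] by blast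
  qed
  then have "carrier R \<subseteq> F.sat P (F.span_over X us)"
    using us F.sat_trans[OF P up(1)] unfolding spanning_def by blast
  define gs where "gs = monomial_multiples xs us"
  define K where "K = I.span_over {\<zero>} (map frob xs)"
  have gs: "set gs \<subseteq> carrier R" unfolding gs_def by (rule monomial_multiples_closed[OF xsc usc])
  \<comment> \<open>Modulo the \<open>p\<close>-th powers of the parameters, \<open>gs\<close> generates; these powers lie in \<open>K\<close>.\<close>
  have gs_span: "carrier R \<subseteq> F.sat P (F.span_over K gs)"
    unfolding gs_def K_def
    by (rule spanning_monomial_multiples[OF P zeroideal xsc usc])
      (use \<open>carrier R \<subseteq> F.sat P (F.span_over X us)\<close> X_def in simp)
  define W where "W = F.span_over {\<zero>} gs"
  have W: "F.submod W" "set gs \<subseteq> W"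
    unfolding W_def using F.submod_span[OF F.submod_zero gs] F.span_upper[OF F.submod_zero gs] by auto
  have K: "F.submod K"
    unfolding K_def using I.submod_span[OF I.submod_zero, of "map frob xs"] xsc
    by (intro F.ideal_submod) (auto simp: submodule_id_iff_ideal)
  have K_least: "K \<subseteq> Z" if Z: "F.submod Z" "\<And>x r. x \<in> P \<Longrightarrow> r \<in> carrier R \<Longrightarrow> frob x \<otimes> r \<in> Z" for Z
  proof -
    have "I.span_over {\<zero>} (map frob ys) \<subseteq> Z" if "set ys \<subseteq> P" for ys
      using that
    proof (induction ys)
      case Nil
      then show ?case using F.submodD(2)[OF Z(1)] by simp
    next
      case (Cons y ys)
      show ?case
      proof
        fix z assume "z \<in> I.span_over {\<zero>} (map frob (y # ys))"
        then obtain a k where a: "a \<in> carrier R" "k \<in> I.span_over {\<zero>} (map frob ys)"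
          and z: "z = a \<otimes> frob y \<oplus> k" by auto
        have "y \<in> P" using Cons.prems by simp
        then have "a \<otimes> frob y \<in> Z" using Z(2)[of y a] a(1) ideal.Icarr[OF iP] m_comm[of a] by auto
        moreover have "k \<in> Z" using Cons a(2) by auto
        ultimately show "z \<in> Z" unfolding z by (rule F.submodD(3)[OF Z(1)])
      qed
    qed
    then show ?thesis unfolding K_def using xs(1) by blast
  qed
  have WK: "F.submod (W <+>\<^bsub>R\<^esub> K)" "W \<subseteq> W <+>\<^bsub>R\<^esub> K" "K \<subseteq> W <+>\<^bsub>R\<^esub> K"
    using F.submod_set_add[OF W(1) K] F.set_add_upper[OF W(1) K] by auto
  have "F.span_over K gs \<subseteq> W <+>\<^bsub>R\<^esub> K" using WK W(2) by (intro F.span_least) auto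
  then have WK_span: "carrier R \<subseteq> F.sat P (W <+>\<^bsub>R\<^esub> K)" using gs_span F.sat_mono[OF P] by blast
  have "carrier R \<subseteq> F.span_over W bs"
    using bs(2) F.span_mono[OF F.submod_zero W(1) _ order_refl bs(1)] F.submodD(2)[OF W(1)] by blast
  then have "carrier R \<subseteq> F.sat P (F.span_over W bs)"
    using F.sat_upper[OF P F.submod_span[OF W(1) bs(1)]] by (rule order_trans)
  from F.nakayama[OF P W(1) K K_least WK_span bs(1) this]
  have span_P: "carrier R \<subseteq> F.sat P W" .
  then have "set bs \<subseteq> F.sat P W" using bs(1) by blast
  from F.common_denominator[OF P W(1) finite_set this]
  obtain c where c: "c \<in> carrier R - P" and cb: "\<And>b. b \<in> set bs \<Longrightarrow> c [^] p \<otimes> b \<in> W" by auto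
  have cW: "c [^] p \<otimes> s \<in> W" if s: "s \<in> carrier R" for s
  proof -
    let ?Z = "{s \<in> carrier R. c [^] p \<otimes> s \<in> W}"
    have Z: "F.submod ?Z" by (rule F.submod_mult_preimage[OF W(1)]) (use c in simp)
    have "F.span_over {\<zero>} bs \<subseteq> ?Z"
      using cb bs(1) F.submodD(2)[OF Z] by (intro F.span_least[OF Z]) auto
    then show ?thesis using s bs(2) by blast
  qed
  \<comment> \<open>A multiplier outside \<open>P\<close> is nonzero, so \<open>gs\<close> also generates at the prime \<open>0\<close>, where its length is
    minimal.\<close>
  have zero: "primeideal {\<zero>} R" using Q(3)[of 0] Q(1) by simp
  have "F.sat P W \<subseteq> F.sat {\<zero>} W"
    using additive_subgroup.zero_closed[OF ideal.axioms(1)[OF iP]] by (auto simp: saturation_def)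
  then have "carrier R \<subseteq> F.sat {\<zero>} (F.span_over {\<zero>} gs)" using span_P unfolding W_def by blast
  then obtain vs where vs: "set vs \<subseteq> carrier R" "carrier R \<subseteq> F.sat {\<zero>} (F.span_over {\<zero>} vs)"
    "F.independent_mod {\<zero>} vs" "length vs < length gs \<or> vs = gs"
    using F.ex_independent_spanning[OF zero gs] by blast
  have "p ^ length xs * length us \<le> length vs"
  proof (rule frobenius_rank_chain[where Q = Q and d = "length xs" and i = "length xs", OF Q(3,4,5) bs])
    show "length us \<le> length vs" if "set vs \<subseteq> carrier R"
      "carrier R \<subseteq> F.sat (Q (length xs)) (F.span_over (Q (length xs)) vs)" for vs
      using us_min that unfolding Q(2) spanning_def by blast
  qed (use vs Q(1) in auto)
  then have "vs = gs" using vs(4) by (simp add: gs_def length_monomial_multiples)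
  then show ?thesis using c gs vs(3) cW unfolding W_def by blast
qed

end

section \<open>Factorization of the identity through Frobenius\<close>

context char_p_ring
begin

text \<open>These are the \<open>R\<close>-linear maps to \<open>R\<close> from the \<open>e\<close>-th Frobenius pushforward of \<open>R\<close>.\<close>

definition cartier_map :: "nat \<Rightarrow> ('a \<Rightarrow> 'a) \<Rightarrow> bool" where
  "cartier_map e \<theta> \<longleftrightarrow> (\<forall>s\<in>carrier R. \<theta> s \<in> carrier R) \<and>
     (\<forall>s\<in>carrier R. \<forall>t\<in>carrier R. \<theta> (s \<oplus> t) = \<theta> s \<oplus> \<theta> t) \<and>
     (\<forall>a\<in>carrier R. \<forall>s\<in>carrier R. \<theta> (a [^] (p ^ e) \<otimes> s) = a \<otimes> \<theta> s)"

lemma cartier_mapD: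
  assumes "cartier_map e \<theta>"
  shows "s \<in> carrier R \<Longrightarrow> \<theta> s \<in> carrier R"
    "s \<in> carrier R \<Longrightarrow> t \<in> carrier R \<Longrightarrow> \<theta> (s \<oplus> t) = \<theta> s \<oplus> \<theta> t"
    "a \<in> carrier R \<Longrightarrow> s \<in> carrier R \<Longrightarrow> \<theta> (a [^] (p ^ e) \<otimes> s) = a \<otimes> \<theta> s"
  using assms by (auto simp: cartier_map_def)

lemma cartier_mapI:
  assumes "\<And>s. s \<in> carrier R \<Longrightarrow> \<theta> s \<in> carrier R"
    "\<And>s t. s \<in> carrier R \<Longrightarrow> t \<in> carrier R \<Longrightarrow> \<theta> (s \<oplus> t) = \<theta> s \<oplus> \<theta> t"
    "\<And>a s. a \<in> carrier R \<Longrightarrow> s \<in> carrier R \<Longrightarrow> \<theta> (a [^] (p ^ e) \<otimes> s) = a \<otimes> \<theta> s"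
  shows "cartier_map e \<theta>"
  using assms by (auto simp: cartier_map_def)

text \<open>The finite sums of maps \<open>s \<mapsto> \<eta>(s)^(p^e) t\<close> are the endomorphisms of the \<open>e\<close>-th Frobenius pushforward
  of \<open>R\<close>, as an \<open>R\<close>-module, that factor through a finite free module. If the identity is one of them,
  the pushforward is finitely generated and projective.\<close>

inductive factors_through_frobenius :: "nat \<Rightarrow> ('a \<Rightarrow> 'a) \<Rightarrow> bool" for e where
  zero: "factors_through_frobenius e (\<lambda>s. \<zero>)"
| add: "factors_through_frobenius e \<delta> \<Longrightarrow> cartier_map e \<eta> \<Longrightarrow> t \<in> carrier R \<Longrightarrow>
    factors_through_frobenius e (\<lambda>s. \<eta> s [^] (p ^ e) \<otimes> t \<oplus> \<delta> s)"

text \<open>Values outside the carrier are irrelevant, so maps that agree on the carrier are identified.\<close>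

definition factorizable :: "nat \<Rightarrow> ('a \<Rightarrow> 'a) \<Rightarrow> bool" where
  "factorizable e g \<longleftrightarrow> (\<exists>\<delta>. factors_through_frobenius e \<delta> \<and> (\<forall>s\<in>carrier R. \<delta> s = g s))"

lemma factors_closed: "factors_through_frobenius e \<delta> \<Longrightarrow> s \<in> carrier R \<Longrightarrow> \<delta> s \<in> carrier R"
  by (induction rule: factors_through_frobenius.induct) (auto dest: cartier_mapD(1))

lemma factorizable_closed: "factorizable e g \<Longrightarrow> s \<in> carrier R \<Longrightarrow> g s \<in> carrier R"
  using factors_closed unfolding factorizable_def by metis

lemma factorizable_cong: "factorizable e g \<Longrightarrow> (\<And>s. s \<in> carrier R \<Longrightarrow> g s = h s) \<Longrightarrow> factorizable e h"
  unfolding factorizable_def by metis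

lemma factorizable_zero: "factorizable e (\<lambda>s. \<zero>)"
  unfolding factorizable_def using factors_through_frobenius.zero by blast

lemma factorizable_Cons:
  assumes "factorizable e g" "cartier_map e \<eta>" "t \<in> carrier R"
  shows "factorizable e (\<lambda>s. \<eta> s [^] (p ^ e) \<otimes> t \<oplus> g s)"
proof -
  obtain \<delta> where d: "factors_through_frobenius e \<delta>" "\<forall>s\<in>carrier R. \<delta> s = g s"
    using assms unfolding factorizable_def by blast
  show ?thesis unfolding factorizable_def
    using factors_through_frobenius.add[OF d(1) assms(2,3)] d(2) by (intro exI conjI) auto
qed

lemma factorizable_induct [consumes 1, case_names cong zero add]:
  assumes "factorizable e g"
    and cong: "\<And>g h. Q g \<Longrightarrow> (\<And>s. s \<in> carrier R \<Longrightarrow> g s = h s) \<Longrightarrow> Q h"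
    and zero: "Q (\<lambda>s. \<zero>)"
    and add: "\<And>g \<eta> t. factorizable e g \<Longrightarrow> Q g \<Longrightarrow> cartier_map e \<eta> \<Longrightarrow> t \<in> carrier R \<Longrightarrow>
      Q (\<lambda>s. \<eta> s [^] (p ^ e) \<otimes> t \<oplus> g s)"
  shows "Q g"
proof -
  obtain \<delta> where d: "factors_through_frobenius e \<delta>" "\<forall>s\<in>carrier R. \<delta> s = g s"
    using assms(1) unfolding factorizable_def by blast
  from d(1) have "Q \<delta>"
  proof (induction rule: factors_through_frobenius.induct)
    case (add \<delta> \<eta> t)
    then show ?case using assms(4)[of \<delta> \<eta> t] unfolding factorizable_def by blast
  qed (rule zero)
  then show ?thesis using cong d(2) by blast
qed

lemma factorizable_sum:
  assumes "factorizable e g" "factorizable e h"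
  shows "factorizable e (\<lambda>s. g s \<oplus> h s)"
  using assms(1)
proof (induction rule: factorizable_induct)
  case (cong g g')
  show ?case by (rule factorizable_cong[OF cong(1)]) (simp add: cong(2))
next
  case zero
  show ?case by (rule factorizable_cong[OF assms(2)]) (simp add: factorizable_closed[OF assms(2)])
next
  case (add g \<eta> t)
  show ?case
    by (rule factorizable_cong[OF factorizable_Cons[OF add(4,2,3)]])
      (use add assms(2) in \<open>simp add: a_assoc factorizable_closed cartier_mapD(1)\<close>)
qed

lemma factorizable_mult:
  assumes "factorizable e g" "r \<in> carrier R"
  shows "factorizable e (\<lambda>s. r \<otimes> g s)"
  using assms(1)
proof (induction rule: factorizable_induct)
  case (cong g g')
  show ?case by (rule factorizable_cong[OF cong(1)]) (simp add: cong(2))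
next
  case zero
  show ?case by (rule factorizable_cong[OF factorizable_zero]) (simp add: assms(2))
next
  case (add g \<eta> t)
  have "r \<otimes> t \<in> carrier R" using add assms by simp
  show ?case
    by (rule factorizable_cong[OF factorizable_Cons[OF add(4,2) \<open>r \<otimes> t \<in> carrier R\<close>]])
      (use add assms(2) in \<open>simp add: r_distr m_lcomm factorizable_closed cartier_mapD(1)\<close>)
qed

text \<open>The coordinates with respect to an independent list are unique. Hence the coordinates of \<open>g s\<close>
  depend additively on \<open>s\<close>; they are \<open>p\<close>-th powers of Cartier maps.\<close>

lemma factorizable_of_independent:
  shows "set vs \<subseteq> carrier R \<Longrightarrow> twisted_ring.independent_mod R frob {\<zero>} vs \<Longrightarrow>
    (\<And>s. s \<in> carrier R \<Longrightarrow> g s \<in> twisted_span R frob {\<zero>} vs) \<Longrightarrow>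
    (\<And>s t. s \<in> carrier R \<Longrightarrow> t \<in> carrier R \<Longrightarrow> g (s \<oplus> t) = g s \<oplus> g t) \<Longrightarrow>
    (\<And>a s. a \<in> carrier R \<Longrightarrow> s \<in> carrier R \<Longrightarrow> g (a [^] p \<otimes> s) = a [^] p \<otimes> g s) \<Longrightarrow>
    factorizable 1 g"
proof (induction vs arbitrary: g)
  case Nil
  show ?case by (rule factorizable_cong[OF factorizable_zero]) (use Nil in simp)
next
  case (Cons v vs)
  interpret F: twisted_ring R frob by (rule twisted_ring_frob)
  have v: "v \<in> carrier R" "set vs \<subseteq> carrier R" using Cons.prems by auto
  let ?V = "F.span_over {\<zero>} vs"
  have V: "F.submod ?V" by (rule F.submod_span[OF F.submod_zero v(2)])
  have Vc: "y \<in> carrier R" if "y \<in> ?V" for y using that F.submodD(1)[OF V] by blast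
  have ind: "v \<notin> F.sat {\<zero>} ?V" "F.independent_mod {\<zero>} vs" using Cons.prems(2) by auto
  have unique: "a = a'" if *: "a \<in> carrier R" "a' \<in> carrier R" "y \<in> ?V" "y' \<in> ?V"
    "frob a \<otimes> v \<oplus> y = frob a' \<otimes> v \<oplus> y'" for a a' y y'
  proof (rule ccontr)
    assume "a \<noteq> a'"
    then have d: "a \<ominus> a' \<in> carrier R - {\<zero>}" using * by (simp add: r_right_minus_eq)
    have "(a \<ominus> a') \<oplus> a' = a" using * by (simp add: a_minus_def a_assoc l_neg)
    then have "frob a = frob (a \<ominus> a') \<oplus> frob a'" using F.sigma_add[of "a \<ominus> a'" a'] * by simp
    then have "frob a' \<otimes> v \<oplus> (frob (a \<ominus> a') \<otimes> v \<oplus> y) = frob a' \<otimes> v \<oplus> y'"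
      using *(1-4) *(5)[symmetric] v Vc by (simp add: l_distr a_ac)
    then have "frob (a \<ominus> a') \<otimes> v \<oplus> y = y'" using * v Vc by simp
    then have "frob (a \<ominus> a') \<otimes> v \<in> ?V" using F.submod_cancel[OF V, of _ y] * v by simp
    then show False using ind(1) d v by (auto simp: saturation_def)
  qed
  have ex: "\<exists>a y. a \<in> carrier R \<and> y \<in> ?V \<and> g s = frob a \<otimes> v \<oplus> y" if "s \<in> carrier R" for s
    using Cons.prems(3)[OF that] by auto
  define \<eta> where "\<eta> s = (SOME a. a \<in> carrier R \<and> (\<exists>y\<in>?V. g s = frob a \<otimes> v \<oplus> y))" for s
  have eta: "\<eta> s \<in> carrier R \<and> (\<exists>y\<in>?V. g s = frob (\<eta> s) \<otimes> v \<oplus> y)" if "s \<in> carrier R" for s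
    unfolding \<eta>_def by (rule someI_ex) (use ex[OF that] in blast)
  define h where "h s = g s \<ominus> frob (\<eta> s) \<otimes> v" for s
  have h: "h s \<in> ?V" "g s = frob (\<eta> s) \<otimes> v \<oplus> h s" if s: "s \<in> carrier R" for s
  proof -
    obtain y where y: "y \<in> ?V" "g s = frob (\<eta> s) \<otimes> v \<oplus> y" using eta[OF s] by blast
    then have "h s = y" unfolding h_def y(2) using eta[OF s] Vc[OF y(1)] v
      by (simp add: a_minus_def a_comm[of "frob (\<eta> s) \<otimes> v"] a_assoc r_neg)
    then show "h s \<in> ?V" "g s = frob (\<eta> s) \<otimes> v \<oplus> h s" using y by auto
  qed
  have eta_eq: "\<eta> s = a" "h s = y" if "s \<in> carrier R" "a \<in> carrier R" "y \<in> ?V" "g s = frob a \<otimes> v \<oplus> y" for s a y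
  proof -
    show 1: "\<eta> s = a" using unique[OF _ that(2) h(1)[OF that(1)] that(3)] eta[OF that(1)] h(2)[OF that(1)] that(4) by simp
    have "frob a \<otimes> v \<oplus> h s = frob a \<otimes> v \<oplus> y" using h(2)[OF that(1)] that(4) 1 by simp
    then show "h s = y" using that Vc h(1)[OF that(1)] v by simp
  qed
  have add: "\<eta> (s \<oplus> t) = \<eta> s \<oplus> \<eta> t \<and> h (s \<oplus> t) = h s \<oplus> h t" if st: "s \<in> carrier R" "t \<in> carrier R" for s t
  proof -
    have "g (s \<oplus> t) = (frob (\<eta> s) \<otimes> v \<oplus> h s) \<oplus> (frob (\<eta> t) \<otimes> v \<oplus> h t)"
      using Cons.prems(4)[OF st] h(2) st by simp
    also have "\<dots> = frob (\<eta> s \<oplus> \<eta> t) \<otimes> v \<oplus> (h s \<oplus> h t)"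
      using eta st v Vc[OF h(1)] by (simp add: F.sigma_add l_distr a_ac)
    finally show ?thesis
      using eta_eq[of "s \<oplus> t" "\<eta> s \<oplus> \<eta> t" "h s \<oplus> h t"] st eta h(1) F.submodD(3)[OF V] by simp
  qed
  have mult: "\<eta> (frob a \<otimes> s) = a \<otimes> \<eta> s \<and> h (frob a \<otimes> s) = frob a \<otimes> h s" if as: "a \<in> carrier R" "s \<in> carrier R" for a s
  proof -
    have "g (frob a \<otimes> s) = frob a \<otimes> (frob (\<eta> s) \<otimes> v \<oplus> h s)"
      using Cons.prems(5)[OF as] h(2) as by simp
    also have "\<dots> = frob (a \<otimes> \<eta> s) \<otimes> v \<oplus> frob a \<otimes> h s"
      using eta as v Vc[OF h(1)] by (simp add: F.sigma_mult r_distr m_assoc)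
    finally show ?thesis
      using eta_eq[of "frob a \<otimes> s" "a \<otimes> \<eta> s" "frob a \<otimes> h s"] as eta h(1) F.submodD(4)[OF V] by simp
  qed
  have "cartier_map 1 \<eta>" using eta add mult by (intro cartier_mapI) auto
  moreover have "factorizable 1 h"
    using Cons.IH[OF v(2) ind(2)] h(1) add mult by blast
  ultimately have "factorizable 1 (\<lambda>s. \<eta> s [^] (p ^ 1) \<otimes> v \<oplus> h s)" using v by (intro factorizable_Cons)
  then show ?case by (rule factorizable_cong) (simp add: h(2)[symmetric])
qed

end

text \<open>The multipliers \<open>c\<close> for which \<open>s \<mapsto> c s\<close> factors form an ideal. A local basis at \<open>P\<close> provides a
  multiplier outside \<open>P\<close>, so that the ideal lies in no prime.\<close>

lemma (in noetherian_char_p) factorizable_identity_1: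
  assumes bs: "set bs \<subseteq> carrier R" "carrier R \<subseteq> twisted_span R frob {\<zero>} bs"
    and reg: "\<And>P. primeideal P R \<Longrightarrow> regular_at R P"
  shows "factorizable 1 (\<lambda>s. s)"
proof -
  let ?A = "{c \<in> carrier R. factorizable 1 (\<lambda>s. c \<otimes> s)}"
  interpret I: twisted_ring R "\<lambda>x. x" by (rule twisted_ring_id)
  interpret F: twisted_ring R frob by (rule twisted_ring_frob)
  have "I.submod ?A"
  proof (rule I.submodI)
    have "factorizable 1 (\<lambda>s. \<zero> \<otimes> s)" by (rule factorizable_cong[OF factorizable_zero]) simp
    then show "\<zero> \<in> ?A" by simp
  next
    fix x y assume xy: "x \<in> ?A" "y \<in> ?A"
    have "factorizable 1 (\<lambda>s. x \<otimes> s \<oplus> y \<otimes> s)" using xy by (intro factorizable_sum) auto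
    then have "factorizable 1 (\<lambda>s. (x \<oplus> y) \<otimes> s)"
      by (rule factorizable_cong) (use xy in \<open>simp add: l_distr\<close>)
    then show "x \<oplus> y \<in> ?A" using xy by simp
  next
    fix a x assume a: "a \<in> carrier R" "x \<in> ?A"
    have "factorizable 1 (\<lambda>s. a \<otimes> (x \<otimes> s))" by (rule factorizable_mult) (use a in auto)
    then have "factorizable 1 (\<lambda>s. (a \<otimes> x) \<otimes> s)"
      by (rule factorizable_cong) (use a in \<open>simp add: m_assoc\<close>)
    then show "a \<otimes> x \<in> ?A" using a by simp
  qed auto
  then have A: "ideal ?A R" by (simp add: submodule_id_iff_ideal)
  have "?A = carrier R"
  proof (rule ccontr)
    assume "?A \<noteq> carrier R"
    then obtain P where P: "primeideal P R" "?A \<subseteq> P" using ex_minimal_prime[OF A] by blast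
    obtain c gs where c: "c \<in> carrier R - P" and gs: "set gs \<subseteq> carrier R" "F.independent_mod {\<zero>} gs"
      and span: "\<And>s. s \<in> carrier R \<Longrightarrow> c [^] p \<otimes> s \<in> F.span_over {\<zero>} gs"
      using ex_local_frobenius_basis[OF bs reg[OF P(1)] P(1)] by blast
    have cp: "c [^] p \<in> carrier R" using c by simp
    have "factorizable 1 (\<lambda>s. c [^] p \<otimes> s)"
      by (rule factorizable_of_independent[OF gs span]) (use cp in \<open>simp_all add: r_distr m_lcomm\<close>)
    then have "c [^] p \<in> P" using P(2) c by auto
    moreover have "c [^] n \<in> carrier R - P" for n :: nat
      by (induction n) (use c I.denominators[OF P(1)] in auto)
    ultimately show False by blast
  qed
  then have "factorizable 1 (\<lambda>s. \<one> \<otimes> s)" by blast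
  then show ?thesis by (rule factorizable_cong) simp
qed

text \<open>If \<open>s = \<Sum> \<psi>\<^sub>i(s)^p t\<^sub>i\<close> and \<open>s = \<Sum> \<eta>\<^sub>j(s)^q u\<^sub>j\<close>, then inserting the second equation, for \<open>\<psi>\<^sub>i(s)\<close>, into the
  first gives \<open>s = \<Sum> \<eta>\<^sub>j(\<psi>\<^sub>i(s))^(p q) u\<^sub>j^p t\<^sub>i\<close>.\<close>

lemma (in char_p_ring) factorizable_identity:
  assumes "factorizable 1 (\<lambda>s. s)"
  shows "factorizable e (\<lambda>s. s)"
proof (induction e)
  case 0
  have "cartier_map 0 (\<lambda>s. s)" by (intro cartier_mapI) auto
  from factorizable_Cons[OF factorizable_zero this one_closed] show ?case
    by (rule factorizable_cong) simp
next
  case (Suc e)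
  have comp: "factorizable (Suc e) (\<lambda>s. (g (\<psi> s)) [^] p \<otimes> t)"
    if "factorizable e g" "cartier_map 1 \<psi>" "t \<in> carrier R" for g \<psi> t
    using that(1)
  proof (induction rule: factorizable_induct)
    case (cong g g')
    show ?case
      by (rule factorizable_cong[OF cong(1)]) (use cong(2) cartier_mapD(1)[OF that(2)] in simp)
  next
    case zero
    have "\<zero> [^] p = \<zero>" using prime_gt_0_nat[OF prime_p] by (simp add: nat_pow_zero)
    then show ?case using that(3) by (intro factorizable_cong[OF factorizable_zero]) simp
  next
    case (add g \<eta> u)
    note [simp] = cartier_mapD(1)[OF that(2)] cartier_mapD(1)[OF add(2)] factorizable_closed[OF add(1)] add(3) that(3)
    have "cartier_map (Suc e) (\<lambda>s. \<eta> (\<psi> s))"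
    proof (rule cartier_mapI)
      fix a s assume as: "a \<in> carrier R" "s \<in> carrier R"
      have "a [^] p ^ Suc e = (a [^] (p ^ e)) [^] (p ^ 1)"
        using as by (simp add: nat_pow_pow mult.commute)
      then show "\<eta> (\<psi> (a [^] p ^ Suc e \<otimes> s)) = a \<otimes> \<eta> (\<psi> s)"
        using as cartier_mapD(3)[OF that(2), of "a [^] (p ^ e)" s] cartier_mapD(3)[OF add(2), of a "\<psi> s"] by simp
    qed (use cartier_mapD(2)[OF that(2)] cartier_mapD(2)[OF add(2)] in simp_all)
    moreover have "u [^] p \<otimes> t \<in> carrier R" by simp
    ultimately have "factorizable (Suc e) (\<lambda>s. \<eta> (\<psi> s) [^] (p ^ Suc e) \<otimes> (u [^] p \<otimes> t) \<oplus> (g (\<psi> s)) [^] p \<otimes> t)"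
      using add(4) by (intro factorizable_Cons)
    then show ?case
      by (rule factorizable_cong)
        (simp add: power_p_add nat_pow_distrib nat_pow_pow l_distr m_assoc mult.commute)
  qed
  have "factorizable (Suc e) g" if "factorizable 1 g" for g
    using that
  proof (induction rule: factorizable_induct)
    case (cong g h)
    then show ?case by (rule factorizable_cong)
  next
    case zero
    show ?case by (rule factorizable_zero)
  next
    case (add g \<eta> t)
    show ?case using factorizable_sum[OF comp[OF Suc add(2,3)] add(4)] by simp
  qed
  then show ?case using assms by blast
qed


section \<open>Stabilization of the Cartier ideals\<close>

definition power_linear :: "('a, 'm) ring_scheme \<Rightarrow> nat \<Rightarrow> ('a \<Rightarrow> 'a) \<Rightarrow> bool" where
  "power_linear R q \<delta> \<longleftrightarrow> (\<forall>s\<in>carrier R. \<delta> s \<in> carrier R) \<and>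
     (\<forall>s\<in>carrier R. \<forall>t\<in>carrier R. \<delta> (s \<oplus>\<^bsub>R\<^esub> t) = \<delta> s \<oplus>\<^bsub>R\<^esub> \<delta> t) \<and>
     (\<forall>a\<in>carrier R. \<forall>s\<in>carrier R. \<delta> (a [^]\<^bsub>R\<^esub> q \<otimes>\<^bsub>R\<^esub> s) = a [^]\<^bsub>R\<^esub> q \<otimes>\<^bsub>R\<^esub> \<delta> s)"

context char_p_ring
begin

lemma cartier_map_zero: "cartier_map e \<theta> \<Longrightarrow> \<theta> \<zero> = \<zero>"
  using cartier_mapD(1,2)[of e \<theta> \<zero>] cartier_mapD(2)[of e \<theta> \<zero> \<zero>] by (metis l_zero zero_closed add.r_cancel_one')

lemma cartier_map_add:
  assumes "cartier_map e \<theta>" "cartier_map e \<phi>"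
  shows "cartier_map e (\<lambda>s. \<theta> s \<oplus> \<phi> s)"
  using cartier_mapD[OF assms(1)] cartier_mapD[OF assms(2)]
  by (intro cartier_mapI) (simp_all add: r_distr a_ac)

lemma cartier_map_mult:
  assumes "cartier_map e \<theta>" "r \<in> carrier R"
  shows "cartier_map e (\<lambda>s. r \<otimes> \<theta> s)"
  using cartier_mapD[OF assms(1)] assms(2) by (intro cartier_mapI) (simp_all add: r_distr m_lcomm)

lemma cartier_map_comp:
  assumes "cartier_map d \<phi>" "cartier_map e \<theta>"
  shows "cartier_map (d + e) (\<lambda>s. \<phi> (\<theta> s))"
proof (rule cartier_mapI)
  fix a s assume as: "a \<in> carrier R" "s \<in> carrier R"
  have "a [^] p ^ (d + e) = (a [^] (p ^ d)) [^] (p ^ e)"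
    using as by (simp add: nat_pow_pow power_add)
  then show "\<phi> (\<theta> (a [^] p ^ (d + e) \<otimes> s)) = a \<otimes> \<phi> (\<theta> s)"
    using as cartier_mapD[OF assms(1)] cartier_mapD[OF assms(2)] by simp
qed (use cartier_mapD(1,2)[OF assms(1)] cartier_mapD(1,2)[OF assms(2)] in auto)

text \<open>Together with \<open>cartier_map_comp\<close>, this relates the levels: a map of level \<open>d + e\<close> can be applied to
  \<open>p^e\<close>-th powers, after which it is of level \<open>d\<close>.\<close>

lemma cartier_map_frobenius:
  assumes "cartier_map (d + e) \<theta>" "t \<in> carrier R"
  shows "cartier_map d (\<lambda>s. \<theta> (s [^] (p ^ e) \<otimes> t))"
proof (rule cartier_mapI)
  fix a s assume as: "a \<in> carrier R" "s \<in> carrier R"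
  have "(a [^] (p ^ d) \<otimes> s) [^] (p ^ e) \<otimes> t = a [^] (p ^ (d + e)) \<otimes> (s [^] (p ^ e) \<otimes> t)"
    using as assms(2) by (simp add: nat_pow_distrib nat_pow_pow power_add m_assoc)
  then show "\<theta> ((a [^] (p ^ d) \<otimes> s) [^] (p ^ e) \<otimes> t) = a \<otimes> \<theta> (s [^] (p ^ e) \<otimes> t)"
    using as assms cartier_mapD(3)[OF assms(1)] by simp
qed (use assms cartier_mapD(1,2)[OF assms(1)] in \<open>simp_all add: power_pe_add l_distr\<close>)

lemma frobenius_power_split:
  assumes "f \<in> carrier R"
  shows "f [^] (p ^ (d + e) - 1) = (f [^] (p ^ d - 1)) [^] (p ^ e) \<otimes> f [^] (p ^ e - 1)"
proof -
  have "0 < p ^ d" "0 < p ^ e" using prime_gt_0_nat[OF prime_p] by auto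
  then have "p ^ (d + e) - 1 = (p ^ d - 1) * p ^ e + (p ^ e - 1)"
    by (cases "p ^ d") (auto simp: power_add)
  then show ?thesis using assms by (simp add: nat_pow_mult nat_pow_pow)
qed

text \<open>For regular \<open>F\<close>-finite \<open>R\<close>, this is the smallest ideal \<open>J\<close> such that \<open>f^(p^e - 1)\<close> lies in the ideal
  generated by the \<open>p^e\<close>-th powers of the elements of \<open>J\<close>, and it is the test ideal of \<open>f\<close> with exponent
  \<open>1 - 1/p^e\<close>.\<close>

definition cartier_ideal :: "'a \<Rightarrow> nat \<Rightarrow> 'a set" where
  "cartier_ideal f e = {\<theta> (f [^] (p ^ e - 1)) | \<theta>. cartier_map e \<theta>}"

lemma cartier_idealI: "cartier_map e \<theta> \<Longrightarrow> \<theta> (f [^] (p ^ e - 1)) \<in> cartier_ideal f e"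
  by (auto simp: cartier_ideal_def)

lemma cartier_idealE:
  assumes "m \<in> cartier_ideal f e"
  obtains \<theta> where "cartier_map e \<theta>" "m = \<theta> (f [^] (p ^ e - 1))"
  using assms by (auto simp: cartier_ideal_def)

lemma ideal_cartier_ideal:
  assumes f: "f \<in> carrier R"
  shows "ideal (cartier_ideal f e) R"
proof -
  interpret I: twisted_ring R "\<lambda>x. x" by (rule twisted_ring_id)
  let ?F = "f [^] (p ^ e - 1)"
  have "I.submod (cartier_ideal f e)"
  proof (rule I.submodI)
    show "cartier_ideal f e \<subseteq> carrier R" using f by (auto simp: cartier_ideal_def cartier_mapD(1))
    have "cartier_map e (\<lambda>s. \<zero>)" by (rule cartier_mapI) auto
    from cartier_idealI[OF this] show "\<zero> \<in> cartier_ideal f e" .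
  next
    fix x y assume "x \<in> cartier_ideal f e" "y \<in> cartier_ideal f e"
    then obtain \<theta> \<phi> where "cartier_map e \<theta>" "x = \<theta> ?F" "cartier_map e \<phi>" "y = \<phi> ?F"
      by (metis cartier_idealE)
    then show "x \<oplus> y \<in> cartier_ideal f e" using cartier_idealI[OF cartier_map_add] by metis
  next
    fix a x assume "a \<in> carrier R" "x \<in> cartier_ideal f e"
    then show "a \<otimes> x \<in> cartier_ideal f e"
      using cartier_idealI[OF cartier_map_mult] by (metis cartier_idealE)
  qed
  then show ?thesis by (simp add: submodule_id_iff_ideal)
qed

text \<open>\<open>f^(p q - 1) = (f^(q-1))^p f^(p-1)\<close>, and \<open>s \<mapsto> \<theta>(s^p f^(p-1))\<close> is of level \<open>e\<close> if \<open>\<theta>\<close> is of level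
  \<open>e + 1\<close>.\<close>

lemma cartier_ideal_Suc:
  assumes f: "f \<in> carrier R"
  shows "cartier_ideal f (Suc e) \<subseteq> cartier_ideal f e"
proof
  fix m assume "m \<in> cartier_ideal f (Suc e)"
  then obtain \<theta> where \<theta>: "cartier_map (e + 1) \<theta>" and m: "m = \<theta> (f [^] (p ^ (e + 1) - 1))"
    by (auto elim: cartier_idealE)
  have "f [^] (p ^ 1 - 1) \<in> carrier R" using f by simp
  from cartier_idealI[OF cartier_map_frobenius[OF \<theta> this], of f]
  show "m \<in> cartier_ideal f e" unfolding m frobenius_power_split[OF f] .
qed

lemma cartier_ideal_antimono:
  assumes "f \<in> carrier R" "d \<le> e"
  shows "cartier_ideal f e \<subseteq> cartier_ideal f d"
  using assms(2) by (induction rule: dec_induct) (use cartier_ideal_Suc[OF assms(1)] in blast)+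

text \<open>When the identity factors, \<open>M\<^sub>e\<^sub>+\<^sub>1 = \<Phi>(M\<^sub>e)\<close>, where \<open>\<Phi>(I)\<close> is spanned by the values at \<open>f^(p-1) I\<close> of
  the Cartier maps of level one. From \<open>x M\<^sub>e \<subseteq> \<Phi>(M\<^sub>e)\<close> and \<open>x\<^sup>2 M\<^sub>e \<subseteq> M\<^sub>e\<^sub>+\<^sub>k\<close> one obtains
  \<open>x\<^sup>2 M\<^sub>e \<subseteq> x \<Phi>(M\<^sub>e) = \<Phi>(x^p M\<^sub>e) \<subseteq> \<Phi>(x\<^sup>2 M\<^sub>e) \<subseteq> \<Phi>(M\<^sub>e\<^sub>+\<^sub>k) = M\<^sub>e\<^sub>+\<^sub>k\<^sub>+\<^sub>1\<close>, as \<open>p \<ge> 2\<close>. The exponent of \<open>x\<close> is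
  independent of \<open>k\<close>; this is what makes the sequence stationary. The case \<open>x = 1\<close> shows that one
  equality \<open>M\<^sub>e = M\<^sub>e\<^sub>+\<^sub>1\<close> implies all later ones.\<close>

lemma cartier_ideal_propagate:
  assumes fid: "factorizable e (\<lambda>s. s)" and f: "f \<in> carrier R" and x: "x \<in> carrier R"
    and step: "\<And>m. m \<in> cartier_ideal f e \<Longrightarrow> x \<otimes> m \<in> cartier_ideal f (Suc e)"
  shows "m \<in> cartier_ideal f e \<Longrightarrow> x \<otimes> x \<otimes> m \<in> cartier_ideal f (k + e)"
proof (induction k arbitrary: m)
  case 0
  then show ?case using ideal.I_l_closed[OF ideal_cartier_ideal[OF f] 0] x by simp
next
  case (Suc k)
  let ?F = "f [^] (p ^ (1 + e) - 1)"
  let ?N = "cartier_ideal f (Suc k + e)"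
  have N: "ideal ?N R" by (rule ideal_cartier_ideal[OF f])
  have mc: "m \<in> carrier R" using Suc.prems ideal.Icarr[OF ideal_cartier_ideal[OF f]] by blast
  have "x \<otimes> m \<in> cartier_ideal f (1 + e)" using step[OF Suc.prems] by simp
  then obtain \<theta> where \<theta>: "cartier_map (1 + e) \<theta>" and xm: "x \<otimes> m = \<theta> ?F"
    by (auto elim: cartier_idealE)
  note [simp] = f x cartier_mapD(1,2)[OF \<theta>]
  \<comment> \<open>Expanding the argument of \<open>\<theta>\<close> by the factorization of the identity makes \<open>\<theta>\<close> a sum of compositions
    \<open>\<phi> \<circ> \<eta>\<close> of maps of levels \<open>1\<close> and \<open>e\<close>.\<close>
  have "g ?F \<in> carrier R \<and> x \<otimes> \<theta> (g ?F) \<in> ?N" if "factorizable e g" for g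
    using that
  proof (induction rule: factorizable_induct)
    case (cong g h)
    have "h ?F = g ?F" using cong(2)[of ?F] by simp
    then show ?case using cong(1) by simp
  next
    case zero
    show ?case using cartier_map_zero[OF \<theta>] additive_subgroup.zero_closed[OF ideal.axioms(1)[OF N]] by simp
  next
    case (add g \<eta> t)
    define m' where "m' = \<eta> (f [^] (p ^ e - 1))"
    have m': "m' \<in> cartier_ideal f e" unfolding m'_def by (rule cartier_idealI[OF add(2)])
    have m'c: "m' \<in> carrier R" unfolding m'_def using cartier_mapD(1)[OF add(2)] by simp
    have eta: "\<eta> ?F = f [^] (p - 1) \<otimes> m'"
      unfolding frobenius_power_split[OF f] m'_def using cartier_mapD(3)[OF add(2)] by simp
    define \<phi> where "\<phi> s = \<theta> (s [^] (p ^ e) \<otimes> t)" for s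
    have \<phi>: "cartier_map 1 \<phi>" unfolding \<phi>_def by (rule cartier_map_frobenius[OF \<theta> add(3)])
    have "x [^] p = x [^] (p - 2) \<otimes> (x \<otimes> x)"
    proof -
      have "p = (p - 2) + 2" using prime_ge_2_nat[OF prime_p] by simp
      then have "x [^] p = x [^] (p - 2) \<otimes> x [^] (2::nat)" using nat_pow_mult[OF x, of "p - 2" 2] by simp
      then show ?thesis by (simp add: numeral_2_eq_2)
    qed
    then have "x [^] p \<otimes> m' = x [^] (p - 2) \<otimes> (x \<otimes> x \<otimes> m')" using m'c by (simp add: m_assoc)
    also have "\<dots> \<in> cartier_ideal f (k + e)"
      using ideal.I_l_closed[OF ideal_cartier_ideal[OF f] Suc.IH[OF m']] by simp
    finally obtain \<theta>' where \<theta>': "cartier_map (k + e) \<theta>'" and xm': "x [^] p \<otimes> m' = \<theta>' (f [^] (p ^ (k + e) - 1))"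
      by (auto elim: cartier_idealE)
    have "x \<otimes> \<phi> (\<eta> ?F) = \<phi> (x [^] p \<otimes> (f [^] (p - 1) \<otimes> m'))"
      unfolding eta using cartier_mapD(3)[OF \<phi>, of x] m'c by simp
    also have "x [^] p \<otimes> (f [^] (p - 1) \<otimes> m') = f [^] (p - 1) \<otimes> (x [^] p \<otimes> m')"
      using m'c by (simp add: m_lcomm)
    also have "\<dots> = \<theta>' (f [^] (p ^ (1 + (k + e)) - 1))"
      unfolding frobenius_power_split[OF f] xm' using cartier_mapD(3)[OF \<theta>'] by simp
    finally have "x \<otimes> \<phi> (\<eta> ?F) \<in> ?N"
      using cartier_idealI[OF cartier_map_comp[OF \<phi> \<theta>'], of f] by simp
    moreover have "x \<otimes> \<theta> (\<eta> ?F [^] (p ^ e) \<otimes> t \<oplus> g ?F) = x \<otimes> \<phi> (\<eta> ?F) \<oplus> x \<otimes> \<theta> (g ?F)"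
      unfolding \<phi>_def using add(3,4) cartier_mapD(1)[OF add(2), of ?F] by (simp add: r_distr)
    ultimately show ?case
      using add(3,4) cartier_mapD(1)[OF add(2), of ?F] additive_subgroup.a_closed[OF ideal.axioms(1)[OF N]]
      by simp
  qed
  from this[OF fid] have "x \<otimes> (x \<otimes> m) \<in> ?N" unfolding xm by simp
  then show ?case using mc by (simp add: m_assoc)
qed

end

context noetherian_char_p
begin

text \<open>Let \<open>J\<close> be the intersection of the ideals \<open>M\<^sub>e\<close>. The annihilators of the quotients \<open>M\<^sub>e/J\<close> increase, hence
  are equal to some \<open>A\<close> from some point on. If \<open>A\<close> is proper, take a minimal prime \<open>P\<close> of \<open>A\<close>. At \<open>P\<close> the
  quotient \<open>M\<^sub>e/J\<close> has finite length, so the sequence is stationary there: \<open>x M\<^sub>e \<subseteq> M\<^sub>e\<^sub>+\<^sub>1\<close> for some \<open>e\<close> and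
  some \<open>x \<notin> P\<close>. Then \<open>x\<^sup>2 M\<^sub>e \<subseteq> J\<close> by \<open>cartier_ideal_propagate\<close>, that is, \<open>x\<^sup>2 \<in> A \<subseteq> P\<close>, a contradiction.\<close>

lemma cartier_ideals_stabilize:
  assumes fid: "\<And>e. factorizable e (\<lambda>s. s)" and f: "f \<in> carrier R"
  shows "\<exists>e. cartier_ideal f e \<subseteq> cartier_ideal f (Suc e)"
proof -
  interpret I: twisted_ring R "\<lambda>x. x" by (rule twisted_ring_id)
  define M where "M = cartier_ideal f"
  have M: "ideal (M e) R" "I.submod (M e)" for e
    unfolding M_def using ideal_cartier_ideal[OF f] submodule_id_iff_ideal by auto
  have Mc: "m \<in> carrier R" if "m \<in> M e" for m e using that ideal.Icarr[OF M(1)] by blast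
  have anti: "M e \<subseteq> M d" if "d \<le> e" for d e unfolding M_def by (rule cartier_ideal_antimono[OF f that])
  define J where "J = (\<Inter>e. M e)"
  have J: "ideal J R" "I.submod J"
  proof -
    show "ideal J R" unfolding J_def by (rule i_Intersect) (use M in auto)
    then show "I.submod J" by (simp add: submodule_id_iff_ideal)
  qed
  have JM: "J \<subseteq> M e" for e by (auto simp: J_def)
  define A where "A e = {a \<in> carrier R. \<forall>m\<in>M e. a \<otimes> m \<in> J}" for e
  have A: "ideal (A e) R" for e
  proof -
    have "I.submod (A e)"
    proof (rule I.submodI)
      show "\<zero> \<in> A e" using Mc I.submodD(2)[OF J(2)] by (auto simp: A_def)
      show "x \<oplus> y \<in> A e" if "x \<in> A e" "y \<in> A e" for x y
        using that Mc I.submodD(3)[OF J(2)] by (auto simp: A_def l_distr)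
      show "a \<otimes> x \<in> A e" if "a \<in> carrier R" "x \<in> A e" for a x
        using that Mc I.submodD(4)[OF J(2)] by (auto simp: A_def m_assoc)
    qed (auto simp: A_def)
    then show ?thesis by (simp add: submodule_id_iff_ideal)
  qed
  have "\<exists>B\<in>range A. \<forall>I\<in>range A. B \<subseteq> I \<longrightarrow> I = B" by (rule maximal_ideal_in_family) (use A in auto)
  then obtain B where "B \<in> range A" and B: "\<forall>I\<in>range A. B \<subseteq> I \<longrightarrow> I = B" by (elim bexE)
  then obtain d where Bd: "B = A d" by (elim rangeE)
  have d: "A e = A d" if "A d \<subseteq> A e" for e using B that unfolding Bd by simp
  have Ad: "A e = A d" if "d \<le> e" for e using d[of e] anti[OF that] by (auto simp: A_def)
  show ?thesis
  proof (cases "A d = carrier R")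
    case True
    have "m \<in> J" if m: "m \<in> M d" for m
    proof -
      have "\<one> \<in> A d" using True by simp
      then have "\<one> \<otimes> m \<in> J" using m unfolding A_def by blast
      then show ?thesis using Mc[OF m] by simp
    qed
    then have "M d \<subseteq> M (Suc d)" using JM by blast
    then show ?thesis unfolding M_def by blast
  next
    case False
    obtain P where P: "primeideal P R" "A d \<subseteq> P"
      and minP: "\<And>T. primeideal T R \<Longrightarrow> A d \<subseteq> T \<Longrightarrow> T \<subseteq> P \<Longrightarrow> T = P"
      using ex_minimal_prime[OF A False] by blast
    have "\<exists>l. local_length_le R (\<lambda>x. x) P l (A d) (carrier R)"
      by (rule finite_local_length[OF P(1) A minP])
    then obtain l where l: "local_length_le R (\<lambda>x. x) P l (A d) (carrier R)" by blast
    have gens: "\<exists>B. set B \<subseteq> M e \<and> (\<forall>Z. I.submod Z \<longrightarrow> set B \<subseteq> Z \<longrightarrow> M e \<subseteq> Z)" for e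
    proof -
      obtain B where B: "B \<subseteq> carrier R" "finite B" "M e = Idl B" using finetely_gen[OF M(1)] by blast
      obtain bs where bs: "set bs = B" using finite_list[OF B(2)] by blast
      have "B \<subseteq> M e" using genideal_self[OF B(1)] B(3) by simp
      moreover have "M e \<subseteq> Z" if "I.submod Z" "B \<subseteq> Z" for Z
        using genideal_minimal[of Z B] that B(3) submodule_id_iff_ideal by simp
      ultimately show ?thesis using bs by blast
    qed
    obtain bs where bs: "set bs \<subseteq> M d" "\<And>Z. I.submod Z \<Longrightarrow> set bs \<subseteq> Z \<Longrightarrow> M d \<subseteq> Z" using gens[of d] by blast
    have bsc: "set bs \<subseteq> carrier R" using bs(1) Mc by blast
    have len: "local_length_le R (\<lambda>x. x) P (length bs * l) J (I.span_over J bs)"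
    proof (rule I.local_length_span[OF P(1) J(2) bsc A _ l])
      fix a w assume "a \<in> A d" "w \<in> set bs"
      then show "a \<otimes> w \<in> J" using bs(1) unfolding A_def by blast
    qed
    have sp: "I.submod (I.span_over J bs)" "M d \<subseteq> I.span_over J bs"
      using I.submod_span[OF J(2) bsc] bs(2) I.span_upper[OF J(2) bsc] by auto
    have "\<exists>e\<ge>d. M e \<subseteq> I.sat P (M (Suc e))"
    proof (rule ccontr)
      assume no: "\<not> ?thesis"
      have "I.chain P n J (M e)" if "d \<le> e" for n e
        using that
      proof (induction n arbitrary: e)
        case 0
        then show ?case using J(2) M(2) JM by simp
      next
        case (Suc n)
        have "I.chain P n J (M (Suc e))" using Suc by simp
        moreover have "M (Suc e) \<subseteq> M e" by (rule anti) simp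
        moreover have "\<not> M e \<subseteq> I.sat P (M (Suc e))" using no Suc.prems by blast
        ultimately show ?case unfolding local_chain.simps using M(2) by blast
      qed
      then have "I.chain P (Suc (length bs * l)) J (M d)" by blast
      then have "I.chain P (Suc (length bs * l)) J (I.span_over J bs)"
        by (rule I.chain_mono[OF P(1) _ J(2) sp(1) order_refl sp(2)])
      then have "Suc (length bs * l) \<le> length bs * l" using len unfolding local_length_le_def by blast
      then show False by simp
    qed
    then obtain e where e: "d \<le> e" "M e \<subseteq> I.sat P (M (Suc e))" by blast
    obtain cs where cs: "set cs \<subseteq> M e" "\<And>Z. I.submod Z \<Longrightarrow> set cs \<subseteq> Z \<Longrightarrow> M e \<subseteq> Z" using gens[of e] by blast
    have "set cs \<subseteq> I.sat P (M (Suc e))" using cs(1) e(2) by (rule order_trans)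
    from I.common_denominator[OF P(1) M(2) finite_set this]
    obtain x where x: "x \<in> carrier R - P" and xc: "\<And>b. b \<in> set cs \<Longrightarrow> x \<otimes> b \<in> M (Suc e)" by blast
    let ?Z = "{s \<in> carrier R. x \<otimes> s \<in> M (Suc e)}"
    have "I.submod ?Z" by (rule I.submod_mult_preimage[OF M(2)]) (use x in simp)
    moreover have "set cs \<subseteq> ?Z" using xc cs(1) Mc by blast
    ultimately have "M e \<subseteq> ?Z" by (rule cs(2))
    then have step: "x \<otimes> m \<in> M (Suc e)" if "m \<in> M e" for m using that by blast
    have xx: "x \<otimes> x \<otimes> m \<in> M (k + e)" if "m \<in> M e" for m k
      using cartier_ideal_propagate[OF fid f _ step[unfolded M_def], of m k] that x unfolding M_def by blast
    have "x \<otimes> x \<otimes> m \<in> J" if m: "m \<in> M e" for m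
    proof -
      have "x \<otimes> x \<otimes> m \<in> M j" for j using xx[OF m, of j] anti[of j "j + e"] by auto
      then show ?thesis by (simp add: J_def)
    qed
    then have "x \<otimes> x \<in> A e" using x by (simp add: A_def)
    then have "x \<otimes> x \<in> P" using Ad[OF e(1)] P(2) by blast
    then show ?thesis using I.denominators(2)[OF P(1) x x] by simp
  qed
qed

end

text \<open>If \<open>g(s) = \<Sum> \<eta>\<^sub>j(s)^q t\<^sub>j\<close> and \<open>\<eta>\<^sub>j(f^(q-1)) = \<theta>\<^sub>j(f^(q p^k - 1))\<close>, where \<open>q = p^e\<close>, then
  \<open>\<delta>(s) = \<Sum> \<theta>\<^sub>j(s)^(q p^k) t\<^sub>j^(p^k)\<close> is linear over the \<open>q p^k\<close>-th powers and takes \<open>f^(q p^k - 1)\<close> to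
  \<open>g(f^(q-1))^(p^k)\<close>. The case \<open>g = id\<close> is the assertion.\<close>

lemma (in char_p_ring) ex_power_linear_of_stable:
  assumes fid: "\<And>e. factorizable e (\<lambda>s. s)" and f: "f \<in> carrier R"
    and stable: "cartier_ideal f e \<subseteq> cartier_ideal f (Suc e)"
  shows "\<exists>\<delta>. power_linear R (p ^ (k + e)) \<delta> \<and>
    \<delta> (f [^] (p ^ (k + e) - 1)) = f [^] (p ^ (k + e) - p ^ k)"
proof -
  let ?F = "f [^] (p ^ e - 1)" and ?F' = "f [^] (p ^ (k + e) - 1)" and ?q = "p ^ (k + e)"
  have Mc: "m \<in> carrier R" if "m \<in> cartier_ideal f e" for m e
    using that ideal.Icarr[OF ideal_cartier_ideal[OF f]] by blast
  have stab: "m \<in> cartier_ideal f (k + e)" if m: "m \<in> cartier_ideal f e" for m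
  proof -
    have "\<one> \<otimes> \<one> \<otimes> m \<in> cartier_ideal f (k + e)"
      by (rule cartier_ideal_propagate[OF fid f one_closed _ m]) (use stable Mc in auto)
    then show ?thesis using Mc[OF m] by simp
  qed
  have pos: "0 < p ^ k" "0 < p ^ e" using prime_gt_0_nat[OF prime_p] by auto
  have "g ?F \<in> carrier R \<and> (\<exists>\<delta>. power_linear R ?q \<delta> \<and> \<delta> ?F' = (g ?F) [^] (p ^ k))" if "factorizable e g" for g
    using that
  proof (induction rule: factorizable_induct)
    case (cong g h)
    have "h ?F = g ?F" using cong(2)[of ?F] f by simp
    then show ?case using cong(1) by simp
  next
    case zero
    have "power_linear R ?q (\<lambda>s. \<zero>)" by (simp add: power_linear_def)
    moreover have "\<zero> [^] (p ^ k) = \<zero>" using pos by (simp add: nat_pow_zero)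
    ultimately show ?case by (intro conjI exI[of _ "\<lambda>s. \<zero>"]) auto
  next
    case (add g \<eta> t)
    have gc: "g ?F \<in> carrier R" using add(4) by blast
    obtain \<delta> where \<delta>: "power_linear R ?q \<delta>" "\<delta> ?F' = (g ?F) [^] (p ^ k)" using add(4) by blast
    have etac: "\<eta> ?F \<in> carrier R" using cartier_mapD(1)[OF add(2)] f by simp
    have "\<eta> ?F \<in> cartier_ideal f (k + e)" by (rule stab[OF cartier_idealI[OF add(2)]])
    then obtain \<theta> where \<theta>: "cartier_map (k + e) \<theta>" "\<eta> ?F = \<theta> ?F'" by (rule cartier_idealE)
    note [simp] = cartier_mapD[OF \<theta>(1)] add(3)
    have "power_linear R ?q (\<lambda>s. \<theta> s [^] ?q \<otimes> t [^] (p ^ k) \<oplus> \<delta> s)"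
      using \<delta>(1) unfolding power_linear_def
      by (simp add: power_pe_add nat_pow_distrib l_distr r_distr m_assoc a_ac)
    moreover have "\<theta> ?F' [^] ?q \<otimes> t [^] (p ^ k) \<oplus> \<delta> ?F' = (\<eta> ?F [^] (p ^ e) \<otimes> t \<oplus> g ?F) [^] (p ^ k)"
      unfolding \<delta>(2) \<theta>(2)[symmetric] using etac gc
      by (simp add: power_pe_add nat_pow_distrib nat_pow_pow power_add mult.commute)
    ultimately have ex: "\<exists>\<delta>. power_linear R ?q \<delta> \<and> \<delta> ?F' = (\<eta> ?F [^] (p ^ e) \<otimes> t \<oplus> g ?F) [^] (p ^ k)"
      by (intro exI[of _ "\<lambda>s. \<theta> s [^] ?q \<otimes> t [^] (p ^ k) \<oplus> \<delta> s"] conjI)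
    show ?case by (rule conjI[OF _ ex]) (use etac gc in simp)
  qed
  from this[OF fid] obtain \<delta> where \<delta>: "power_linear R ?q \<delta>" "\<delta> ?F' = ?F [^] (p ^ k)" by blast
  have "(p ^ e - 1) * p ^ k = ?q - p ^ k"
    unfolding power_add diff_mult_distrib by (simp only: mult_1 mult.commute)
  then have "?F [^] (p ^ k) = f [^] (?q - p ^ k)" using f by (simp add: nat_pow_pow)
  then show ?thesis using \<delta> by (intro exI[of _ \<delta>]) simp
qed


section \<open>Operators that are linear over powers are differential operators\<close>

context cring
begin

definition zero_op :: "'a \<Rightarrow> 'a" where "zero_op = (\<lambda>x\<in>carrier R. \<zero>)"

lemma zero_op_diff_ops_le: "zero_op \<in> diff_ops_le R m"
proof (induction m)
  case 0
  have "zero_op = (\<lambda>x\<in>carrier R. \<zero> \<otimes> x)" unfolding zero_op_def by (rule restrict_ext) simp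
  then have "\<exists>r. zero_op = (\<lambda>x\<in>carrier R. r \<otimes> x) \<and> r \<in> carrier R" using zero_closed by blast
  then show ?case by simp
qed (rule diff_ops_le_Suc)

lemma op_add_diff_ops_le:
  "\<delta> \<in> diff_ops_le R m \<Longrightarrow> \<epsilon> \<in> diff_ops_le R m \<Longrightarrow> op_add \<delta> \<epsilon> \<in> diff_ops_le R m"
proof (induction m arbitrary: \<delta> \<epsilon>)
  case 0
  then obtain c d where c: "\<delta> = (\<lambda>x\<in>carrier R. c \<otimes> x)" "c \<in> carrier R"
    and d: "\<epsilon> = (\<lambda>x\<in>carrier R. d \<otimes> x)" "d \<in> carrier R" by auto
  have "op_add \<delta> \<epsilon> = (\<lambda>x\<in>carrier R. (c \<oplus> d) \<otimes> x)"
    unfolding c(1) d(1) op_defs using c(2) d(2) by (intro restrict_ext) (simp add: l_distr)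
  then show ?case unfolding diff_ops_le.simps using c(2) d(2) by blast
next
  case (Suc m)
  have e: "\<delta> \<in> additive_endos R" "\<epsilon> \<in> additive_endos R" using Suc.prems by auto
  have "diff_comm R (op_add \<delta> \<epsilon>) r \<in> diff_ops_le R m" if r: "r \<in> carrier R" for r
    unfolding diff_comm_op(1)[OF e r r] using Suc r by (intro Suc.IH) auto
  then show ?case using op_endos(1)[OF e one_closed] by simp
qed

lemma diff_comm_commute:
  assumes "\<delta> \<in> additive_endos R" "r \<in> carrier R" "s \<in> carrier R"
  shows "diff_comm R (diff_comm R \<delta> r) s = diff_comm R (diff_comm R \<delta> s) r"
  unfolding diff_comm_def
  using additive_endosD(1)[OF assms(1)] assms(2,3)
  by (intro restrict_ext) (simp add: a_minus_def r_distr r_minus minus_add m_lcomm a_ac)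

definition iterated_comm :: "'a \<Rightarrow> nat \<Rightarrow> ('a \<Rightarrow> 'a) \<Rightarrow> 'a \<Rightarrow> 'a" where
  "iterated_comm r n = ((\<lambda>\<delta>. diff_comm R \<delta> r) ^^ n)"

lemma iterated_comm_simps [simp]:
  "iterated_comm r 0 \<delta> = \<delta>"
  "iterated_comm r (Suc n) \<delta> = diff_comm R (iterated_comm r n \<delta>) r"
  by (simp_all add: iterated_comm_def)

lemma iterated_comm_endo:
  "\<delta> \<in> additive_endos R \<Longrightarrow> r \<in> carrier R \<Longrightarrow> iterated_comm r n \<delta> \<in> additive_endos R"
  by (induction n) (simp_all add: diff_comm_endo)

lemma iterated_comm_commute:
  assumes "\<delta> \<in> additive_endos R" "r \<in> carrier R" "s \<in> carrier R"
  shows "iterated_comm r n (diff_comm R \<delta> s) = diff_comm R (iterated_comm r n \<delta>) s"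
  by (induction n) (simp_all add: diff_comm_commute[of _ r s] iterated_comm_endo assms)

lemma diff_comm_zero_op: "r \<in> carrier R \<Longrightarrow> diff_comm R zero_op r = zero_op"
  unfolding diff_comm_def zero_op_def by (rule restrict_ext) (simp add: a_minus_def)

text \<open>The commutator with \<open>r\<close> is \<open>A + B\<close>, where \<open>A \<delta> = - r \<circ> \<delta>\<close> and \<open>B \<delta> = \<delta> \<circ> r\<close> commute. The factor \<open>y\<close> makes
  the induction work.\<close>

lemma pascal_sum_iterated_comm:
  assumes \<delta>: "\<delta> \<in> additive_endos R" and r: "r \<in> carrier R"
  shows "x \<in> carrier R \<Longrightarrow> y \<in> carrier R \<Longrightarrow>
    pascal_sum R n (\<lambda>i j. y \<otimes> ((\<ominus> r) [^] i \<otimes> \<delta> (r [^] j \<otimes> x))) = y \<otimes> iterated_comm r n \<delta> x"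
proof (induction n arbitrary: x y)
  case 0
  then show ?case using additive_endosD(1)[OF \<delta>] by simp
next
  case (Suc n)
  note [simp] = additive_endosD(1)[OF \<delta>] r Suc.prems
  have d [simp]: "iterated_comm r n \<delta> z \<in> carrier R" if "z \<in> carrier R" for z
    using additive_endosD(1)[OF iterated_comm_endo[OF \<delta> r] that] .
  have "(\<lambda>i j::nat. y \<otimes> ((\<ominus> r) [^] Suc i \<otimes> \<delta> (r [^] j \<otimes> x))) =
      (\<lambda>i j. (y \<otimes> \<ominus> r) \<otimes> ((\<ominus> r) [^] i \<otimes> \<delta> (r [^] j \<otimes> x)))"
    by (intro ext) (simp add: m_ac)
  moreover have "(\<lambda>(i::nat) j. y \<otimes> ((\<ominus> r) [^] i \<otimes> \<delta> (r [^] Suc j \<otimes> x))) =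
      (\<lambda>i j. y \<otimes> ((\<ominus> r) [^] i \<otimes> \<delta> (r [^] j \<otimes> (r \<otimes> x))))"
    by (intro ext) (simp add: m_assoc)
  ultimately have "pascal_sum R (Suc n) (\<lambda>i j. y \<otimes> ((\<ominus> r) [^] i \<otimes> \<delta> (r [^] j \<otimes> x))) =
      (y \<otimes> \<ominus> r) \<otimes> iterated_comm r n \<delta> x \<oplus> y \<otimes> iterated_comm r n \<delta> (r \<otimes> x)"
    using Suc.IH[of x "y \<otimes> \<ominus> r"] Suc.IH[of "r \<otimes> x" y] by (simp del: nat_pow_Suc)
  also have "\<dots> = y \<otimes> iterated_comm r (Suc n) \<delta> x"
    by (simp add: op_apply(4) a_minus_def r_distr l_minus r_minus m_assoc a_comm)
  finally show ?case .
qed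

end

context char_p_ring
begin

text \<open>The \<open>p\<close>-th power of a difference of commuting operators is the difference of their \<open>p\<close>-th
  powers.\<close>

lemma iterated_comm_p:
  assumes \<delta>: "\<delta> \<in> additive_endos R" and r: "r \<in> carrier R"
  shows "iterated_comm r p \<delta> = diff_comm R \<delta> (r [^] p)"
proof -
  interpret F: twisted_ring R frob by (rule twisted_ring_frob)
  note [simp] = additive_endosD(1)[OF \<delta>] r
  show ?thesis
  proof (rule extensionalityI)
    show "iterated_comm r p \<delta> \<in> extensional (carrier R)"
      using additive_endosD(3)[OF iterated_comm_endo[OF \<delta> r]] .
    show "diff_comm R \<delta> (r [^] p) \<in> extensional (carrier R)" by (simp add: diff_comm_def)
    fix x assume x: "x \<in> carrier R"
    have "iterated_comm r p \<delta> x \<in> carrier R"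
      using additive_endosD(1)[OF iterated_comm_endo[OF \<delta> r] x] .
    then have "iterated_comm r p \<delta> x =
        pascal_sum R p (\<lambda>i j. \<one> \<otimes> ((\<ominus> r) [^] i \<otimes> \<delta> (r [^] j \<otimes> x)))"
      using pascal_sum_iterated_comm[OF \<delta> r x one_closed, of p] by simp
    also have "\<dots> = \<ominus> (r [^] p) \<otimes> \<delta> x \<oplus> \<delta> (r [^] p \<otimes> x)"
      using pascal_sum_p[of "\<lambda>i j. \<one> \<otimes> ((\<ominus> r) [^] i \<otimes> \<delta> (r [^] j \<otimes> x))"] x
      by (simp add: F.sigma_minus)
    also have "\<dots> = diff_comm R \<delta> (r [^] p) x"
      using x by (simp add: op_apply(4) a_minus_def l_minus a_comm)
    finally show "iterated_comm r p \<delta> x = diff_comm R \<delta> (r [^] p) x" .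
  qed
qed

lemma iterated_comm_pe:
  "\<delta> \<in> additive_endos R \<Longrightarrow> r \<in> carrier R \<Longrightarrow> iterated_comm r (p ^ e) \<delta> = diff_comm R \<delta> (r [^] (p ^ e))"
proof (induction e arbitrary: r)
  case 0
  then show ?case by simp
next
  case (Suc e)
  have "iterated_comm r (p * n) \<delta> = iterated_comm (r [^] p) n \<delta>" for n
  proof (induction n)
    case (Suc n)
    have "iterated_comm r (p * Suc n) \<delta> = iterated_comm r p (iterated_comm r (p * n) \<delta>)"
      by (simp add: iterated_comm_def funpow_add)
    then show ?case using Suc iterated_comm_p iterated_comm_endo \<open>\<delta> \<in> _\<close> \<open>r \<in> _\<close> by simp
  qed simp
  from this[of "p ^ e"] Suc.IH[of "r [^] p"] Suc.prems show ?case
    by (simp add: nat_pow_pow)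
qed

lemma endo_zero:
  assumes "\<delta> \<in> additive_endos R"
  shows "\<delta> \<zero> = \<zero>"
proof -
  have "\<delta> \<zero> \<oplus> \<delta> \<zero> = \<delta> \<zero>" using additive_endosD(2)[OF assms, of \<zero> \<zero>] by simp
  then show ?thesis using additive_endosD(1)[OF assms, of \<zero>] by simp
qed

text \<open>For \<open>\<delta>\<close> linear over the \<open>q\<close>-th powers, the commutator with \<open>r\<close> depends \<open>q\<close>-linearly on \<open>r\<close>: the
  commutator with \<open>a^q r\<close> is \<open>a^q\<close> times the commutator with \<open>r\<close>. So the order need only be tested on
  generators.\<close>

lemma diff_ops_le_Suc_of_generators:
  assumes bs: "carrier R \<subseteq> twisted_span R (\<lambda>a. a [^] (p ^ e)) {\<zero>} bs" "set bs \<subseteq> carrier R"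
    and \<delta>: "\<delta> \<in> additive_endos R" "power_linear R (p ^ e) \<delta>"
    and gen: "\<And>b. b \<in> set bs \<Longrightarrow> diff_comm R \<delta> b \<in> diff_ops_le R m"
  shows "\<delta> \<in> diff_ops_le R (Suc m)"
proof -
  interpret F: twisted_ring R "\<lambda>a. a [^] (p ^ e)" by (rule twisted_ring_frobenius)
  note [simp] = additive_endosD(1)[OF \<delta>(1)] endo_zero[OF \<delta>(1)]
  have lin: "\<delta> (a [^] (p ^ e) \<otimes> s) = a [^] (p ^ e) \<otimes> \<delta> s" if "a \<in> carrier R" "s \<in> carrier R" for a s
    using \<delta>(2) that by (simp add: power_linear_def)
  let ?Z = "{r \<in> carrier R. diff_comm R \<delta> r \<in> diff_ops_le R m}"
  have "F.submod ?Z"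
  proof (rule F.submodI)
    have "diff_comm R \<delta> \<zero> = zero_op"
      unfolding diff_comm_def zero_op_def by (rule restrict_ext) (simp add: a_minus_def)
    then show "\<zero> \<in> ?Z" using zero_op_diff_ops_le by simp
  next
    fix r s assume rs: "r \<in> ?Z" "s \<in> ?Z"
    have "diff_comm R \<delta> (r \<oplus> s) = op_add (diff_comm R \<delta> r) (diff_comm R \<delta> s)"
      unfolding diff_comm_def op_defs using rs additive_endosD(2)[OF \<delta>(1)]
      by (intro restrict_ext) (simp add: a_minus_def l_distr minus_add a_ac)
    then show "r \<oplus> s \<in> ?Z" using rs op_add_diff_ops_le by simp
  next
    fix a r assume a: "a \<in> carrier R" and r: "r \<in> ?Z"
    have "diff_comm R \<delta> (a [^] (p ^ e) \<otimes> r) = op_lmult (a [^] (p ^ e)) (diff_comm R \<delta> r)"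
      unfolding diff_comm_def op_defs using a r
      by (intro restrict_ext) (simp add: m_assoc lin minus_distrib)
    then show "a [^] (p ^ e) \<otimes> r \<in> ?Z" using a r op_mult_in_diff_ops_le by simp
  qed auto
  moreover have "set bs \<subseteq> ?Z" using gen bs(2) by blast
  ultimately have "F.span_over {\<zero>} bs \<subseteq> ?Z" using F.submodD(2) by (intro F.span_least) auto
  then show ?thesis using bs(1) \<delta>(1) by auto
qed

lemma power_linear_diff_comm:
  assumes "\<delta> \<in> additive_endos R" "power_linear R q \<delta>" "r \<in> carrier R"
  shows "power_linear R q (diff_comm R \<delta> r)"
  unfolding power_linear_def
proof (intro conjI ballI)
  note e = diff_comm_endo[OF assms(1,3)]
  show "diff_comm R \<delta> r s \<in> carrier R" if "s \<in> carrier R" for s using additive_endosD(1)[OF e that] .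
  show "diff_comm R \<delta> r (s \<oplus> t) = diff_comm R \<delta> r s \<oplus> diff_comm R \<delta> r t"
    if "s \<in> carrier R" "t \<in> carrier R" for s t using additive_endosD(2)[OF e that] .
  fix a s assume as: "a \<in> carrier R" "s \<in> carrier R"
  have "\<delta> (r \<otimes> (a [^] q \<otimes> s)) = a [^] q \<otimes> \<delta> (r \<otimes> s)" "\<delta> (a [^] q \<otimes> s) = a [^] q \<otimes> \<delta> s"
    using assms as by (simp_all add: power_linear_def m_lcomm[of r])
  then show "diff_comm R \<delta> r (a [^] q \<otimes> s) = a [^] q \<otimes> diff_comm R \<delta> r s"
    using as assms additive_endosD(1)[OF assms(1)] by (simp add: op_apply(4) minus_distrib m_lcomm[of r])
qed

text \<open>Taking the commutator with a generator \<open>b\<close> lowers the exponent \<open>k b\<close> by one and keeps the others,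
  because iterated commutators commute. When all exponents are used up, the operator vanishes.\<close>

lemma diff_op_of_nilpotent_comms:
  assumes bs: "carrier R \<subseteq> twisted_span R (\<lambda>a. a [^] (p ^ e)) {\<zero>} bs" "set bs \<subseteq> carrier R"
  shows "\<delta> \<in> additive_endos R \<Longrightarrow> power_linear R (p ^ e) \<delta> \<Longrightarrow>
    (\<And>b. b \<in> set bs \<Longrightarrow> iterated_comm b (k b) \<delta> = zero_op) \<Longrightarrow> (\<Sum>b\<in>set bs. k b) \<le> m \<Longrightarrow>
    \<delta> \<in> diff_ops_le R (Suc m)"
proof (induction m arbitrary: \<delta> k)
  case (0 \<delta> k)
  show ?case
  proof (rule diff_ops_le_Suc_of_generators[OF bs 0(1,2)])
    fix b assume b: "b \<in> set bs"
    then have "k b = 0" using 0(4) by simp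
    then have "\<delta> = zero_op" using 0(3)[OF b] by simp
    then show "diff_comm R \<delta> b \<in> diff_ops_le R 0"
      using diff_comm_zero_op b bs(2) zero_op_diff_ops_le by (metis subsetD)
  qed
next
  case (Suc m \<delta> k)
  show ?case
  proof (rule diff_ops_le_Suc_of_generators[OF bs Suc.prems(1,2)])
    fix b assume b: "b \<in> set bs"
    have bc: "b \<in> carrier R" using b bs(2) by blast
    show "diff_comm R \<delta> b \<in> diff_ops_le R (Suc m)"
    proof (cases "k b")
      case 0
      then have "\<delta> = zero_op" using Suc.prems(3)[OF b] by simp
      then show ?thesis using diff_comm_zero_op[OF bc] zero_op_diff_ops_le by metis
    next
      case (Suc j)
      show ?thesis
      proof (rule Suc.IH)
        show "diff_comm R \<delta> b \<in> additive_endos R" by (rule diff_comm_endo[OF Suc.prems(1) bc])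
        show "power_linear R (p ^ e) (diff_comm R \<delta> b)" by (rule power_linear_diff_comm[OF Suc.prems(1,2) bc])
        have "(\<Sum>b\<in>set bs. k b) = k b + (\<Sum>b\<in>set bs - {b}. k b)" using b by (intro sum.remove) auto
        moreover have "(\<Sum>b'\<in>set bs. (k(b := j)) b') = j + (\<Sum>b'\<in>set bs - {b}. (k(b := j)) b')"
          using b by (subst sum.remove[of _ b]) auto
        moreover have "(\<Sum>b'\<in>set bs - {b}. (k(b := j)) b') = (\<Sum>b'\<in>set bs - {b}. k b')"
          by (intro sum.cong) auto
        ultimately show "(\<Sum>b'\<in>set bs. (k(b := j)) b') \<le> m" using Suc.prems(4) Suc by simp
        fix b' assume b': "b' \<in> set bs"
        have bc': "b' \<in> carrier R" using b' bs(2) by blast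
        show "iterated_comm b' ((k(b := j)) b') (diff_comm R \<delta> b) = zero_op"
        proof (cases "b' = b")
          case True
          then show ?thesis using Suc.prems(3)[OF b] Suc by (simp add: iterated_comm_commute[OF Suc.prems(1) bc bc])
        next
          case False
          then show ?thesis
            using Suc.prems(3)[OF b'] diff_comm_zero_op[OF bc]
            by (simp add: iterated_comm_commute[OF Suc.prems(1) bc' bc])
        qed
      qed
    qed
  qed
qed

text \<open>The \<open>p^e\<close>-fold commutator with \<open>b\<close> is the commutator with \<open>b^(p^e)\<close>, which is zero by linearity.\<close>

lemma power_linear_diff_op:
  assumes bs: "carrier R \<subseteq> twisted_span R (\<lambda>a. a [^] (p ^ e)) {\<zero>} bs" "set bs \<subseteq> carrier R"
    and \<delta>: "power_linear R (p ^ e) \<delta>"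
  shows "restrict \<delta> (carrier R) \<in> diff_ops R"
proof -
  let ?d = "\<lambda>x\<in>carrier R. \<delta> x"
  have e: "?d \<in> additive_endos R" using \<delta> by (intro additive_endosI) (auto simp: power_linear_def)
  have lin: "power_linear R (p ^ e) ?d" using \<delta> by (simp add: power_linear_def)
  have "iterated_comm b (p ^ e) ?d = zero_op" if b: "b \<in> set bs" for b
  proof -
    have bc: "b \<in> carrier R" using b bs(2) by blast
    show ?thesis
      unfolding iterated_comm_pe[OF e bc] diff_comm_def zero_op_def
      using lin bc by (intro restrict_ext) (simp add: power_linear_def r_right_minus_eq)
  qed
  from diff_op_of_nilpotent_comms[OF bs e lin this order_refl] show ?thesis
    unfolding diff_ops_def by blast
qed

lemma F_finite_span:
  assumes "F_finite p R"
  shows "\<exists>bs. set bs \<subseteq> carrier R \<and> carrier R \<subseteq> twisted_span R frob {\<zero>} bs"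
proof -
  interpret F: twisted_ring R frob by (rule twisted_ring_frob)
  obtain B where B: "finite B" "B \<subseteq> carrier R"
    and span: "\<And>x. x \<in> carrier R \<Longrightarrow> \<exists>c\<in>B \<rightarrow> carrier R. x = (\<Oplus>b\<in>B. (c b [^] p) \<otimes> b)"
    using assms unfolding F_finite_def by blast
  obtain bs where bs: "set bs = B" using finite_list[OF B(1)] by blast
  have bsc: "set bs \<subseteq> carrier R" using bs B(2) by simp
  have V: "F.submod (F.span_over {\<zero>} bs)" "B \<subseteq> F.span_over {\<zero>} bs"
    using F.submod_span[OF F.submod_zero bsc] F.span_upper[OF F.submod_zero bsc] bs by auto
  have "x \<in> F.span_over {\<zero>} bs" if x: "x \<in> carrier R" for x
  proof -
    obtain c where c: "c \<in> B \<rightarrow> carrier R" and xc: "x = (\<Oplus>b\<in>B. (c b [^] p) \<otimes> b)" using span[OF x] by blast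
    have "(\<Oplus>b\<in>A. (c b [^] p) \<otimes> b) \<in> F.span_over {\<zero>} bs" if "A \<subseteq> B" for A
      using finite_subset[OF that B(1)] that
    proof (induction A rule: finite_induct)
      case empty
      then show ?case using F.submodD(2)[OF V(1)] by simp
    next
      case (insert b A)
      have car: "(\<lambda>b. c b [^] p \<otimes> b) \<in> A \<rightarrow> carrier R" "c b [^] p \<otimes> b \<in> carrier R"
        using insert.prems Pi_mem[OF c] B(2) by (auto simp: subset_iff)
      have "c b [^] p \<otimes> b \<in> F.span_over {\<zero>} bs"
        using F.submodD(4)[OF V(1), of "c b" b] c V(2) insert.prems by auto
      then show ?case
        using insert F.submodD(3)[OF V(1)] finsum_insert[OF insert.hyps car] by simp
    qed
    then show ?thesis unfolding xc by blast
  qed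
  then show ?thesis using bsc by blast
qed

text \<open>Substitute \<open>a = \<Sum> c\<^sub>i^q w\<^sub>i\<close> into each term \<open>a^p b\<close> of an expression of an element through the
  generators over the \<open>p\<close>-th powers; the \<open>w\<^sub>i^p b\<close> then generate over the \<open>p q\<close>-th powers.\<close>

lemma F_finite_span_iterate:
  assumes bs: "set bs \<subseteq> carrier R" "carrier R \<subseteq> twisted_span R frob {\<zero>} bs"
  shows "\<exists>ws. set ws \<subseteq> carrier R \<and> carrier R \<subseteq> twisted_span R (\<lambda>a. a [^] (p ^ e)) {\<zero>} ws"
proof (induction e)
  case 0
  interpret F: twisted_ring R "\<lambda>a. a [^] (p ^ 0)" by (rule twisted_ring_frobenius)
  have "x \<in> F.span_over {\<zero>} [\<one>]" if "x \<in> carrier R" for x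
    using F.span_ConsI[OF that, of \<zero> "{\<zero>}" "[]" \<one>] that by simp
  then show ?case by (intro exI[of _ "[\<one>]"]) (auto simp del: twisted_span.simps)
next
  case (Suc e)
  then obtain ws where ws: "set ws \<subseteq> carrier R" "carrier R \<subseteq> twisted_span R (\<lambda>a. a [^] (p ^ e)) {\<zero>} ws" by blast
  interpret F: twisted_ring R frob by (rule twisted_ring_frob)
  interpret G: twisted_ring R "\<lambda>a. a [^] (p ^ e)" by (rule twisted_ring_frobenius)
  interpret H: twisted_ring R "\<lambda>a. a [^] (p ^ Suc e)" by (rule twisted_ring_frobenius)
  let ?l = "\<lambda>us b. map (\<lambda>w. w [^] p \<otimes> b) us"
  define vs where "vs = concat (map (?l ws) bs)"
  have vs: "set vs \<subseteq> carrier R" using ws bs by (auto simp: vs_def)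
  define V where "V = H.span_over {\<zero>} vs"
  have V: "H.submod V" "set vs \<subseteq> V"
    unfolding V_def using H.submod_span[OF H.submod_zero vs] H.span_upper[OF H.submod_zero vs] by auto
  have one: "a [^] p \<otimes> b \<in> V" if a: "a \<in> carrier R" and b: "b \<in> set bs" for a b
  proof -
    have bc: "b \<in> carrier R" using b bs by blast
    let ?Z = "{a \<in> carrier R. a [^] p \<otimes> b \<in> V}"
    have Z: "G.submod ?Z"
    proof (rule G.submodI)
      show "\<zero> \<in> ?Z" using H.submodD(2)[OF V(1)] bc F.sigma_zero by simp
      show "x \<oplus> y \<in> ?Z" if "x \<in> ?Z" "y \<in> ?Z" for x y
        using that H.submodD(3)[OF V(1)] bc by (simp add: power_p_add l_distr)
      show "c [^] (p ^ e) \<otimes> x \<in> ?Z" if "c \<in> carrier R" "x \<in> ?Z" for c x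
        using that H.submodD(4)[OF V(1), of c "x [^] p \<otimes> b"] bc
        by (simp add: nat_pow_distrib nat_pow_pow m_assoc mult.commute)
    qed auto
    have "set ws \<subseteq> ?Z" using V(2) b ws(1) unfolding vs_def by auto
    then have "G.span_over {\<zero>} ws \<subseteq> ?Z" using G.submodD(2)[OF Z] by (intro G.span_least[OF Z]) auto
    then show ?thesis using a ws(2) by blast
  qed
  have "F.span_over {\<zero>} us \<subseteq> V" if "set us \<subseteq> set bs" for us
    using that
  proof (induction us)
    case Nil
    then show ?case using H.submodD(2)[OF V(1)] by simp
  next
    case (Cons u us)
    then show ?case using one H.submodD(3)[OF V(1)] by auto
  qed
  then show ?case using vs bs(2) unfolding V_def by blast
qed

end


section \<open>Primes of a localization\<close>

context cring
begin

definition extension :: "'a set \<Rightarrow> 'a set \<Rightarrow> ('a \<times> 'a) set set" where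
  "extension M I = {fraction R M a s | a s. a \<in> I \<and> s \<in> M}"

definition contraction :: "'a set \<Rightarrow> ('a \<times> 'a) set set \<Rightarrow> 'a set" where
  "contraction M T = {a \<in> carrier R. fraction R M a \<one> \<in> T}"

lemma extension_ideal:
  assumes M: "submonoid M R" and I: "ideal I R"
  shows "ideal (extension M I) (localization R M)"
proof -
  interpret L: cring "localization R M" by (rule cring_localization[OF M])
  interpret LI: twisted_ring "localization R M" "\<lambda>x. x" by (rule L.twisted_ring_id)
  note M_simps = M_closed[OF M] M_mult[OF M] M_one[OF M]
  note Ic = ideal.Icarr[OF I]
  note sI = twisted_ring.submodD[OF twisted_ring_id twisted_ring.ideal_submod[OF twisted_ring_id I]]
  have "LI.submod (extension M I)"
  proof (rule LI.submodI)
    show "extension M I \<subseteq> carrier (localization R M)"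
      using Ic fraction_in_localization[OF M] by (auto simp: extension_def)
    show "\<zero>\<^bsub>localization R M\<^esub> \<in> extension M I"
      unfolding localization_carrier(3)[OF M] extension_def using sI(2) M_simps(3) by blast
  next
    fix x y assume "x \<in> extension M I" "y \<in> extension M I"
    then obtain a s b t where *: "a \<in> I" "s \<in> M" "b \<in> I" "t \<in> M"
      and xy: "x = fraction R M a s" "y = fraction R M b t" by (auto simp: extension_def)
    have "(a \<otimes> t) \<oplus> (b \<otimes> s) \<in> I"
      using * M_simps(1) ideal.I_r_closed[OF I] sI(3) by simp
    then show "x \<oplus>\<^bsub>localization R M\<^esub> y \<in> extension M I"
      unfolding xy localization_add[OF M Ic[OF *(1)] Ic[OF *(3)] *(2,4)] extension_def
      using M_simps(2)[OF *(2,4)] by blast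
  next
    fix x y assume "x \<in> carrier (localization R M)" "y \<in> extension M I"
    then obtain a s b t where *: "a \<in> carrier R" "s \<in> M" "b \<in> I" "t \<in> M"
      and xy: "x = fraction R M a s" "y = fraction R M b t"
      by (auto simp: extension_def localization_carrier(1)[OF M])
    have "a \<otimes> b \<in> I" using * ideal.I_l_closed[OF I] by simp
    then show "x \<otimes>\<^bsub>localization R M\<^esub> y \<in> extension M I"
      unfolding xy localization_mult[OF M *(1) Ic[OF *(3)] *(2,4)] extension_def
      using M_simps(2)[OF *(2,4)] by blast
  qed
  then show ?thesis by (simp add: L.submodule_id_iff_ideal)
qed

context
  fixes P M
  assumes P: "primeideal P R"
  defines "M \<equiv> carrier R - P"
begin

lemma prime_complement_submonoid: "submonoid M R"
proof -
  interpret I: twisted_ring R "\<lambda>x. x" by (rule twisted_ring_id)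
  show ?thesis unfolding M_def by unfold_locales (use I.denominators[OF P] in auto)
qed

lemma fraction_in_extension_iff:
  assumes Q: "primeideal Q R" "Q \<subseteq> P" and a: "a \<in> carrier R" "s \<in> M"
  shows "fraction R M a s \<in> extension M Q \<longleftrightarrow> a \<in> Q"
proof
  assume "fraction R M a s \<in> extension M Q"
  then obtain b t where bt: "b \<in> Q" "t \<in> M" "fraction R M a s = fraction R M b t" by (auto simp: extension_def)
  note iQ = primeideal.axioms(1)[OF Q(1)]
  have bc: "b \<in> carrier R" using ideal.Icarr[OF iQ bt(1)] .
  obtain u where u: "u \<in> M" "u \<otimes> (a \<otimes> t) = u \<otimes> (b \<otimes> s)"
    using bt(3) fraction_eq_iff[OF prime_complement_submonoid a(1) bc a(2) bt(2)] by blast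
  have car: "u \<in> carrier R" "t \<in> carrier R" "s \<in> carrier R" using u bt a by (auto simp: M_def)
  have "u \<otimes> (b \<otimes> s) \<in> Q" using ideal.I_l_closed[OF iQ ideal.I_r_closed[OF iQ bt(1)]] car by simp
  then have "(u \<otimes> t) \<otimes> a \<in> Q" using u(2) car a by (simp add: m_ac)
  moreover have "u \<otimes> t \<in> M" using M_mult[OF prime_complement_submonoid u(1) bt(2)] .
  ultimately show "a \<in> Q" using primeideal.I_prime[OF Q(1), of "u \<otimes> t" a] car a Q(2) by (auto simp: M_def)
qed (use a in \<open>auto simp: extension_def\<close>)

lemma extension_prime:
  assumes Q: "primeideal Q R" "Q \<subseteq> P"
  shows "primeideal (extension M Q) (localization R M)"
proof (rule primeidealI[OF extension_ideal[OF prime_complement_submonoid primeideal.axioms(1)[OF Q(1)]] cring_localization[OF prime_complement_submonoid]])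
  note S = prime_complement_submonoid
  have "\<one> \<notin> Q" using M_one[OF S] Q(2) by (auto simp: M_def)
  then have "fraction R M \<one> \<one> \<notin> extension M Q"
    using fraction_in_extension_iff[OF Q one_closed M_one[OF S]] by simp
  moreover have "fraction R M \<one> \<one> \<in> carrier (localization R M)"
    using fraction_in_localization[OF S one_closed M_one[OF S]] .
  ultimately show "carrier (localization R M) \<noteq> extension M Q" by blast
  fix x y assume "x \<in> carrier (localization R M)" "y \<in> carrier (localization R M)"
    and xy: "x \<otimes>\<^bsub>localization R M\<^esub> y \<in> extension M Q"
  then obtain a s b t where *: "a \<in> carrier R" "s \<in> M" "b \<in> carrier R" "t \<in> M"
    "x = fraction R M a s" "y = fraction R M b t" by (auto simp: localization_carrier(1)[OF S])
  then have "a \<otimes> b \<in> Q"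
    using xy fraction_in_extension_iff[OF Q m_closed[OF *(1,3)] M_mult[OF S *(2,4)]]
    by (simp add: localization_mult[OF S])
  then have "a \<in> Q \<or> b \<in> Q" using primeideal.I_prime[OF Q(1) *(1,3)] by blast
  then show "x \<in> extension M Q \<or> y \<in> extension M Q"
    using * fraction_in_extension_iff[OF Q] by simp
qed

lemma extension_strict:
  assumes Q: "primeideal Q R" "Q \<subseteq> P" and Q': "primeideal Q' R" "Q' \<subseteq> P" "Q \<subset> Q'"
  shows "extension M Q \<subset> extension M Q'"
proof -
  obtain a where a: "a \<in> Q'" "a \<notin> Q" using Q' by blast
  have ac: "a \<in> carrier R" using a ideal.Icarr[OF primeideal.axioms(1)[OF Q'(1)]] by blast
  have one: "\<one> \<in> M" using M_one[OF prime_complement_submonoid] .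
  have "fraction R M a \<one> \<in> extension M Q'" "fraction R M a \<one> \<notin> extension M Q"
    using fraction_in_extension_iff[OF Q ac one] fraction_in_extension_iff[OF Q'(1,2) ac one] a by auto
  moreover have "extension M Q \<subseteq> extension M Q'" using Q'(3) by (auto simp: extension_def)
  ultimately show ?thesis by blast
qed

lemma contraction_iff:
  assumes T: "ideal T (localization R M)" and a: "a \<in> carrier R" "s \<in> M"
  shows "fraction R M a s \<in> T \<longleftrightarrow> a \<in> contraction M T"
proof
  note S = prime_complement_submonoid
  have s: "s \<in> carrier R" using a by (simp add: M_def)
  have one: "\<one> \<in> M" using M_one[OF S] .
  {
    assume "fraction R M a s \<in> T"
    then have "fraction R M s \<one> \<otimes>\<^bsub>localization R M\<^esub> fraction R M a s \<in> T"
      by (rule ideal.I_l_closed[OF T]) (rule fraction_in_localization[OF S s one])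
    moreover have "fraction R M s \<one> \<otimes>\<^bsub>localization R M\<^esub> fraction R M a s = fraction R M (s \<otimes> a) (s \<otimes> \<one>)"
      using s a by (simp add: localization_mult[OF S s a(1) one a(2)])
    ultimately show "a \<in> contraction M T"
      using fraction_cancel[OF S a(1) one a(2)] a(1) by (simp add: contraction_def)
  next
    assume "a \<in> contraction M T"
    then have "fraction R M a \<one> \<in> T" by (simp add: contraction_def)
    then have "fraction R M \<one> s \<otimes>\<^bsub>localization R M\<^esub> fraction R M a \<one> \<in> T"
      by (rule ideal.I_l_closed[OF T]) (rule fraction_in_localization[OF S one_closed a(2)])
    then show "fraction R M a s \<in> T"
      using s a by (simp add: localization_mult[OF S one_closed a(1) a(2) one])
  }
qed

lemma contraction_prime:
  assumes T: "primeideal T (localization R M)"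
  shows "primeideal (contraction M T) R" "contraction M T \<subseteq> P"
proof -
  note S = prime_complement_submonoid
  interpret L: cring "localization R M" by (rule cring_localization[OF S])
  interpret I: twisted_ring R "\<lambda>x. x" by (rule twisted_ring_id)
  note iT = primeideal.axioms(1)[OF T]
  interpret T: ideal T "localization R M" by (rule iT)
  have one: "\<one> \<in> M" using M_one[OF S] .
  have one_notin: "fraction R M \<one> \<one> \<notin> T"
    using primeideal.I_notcarr[OF T] ideal.one_imp_carrier[OF iT] by (auto simp: localization_carrier(2)[OF S])
  have "I.submod (contraction M T)"
  proof (rule I.submodI)
    show "\<zero> \<in> contraction M T" using T.zero_closed by (simp add: contraction_def localization_carrier(3)[OF S])
  next
    fix x y assume xy: "x \<in> contraction M T" "y \<in> contraction M T"
    then have c: "x \<in> carrier R" "y \<in> carrier R" by (auto simp: contraction_def)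
    have "fraction R M x \<one> \<oplus>\<^bsub>localization R M\<^esub> fraction R M y \<one> \<in> T"
      using xy by (intro T.a_closed) (auto simp: contraction_def)
    then show "x \<oplus> y \<in> contraction M T"
      using c by (simp add: contraction_def localization_add[OF S c one one])
  next
    fix a x assume a: "a \<in> carrier R" and x: "x \<in> contraction M T"
    then have c: "x \<in> carrier R" by (auto simp: contraction_def)
    have "fraction R M a \<one> \<otimes>\<^bsub>localization R M\<^esub> fraction R M x \<one> \<in> T"
      using x by (intro T.I_l_closed fraction_in_localization[OF S a one]) (auto simp: contraction_def)
    then show "a \<otimes> x \<in> contraction M T"
      using a c by (simp add: contraction_def localization_mult[OF S a c one one])
  qed (auto simp: contraction_def)
  then have i: "ideal (contraction M T) R" by (simp add: submodule_id_iff_ideal)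
  show "primeideal (contraction M T) R"
  proof (rule primeidealI[OF i is_cring])
    show "carrier R \<noteq> contraction M T" using one_notin by (auto simp: contraction_def)
    fix a b assume ab: "a \<in> carrier R" "b \<in> carrier R" "a \<otimes> b \<in> contraction M T"
    then have "fraction R M a \<one> \<otimes>\<^bsub>localization R M\<^esub> fraction R M b \<one> \<in> T"
      by (simp add: contraction_def localization_mult[OF S ab(1,2) one one])
    then show "a \<in> contraction M T \<or> b \<in> contraction M T"
      using primeideal.I_prime[OF T] fraction_in_localization[OF S _ one] ab by (auto simp: contraction_def)
  qed
  show "contraction M T \<subseteq> P"
  proof
    fix a assume a: "a \<in> contraction M T"
    show "a \<in> P"
    proof (rule ccontr)
      assume "a \<notin> P"
      then have aM: "a \<in> M" "a \<in> carrier R" using a by (auto simp: M_def contraction_def)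
      have "fraction R M a a \<in> T" using contraction_iff[OF iT aM(2,1)] a by simp
      moreover have "fraction R M a a = fraction R M \<one> \<one>"
        using fraction_cancel[OF S one_closed one aM(1)] aM by simp
      ultimately show False using one_notin by simp
    qed
  qed
qed

lemma contraction_strict:
  assumes T: "ideal T (localization R M)" "ideal T' (localization R M)" "T \<subset> T'"
  shows "contraction M T \<subset> contraction M T'"
proof -
  note S = prime_complement_submonoid
  obtain x where x: "x \<in> T'" "x \<notin> T" using T(3) by blast
  have "x \<in> carrier (localization R M)" using ideal.Icarr[OF T(2) x(1)] .
  then obtain a s where a: "x = fraction R M a s" "a \<in> carrier R" "s \<in> M"
    by (auto simp: localization_carrier(1)[OF S])
  have "a \<in> contraction M T'" "a \<notin> contraction M T"
    using contraction_iff[OF T(1) a(2,3)] contraction_iff[OF T(2) a(2,3)] x a(1) by auto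
  moreover have "contraction M T \<subseteq> contraction M T'" using T(3) by (auto simp: contraction_def)
  ultimately show ?thesis by blast
qed

text \<open>A fraction outside \<open>extension M P\<close> is a unit.\<close>

lemma extension_maximal: "maximalideal (extension M P) (localization R M)"
proof (rule maximalidealI)
  note S = prime_complement_submonoid
  note pP = extension_prime[OF P order_refl]
  show "ideal (extension M P) (localization R M)" using primeideal.axioms(1)[OF pP] .
  show "carrier (localization R M) \<noteq> extension M P" using primeideal.I_notcarr[OF pP] .
  fix J assume J: "ideal J (localization R M)" "extension M P \<subseteq> J" "J \<subseteq> carrier (localization R M)"
  show "J = extension M P \<or> J = carrier (localization R M)"
  proof (rule disjCI)
    assume "J \<noteq> carrier (localization R M)"
    have "x \<in> extension M P" if x: "x \<in> J" for x
    proof -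
      obtain a s where a: "x = fraction R M a s" "a \<in> carrier R" "s \<in> M"
        using x J(3) by (auto simp: localization_carrier(1)[OF S])
      have "a \<in> P"
      proof (rule ccontr)
        assume "a \<notin> P"
        then have aM: "a \<in> M" using a by (simp add: M_def)
        have "a \<in> contraction M J" using contraction_iff[OF J(1) a(2,3)] x a(1) by simp
        then have "fraction R M a a \<in> J" using contraction_iff[OF J(1) a(2) aM] by simp
        moreover have "fraction R M a a = fraction R M \<one> \<one>"
          using fraction_cancel[OF S one_closed M_one[OF S] aM] a by simp
        ultimately have "\<one>\<^bsub>localization R M\<^esub> \<in> J" by (simp add: localization_carrier(2)[OF S])
        then show False using ideal.one_imp_carrier[OF J(1)] \<open>J \<noteq> _\<close> by simp
      qed
      then show ?thesis using a by (auto simp: extension_def)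
    qed
    then show "J = extension M P" using J(2) by blast
  qed
qed

end

end

section \<open>Regular local rings and chains of primes\<close>

text \<open>The position \<open>i\<close> may be at either end, so that the lemma also extends chains downwards and upwards.\<close>

lemma insert_into_chain:
  fixes Q :: "nat \<Rightarrow> 'b set"
  assumes Q: "\<And>i. i \<le> d \<Longrightarrow> A (Q i)" "\<And>i. i < d \<Longrightarrow> Q i \<subset> Q (Suc i)"
    and T: "A T" "i \<le> Suc d" "0 < i \<Longrightarrow> Q (i - 1) \<subset> T" "i \<le> d \<Longrightarrow> T \<subset> Q i"
  shows "\<exists>Q'. (\<forall>j\<le>Suc d. A (Q' j)) \<and> (\<forall>j<Suc d. Q' j \<subset> Q' (Suc j))"
proof -
  define Q' where "Q' j = (if j < i then Q j else if j = i then T else Q (j - 1))" for j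
  have "A (Q' j)" if "j \<le> Suc d" for j
    using that Q(1)[of j] Q(1)[of "j - 1"] T(1,2) by (auto simp: Q'_def)
  moreover have "Q' j \<subset> Q' (Suc j)" if j: "j < Suc d" for j
  proof -
    consider "Suc j < i" | "Suc j = i" | "j = i" | "i < j" by linarith
    then show ?thesis
    proof cases
      case 1
      then show ?thesis using Q(2)[of j] T(2) j by (simp add: Q'_def)
    next
      case 2
      then show ?thesis using T(3) by (auto simp: Q'_def)
    next
      case 3
      then show ?thesis using T(4) j by (simp add: Q'_def)
    next
      case 4
      then show ?thesis using Q(2)[of "j - 1"] j by (simp add: Q'_def)
    qed
  qed
  ultimately show ?thesis by blast
qed

text \<open>A finite supremum of natural numbers is attained. The prime \<open>T\<close> excludes the empty supremum, which
  is also zero.\<close>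

lemma krull_dim_chain:
  assumes "krull_dim R = enat d" "primeideal T R"
  shows "\<exists>Q. (\<forall>i\<le>d. primeideal (Q i) R) \<and> (\<forall>i<d. Q i \<subset> Q (Suc i))"
    and "(\<forall>i\<le>n. primeideal (Q i) R) \<Longrightarrow> (\<forall>i<n. Q i \<subset> Q (Suc i)) \<Longrightarrow> n \<le> d"
proof -
  define K where "K n \<longleftrightarrow> (\<exists>P. (\<forall>i\<le>n. primeideal (P i) R) \<and> (\<forall>i<n. P i \<subset> P (Suc i)))" for n :: nat
  have dim: "Sup {enat n | n. K n} = enat d" using assms(1) by (simp add: krull_dim_def K_def)
  have le: "n \<le> d" if "K n" for n
  proof -
    have "enat n \<le> Sup {enat n | n. K n}" using that by (intro Sup_upper) blast
    then show ?thesis by (simp add: dim)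
  qed
  show "n \<le> d" if "\<forall>i\<le>n. primeideal (Q i) R" "\<forall>i<n. Q i \<subset> Q (Suc i)" using le that unfolding K_def by blast
  have "K d"
  proof (cases d)
    case 0
    then show ?thesis unfolding K_def using assms(2) by (intro exI[of _ "\<lambda>_. T"]) simp
  next
    case (Suc e)
    show ?thesis
    proof (rule ccontr)
      assume no: "\<not> K d"
      have "Sup {enat n | n. K n} \<le> enat e"
      proof (rule Sup_least)
        fix x assume "x \<in> {enat n | n. K n}"
        then obtain n where n: "x = enat n" "K n" by blast
        then have "n \<le> d" "n \<noteq> d" using le no by auto
        then show "x \<le> enat e" using n Suc by simp
      qed
      then show False unfolding dim Suc by simp
    qed
  qed
  then show "\<exists>Q. (\<forall>i\<le>d. primeideal (Q i) R) \<and> (\<forall>i<d. Q i \<subset> Q (Suc i))" unfolding K_def .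
qed

text \<open>A chain of primes of \<open>R\<^sub>P\<close> of maximal length contracts to a chain of primes of \<open>R\<close> inside \<open>P\<close>. If it did
  not start at \<open>0\<close>, did not end at \<open>P\<close> or admitted a refinement, the extension to \<open>R\<^sub>P\<close> of the longer
  chain would be too long. Numerators of generators of the maximal ideal of \<open>R\<^sub>P\<close> generate \<open>P\<close> locally.\<close>

lemma (in domain) regular_at_of_regular_local:
  assumes P: "primeideal P R" and reg: "regular_local_ring (localization R (carrier R - P))"
  shows "regular_at R P"
proof -
  interpret I: twisted_ring R "\<lambda>x. x" by (rule twisted_ring_id)
  define M where "M = carrier R - P"
  let ?L = "localization R M"
  note S = prime_complement_submonoid[OF P, folded M_def]
  note iP = primeideal.axioms(1)[OF P]
  interpret L: cring ?L by (rule cring_localization[OF S])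
  obtain \<mm> B where mm: "maximalideal \<mm> ?L" "\<And>J. maximalideal J ?L \<Longrightarrow> J = \<mm>"
    and B: "finite B" "B \<subseteq> carrier ?L" "enat (card B) = krull_dim ?L" "\<mm> = genideal ?L B"
    using reg unfolding regular_local_ring_def M_def by blast
  have mm_eq: "extension M P = \<mm>" using mm(2)[OF extension_maximal[OF P, folded M_def]] .
  have "B \<subseteq> extension M P" unfolding mm_eq B(4) by (rule L.genideal_self[OF B(2)])
  then have "\<forall>b\<in>B. \<exists>a s. b = fraction R M a s \<and> a \<in> P \<and> s \<in> M" unfolding extension_def by blast
  then obtain num den where num: "\<And>b. b \<in> B \<Longrightarrow> b = fraction R M (num b) (den b) \<and> num b \<in> P \<and> den b \<in> M"
    by metis
  obtain bl where bl: "set bl = B" "distinct bl" using finite_distinct_list[OF B(1)] by blast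
  define xs where "xs = map num bl"
  define d where "d = length xs"
  have d: "krull_dim ?L = enat d" using B(3) distinct_card[OF bl(2)] bl(1) by (simp add: d_def xs_def)
  have xs: "set xs \<subseteq> P" using num bl(1) by (auto simp: xs_def)
  then have xsc: "set xs \<subseteq> carrier R" using ideal.Icarr[OF iP] by blast
  define X where "X = I.span_over {\<zero>} xs"
  have X: "I.submod X" "set xs \<subseteq> X"
    using I.submod_span[OF I.submod_zero xsc] I.span_upper[OF I.submod_zero xsc] by (simp_all add: X_def)
  have satX: "ideal (I.sat P X) R" using I.submod_sat[OF P X(1)] by (simp add: submodule_id_iff_ideal)
  have "B \<subseteq> extension M (I.sat P X)"
  proof
    fix b assume b: "b \<in> B"
    then have "num b \<in> I.sat P X" using I.sat_upper[OF P X(1)] X(2) bl(1) by (auto simp: xs_def)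
    then show "b \<in> extension M (I.sat P X)" using num[OF b] unfolding extension_def by blast
  qed
  then have sub: "extension M P \<subseteq> extension M (I.sat P X)"
    unfolding mm_eq B(4) by (intro L.genideal_minimal extension_ideal[OF S satX])
  have one: "\<one> \<in> M" using M_one[OF S] .
  have "y \<in> I.sat P X" if y: "y \<in> P" for y
  proof -
    have yc: "y \<in> carrier R" using y ideal.Icarr[OF iP] by blast
    have "fraction R M y \<one> \<in> extension M (I.sat P X)" using sub y one by (auto simp: extension_def)
    then obtain a s where a: "a \<in> I.sat P X" "s \<in> M" and eq: "fraction R M y \<one> = fraction R M a s"
      by (auto simp: extension_def)
    have ac: "a \<in> carrier R" using a ideal.Icarr[OF satX] by blast
    obtain u where u: "u \<in> M" "u \<otimes> (y \<otimes> s) = u \<otimes> (a \<otimes> \<one>)"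
      using eq fraction_eq_iff[OF S yc ac one a(2)] by blast
    have c: "u \<in> carrier R" "s \<in> carrier R" using u a by (auto simp: M_def)
    have "u \<otimes> a \<in> I.sat P X" using ideal.I_l_closed[OF satX a(1) c(1)] .
    then have "(u \<otimes> s) \<otimes> y \<in> I.sat P X" using u(2) ac c yc by (simp add: m_ac)
    moreover have "u \<otimes> s \<in> carrier R - P" using M_mult[OF S u(1) a(2)] by (simp add: M_def)
    ultimately have "y \<in> I.sat P (I.sat P X)" by (intro I.satI[OF P _ yc])
    then show ?thesis using I.sat_idem[OF P X(1)] by blast
  qed
  then have PX: "P \<subseteq> I.sat P (I.span_over {\<zero>} xs)" unfolding X_def by blast
  define A where "A T \<longleftrightarrow> primeideal T R \<and> T \<subseteq> P" for T
  have max: "n \<le> d" if "\<forall>i\<le>n. A (Q i)" "\<forall>i<n. Q i \<subset> Q (Suc i)" for Q n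
  proof (rule krull_dim_chain(2)[OF d extension_prime[OF P P order_refl, folded M_def]])
    show "\<forall>i\<le>n. primeideal (extension M (Q i)) ?L"
      using that(1) extension_prime[OF P, folded M_def] by (simp add: A_def)
    show "\<forall>i<n. extension M (Q i) \<subset> extension M (Q (Suc i))"
      using that extension_strict[OF P, folded M_def] by (simp add: A_def)
  qed
  obtain T where T: "\<forall>i\<le>d. primeideal (T i) ?L" "\<forall>i<d. T i \<subset> T (Suc i)"
    using krull_dim_chain(1)[OF d extension_prime[OF P P order_refl, folded M_def]] by blast
  define Q where "Q i = contraction M (T i)" for i
  have Q: "A (Q i)" if "i \<le> d" for i
    using T(1) that contraction_prime[OF P, folded M_def] by (simp add: A_def Q_def)
  have iT: "ideal (T i) ?L" if "i \<le> d" for i using T(1) that primeideal.axioms(1) by blast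
  have Q_strict: "Q i \<subset> Q (Suc i)" if "i < d" for i
    unfolding Q_def
    by (rule contraction_strict[OF P, folded M_def]) (use T(2) iT that in auto)
  have no_insert: False
    if "A U" "i \<le> Suc d" "0 < i \<Longrightarrow> Q (i - 1) \<subset> U" "i \<le> d \<Longrightarrow> U \<subset> Q i" for U i
  proof -
    have "\<exists>Q'. (\<forall>j\<le>Suc d. A (Q' j)) \<and> (\<forall>j<Suc d. Q' j \<subset> Q' (Suc j))"
      by (rule insert_into_chain[OF Q Q_strict that])
    then obtain Q' where "\<forall>j\<le>Suc d. A (Q' j)" "\<forall>j<Suc d. Q' j \<subset> Q' (Suc j)" by (elim exE conjE)
    then show False using max[of "Suc d" Q'] by simp
  qed
  have "Q d = P"
  proof (rule ccontr)
    assume "Q d \<noteq> P"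
    then have "Q d \<subset> P" using Q[of d] by (auto simp: A_def)
    then show False using no_insert[of P "Suc d"] P by (simp add: A_def)
  qed
  then have Qd: "Q (length xs) = P" by (simp add: d_def)
  have Q0: "Q 0 = {\<zero>}"
  proof (rule ccontr)
    assume ne: "Q 0 \<noteq> {\<zero>}"
    have "\<zero> \<in> Q 0" using Q[of 0] I.ideal_submod[THEN I.submodD(2)] primeideal.axioms(1) by (auto simp: A_def)
    then have "{\<zero>} \<subset> Q 0" using ne by blast
    moreover have "{\<zero>} \<subseteq> P" using I.submodD(2)[OF I.ideal_submod[OF iP]] by simp
    ultimately show False using no_insert[of "{\<zero>}" 0] zeroprimeideal by (simp add: A_def)
  qed
  have between: "U = Q i \<or> U = Q (Suc i)"
    if "i < d" "primeideal U R" "Q i \<subseteq> U" "U \<subseteq> Q (Suc i)" for i U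
  proof (rule ccontr)
    assume "\<not> ?thesis"
    then have "Q i \<subset> U" "U \<subset> Q (Suc i)" using that by auto
    moreover have "U \<subseteq> P" using that(1,4) Q[of "Suc i"] by (auto simp: A_def)
    ultimately show False using no_insert[of U "Suc i"] that(1,2) by (simp add: A_def)
  qed
  have primes: "\<forall>i\<le>length xs. primeideal (Q i) R" using Q by (simp add: A_def d_def)
  have "\<forall>i<length xs. Q i \<subset> Q (Suc i) \<and>
      (\<forall>T. primeideal T R \<longrightarrow> Q i \<subseteq> T \<longrightarrow> T \<subseteq> Q (Suc i) \<longrightarrow> T = Q i \<or> T = Q (Suc i))"
    by (intro allI impI conjI Q_strict between) (simp_all add: d_def)
  then show ?thesis unfolding regular_at_def using Qd Q0 primes xs PX by (intro exI[of _ Q] exI[of _ xs] conjI)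
qed


section \<open>The action on the ring of fractions\<close>

context cring
begin

text \<open>An operator that commutes with the denominator acts on the numerator. Its action on \<open>a/s\<close> is given by
  a recursion whose correction term is the action of the commutator with \<open>s\<close>, here the zero operator.\<close>

lemma diff_act_commuting:
  assumes M: "submonoid M R" and \<delta>: "\<delta> \<in> diff_ops R" and a: "a \<in> carrier R" and s: "s \<in> M"
    and comm: "diff_comm R \<delta> s = zero_op"
  shows "diff_act R M \<delta> (fraction R M a s) = fraction R M (\<delta> a) s"
proof -
  interpret L: cring "localization R M" by (rule cring_localization[OF M])
  note one = M_one[OF M]
  obtain m where "\<delta> \<in> diff_ops_le R m" using \<delta> by (auto simp: diff_ops_def)
  then have m: "\<delta> \<in> diff_ops_le R (Suc m)" by (rule diff_ops_le_Suc)
  have e: "\<delta> \<in> additive_endos R" using m by simp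
  have da: "\<delta> a \<in> carrier R" using additive_endosD(1)[OF e a] .
  have sc: "s \<in> carrier R" using M_closed[OF M s] .
  have z: "zero_op \<in> additive_endos R" using zero_op_diff_ops_le[of 0] by (rule diff_ops_le_endo)
  have "zero_op = op_lmult \<zero> zero_op"
    unfolding zero_op_def op_defs by (rule restrict_ext) simp
  then have "frac_act R M m zero_op a s = frac_act R M m (op_lmult \<zero> zero_op) a s" by simp
  also have "\<dots> = fraction R M \<zero> \<one> \<otimes>\<^bsub>localization R M\<^esub> frac_act R M m zero_op a s"
    by (rule frac_act_lmult[OF M z a s zero_closed])
  also have "\<dots> = \<zero>\<^bsub>localization R M\<^esub>"
    using L.l_null[OF frac_act_closed[OF M z a s]] by (simp add: localization_carrier(3)[OF M])
  finally have "frac_act R M m zero_op a s = \<zero>\<^bsub>localization R M\<^esub>" .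
  then have "diff_act R M \<delta> (fraction R M a s) =
      fraction R M \<one> s \<otimes>\<^bsub>localization R M\<^esub> (fraction R M (\<delta> a) \<one> \<ominus>\<^bsub>localization R M\<^esub> \<zero>\<^bsub>localization R M\<^esub>)"
    unfolding diff_act_frac[OF M m a s] frac_act.simps comm by simp
  also have "\<dots> = fraction R M \<one> s \<otimes>\<^bsub>localization R M\<^esub> fraction R M (\<delta> a) \<one>"
    using fraction_in_localization[OF M da one] by (simp add: a_minus_def)
  also have "\<dots> = fraction R M (\<delta> a) s"
    using da sc by (simp add: localization_mult[OF M one_closed da s one])
  finally show ?thesis .
qed

lemma diff_act_mult:
  assumes M: "submonoid M R" and r: "r \<in> carrier R" and a: "a \<in> carrier R" and s: "s \<in> M"
  shows "diff_act R M (\<lambda>x\<in>carrier R. r \<otimes> x) (fraction R M a s) = fraction R M (r \<otimes> a) s"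
proof -
  have "(\<lambda>x\<in>carrier R. r \<otimes> x) \<in> diff_ops_le R 0" using r by auto
  from diff_act_frac[OF M this a s] show ?thesis using a by simp
qed

lemma mult_diff_op: "r \<in> carrier R \<Longrightarrow> (\<lambda>x\<in>carrier R. r \<otimes> x) \<in> diff_ops R"
  unfolding diff_ops_def by (rule UN_I[of 0]) auto

lemma diff_submodule_localization:
  assumes M: "submonoid M R"
  shows "diff_submodule R M (carrier (localization R M))"
proof -
  interpret L: cring "localization R M" by (rule cring_localization[OF M])
  have "diff_act R M \<delta> x \<in> carrier (localization R M)"
    if \<delta>: "\<delta> \<in> diff_ops R" and x: "x \<in> carrier (localization R M)" for \<delta> x
  proof -
    obtain a s where a: "x = fraction R M a s" "a \<in> carrier R" "s \<in> M"
      using x by (auto simp: localization_carrier(1)[OF M])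
    obtain m where m: "\<delta> \<in> diff_ops_le R m" using \<delta> by (auto simp: diff_ops_def)
    show ?thesis unfolding a(1) diff_act_frac[OF M m a(2,3)]
      by (rule frac_act_closed[OF M diff_ops_le_endo[OF m] a(2,3)])
  qed
  moreover have "subgroup (carrier (localization R M)) (add_monoid (localization R M))"
    using L.add.subgroup_self by simp
  ultimately show ?thesis by (simp add: diff_submodule_def)
qed

text \<open>A fraction \<open>a/f^n\<close> is the multiple \<open>a f^(p^n - n) \<cdot> 1/f^(p^n)\<close>, since \<open>n \<le> p^n\<close>, and multiplications are
  differential operators.\<close>

lemma diff_span_inverse:
  assumes f: "f \<in> carrier R" and p: "1 < p"
    and ops: "\<And>k. \<exists>\<delta>\<in>diff_ops R. diff_act R (powers R f) \<delta> (fraction R (powers R f) \<one> f) =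
      fraction R (powers R f) \<one> (f [^] (p ^ k :: nat))"
  shows "diff_span R (powers R f) {fraction R (powers R f) \<one> f} = carrier (localization R (powers R f))"
proof -
  define M where "M = powers R f"
  have M: "submonoid M R" unfolding M_def by (rule powers_submonoid[OF f])
  have fM: "f [^] n \<in> M" for n :: nat by (auto simp: M_def powers_def)
  have fM1: "f \<in> M" using fM[of 1] f by simp
  have "diff_span R M {fraction R M \<one> f} \<subseteq> carrier (localization R M)"
    unfolding diff_span_def
    using diff_submodule_localization[OF M] fraction_in_localization[OF M one_closed fM1] by auto
  moreover have "x \<in> N" if N: "diff_submodule R M N" "fraction R M \<one> f \<in> N" and x: "x \<in> carrier (localization R M)" for x N
  proof -
    obtain a s where as: "x = fraction R M a s" "a \<in> carrier R" "s \<in> M"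
      using x by (auto simp: localization_carrier(1)[OF M])
    obtain n where "s = f [^] (n::nat)" using as(3) by (auto simp: M_def powers_def)
    then have a: "x = fraction R M a (f [^] n)" "a \<in> carrier R" using as by auto
    have act: "diff_act R M \<delta> y \<in> N" if "\<delta> \<in> diff_ops R" "y \<in> N" for \<delta> y
      using N(1) that by (simp add: diff_submodule_def)
    have n: "n \<le> p ^ n" using less_exp[of n] power_mono[of 2 p n] p by simp
    obtain \<delta> where "\<delta> \<in> diff_ops R" "diff_act R M \<delta> (fraction R M \<one> f) = fraction R M \<one> (f [^] (p ^ n))"
      using ops[of n] unfolding M_def by blast
    then have N1: "fraction R M \<one> (f [^] (p ^ n)) \<in> N" using act[OF _ N(2)] by metis
    define r where "r = f [^] (p ^ n - n) \<otimes> a"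
    have r: "r \<in> carrier R" using f a by (simp add: r_def)
    have "fraction R M (r \<otimes> \<one>) (f [^] (p ^ n)) \<in> N"
      using act[OF mult_diff_op[OF r] N1] diff_act_mult[OF M r one_closed fM] by simp
    moreover have "f [^] (p ^ n) = f [^] (p ^ n - n) \<otimes> f [^] n" using n f by (simp add: nat_pow_mult)
    ultimately have "fraction R M (f [^] (p ^ n - n) \<otimes> a) (f [^] (p ^ n - n) \<otimes> f [^] n) \<in> N"
      using r unfolding r_def by simp
    then show ?thesis unfolding a(1) using fraction_cancel[OF M a(2) fM fM] by simp
  qed
  ultimately show ?thesis unfolding M_def[symmetric] diff_span_def by blast
qed

end

text \<open>With \<open>q = p^e\<close>, write \<open>1/f = f^(q-1)/f^q\<close>; the operator commutes with \<open>f^q\<close>.\<close>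

lemma (in char_p_ring) diff_act_power_linear:
  assumes bs: "carrier R \<subseteq> twisted_span R (\<lambda>a. a [^] (p ^ e)) {\<zero>} bs" "set bs \<subseteq> carrier R"
    and f: "f \<in> carrier R" and \<delta>: "power_linear R (p ^ e) \<delta>"
    and r: "r \<le> p ^ e" "\<delta> (f [^] (p ^ e - 1)) = f [^] (p ^ e - r)"
  shows "\<exists>\<delta>\<in>diff_ops R. diff_act R (powers R f) \<delta> (fraction R (powers R f) \<one> f) =
    fraction R (powers R f) \<one> (f [^] r)"
proof -
  define M where "M = powers R f"
  have M: "submonoid M R" unfolding M_def by (rule powers_submonoid[OF f])
  have fM: "f [^] n \<in> M" for n :: nat by (auto simp: M_def powers_def)
  have fM1: "f \<in> M" using fM[of 1] f by simp
  let ?d = "restrict \<delta> (carrier R)" and ?q = "p ^ e"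
  have d: "?d \<in> diff_ops R" by (rule power_linear_diff_op[OF bs \<delta>])
  have "diff_comm R ?d (f [^] ?q) = zero_op"
    unfolding diff_comm_def zero_op_def using \<delta> f
    by (intro restrict_ext) (simp add: power_linear_def r_right_minus_eq)
  from diff_act_commuting[OF M d _ fM this, of "f [^] (?q - 1)"]
  have act: "diff_act R M ?d (fraction R M (f [^] (?q - 1)) (f [^] ?q)) = fraction R M (f [^] (?q - r)) (f [^] ?q)"
    using f r(2) by simp
  have split: "f [^] ?q = f [^] (?q - n) \<otimes> f [^] n" if "n \<le> ?q" for n using that f by (simp add: nat_pow_mult)
  have cancel: "fraction R M (f [^] (?q - n)) (f [^] ?q) = fraction R M \<one> (f [^] n)" if "n \<le> ?q" for n
    using fraction_cancel[OF M one_closed fM fM, of "?q - n" n] f split[OF that] by simp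
  have "1 \<le> ?q" using prime_gt_0_nat[OF prime_p] by simp
  from cancel[OF this] act cancel[OF r(1)] have "diff_act R M ?d (fraction R M \<one> f) = fraction R M \<one> (f [^] r)"
    using f by simp
  then show ?thesis using d unfolding M_def by blast
qed

theorem theorem4p4:
  fixes R S :: "('a, 'm) ring_scheme" and p :: nat
  assumes "domain S"
    and "contains_field_of_char p S"
    and "regular_ring S"
    and "F_finite p S"
    and "subring (carrier R) S"
    and "R = S\<lparr>carrier := carrier R\<rparr>"
    and "contains_field_of_char p R"
    and "noetherian_ring S"
    and "noetherian_ring R"
    and "F_finite p R"
    and "direct_summand R S"
  shows "\<forall>f\<in>carrier R.
    diff_span R (powers R f) {fraction R (powers R f) \<one>\<^bsub>R\<^esub> f} =
      carrier (localization R (powers R f))"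
proof
  fix f assume f: "f \<in> carrier R"
  interpret S: domain S by fact
  have sub: "carrier R \<subseteq> carrier S" using subringE(1)[OF assms(5)] .
  have ops: "monoid.mult R = monoid.mult S" "add R = add S" "one R = one S" "zero R = zero S"
    by (subst assms(6), simp)+
  have pow: "x [^]\<^bsub>R\<^esub> n = x [^]\<^bsub>S\<^esub> n" for x and n :: nat by (simp add: nat_pow_def ops)
  interpret S: char_p_ring S p
    using assms(2) by unfold_locales (auto simp: contains_field_of_char_def)
  interpret S: noetherian_char_p S p
    using assms(8) by (intro noetherian_char_p.intro noetherian_cring.intro S.char_p_ring_axioms S.is_cring)
  have "domain R" using S.subring_is_domain[OF assms(5)] assms(6) by simp
  then interpret R: domain R .
  interpret R: char_p_ring R p
    using assms(7) by unfold_locales (auto simp: contains_field_of_char_def)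
  have reg: "regular_at S P" if "primeideal P S" for P
    using S.regular_at_of_regular_local[OF that] assms(3) that by (simp add: regular_ring_def)
  obtain bS where bS: "set bS \<subseteq> carrier S" "carrier S \<subseteq> twisted_span S (\<lambda>a. a [^]\<^bsub>S\<^esub> p) {\<zero>\<^bsub>S\<^esub>} bS"
    using S.F_finite_span[OF assms(4)] by blast
  obtain bR where bR: "set bR \<subseteq> carrier R" "carrier R \<subseteq> twisted_span R (\<lambda>a. a [^]\<^bsub>R\<^esub> p) {\<zero>\<^bsub>R\<^esub>} bR"
    using R.F_finite_span[OF assms(10)] by blast
  have fid: "S.factorizable e (\<lambda>s. s)" for e
    by (rule S.factorizable_identity[OF S.factorizable_identity_1[OF bS reg]])
  have fS: "f \<in> carrier S" using f sub by blast
  obtain e where stable: "S.cartier_ideal f e \<subseteq> S.cartier_ideal f (Suc e)"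
    using S.cartier_ideals_stabilize[OF fid fS] by blast
  obtain \<beta> where \<beta>: "\<beta> \<in> carrier S \<rightarrow> carrier R"
    "\<And>x y. x \<in> carrier S \<Longrightarrow> y \<in> carrier S \<Longrightarrow> \<beta> (x \<oplus>\<^bsub>S\<^esub> y) = \<beta> x \<oplus>\<^bsub>R\<^esub> \<beta> y"
    "\<And>r x. r \<in> carrier R \<Longrightarrow> x \<in> carrier S \<Longrightarrow> \<beta> (r \<otimes>\<^bsub>S\<^esub> x) = r \<otimes>\<^bsub>R\<^esub> \<beta> x"
    "\<And>r. r \<in> carrier R \<Longrightarrow> \<beta> r = r"
    using assms(11) unfolding direct_summand_def by blast
  show "diff_span R (powers R f) {fraction R (powers R f) \<one>\<^bsub>R\<^esub> f} = carrier (localization R (powers R f))"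
  proof (rule R.diff_span_inverse[OF f])
    show "1 < p" using prime_gt_1_nat[OF S.prime_p] .
    fix k
    let ?q = "p ^ (k + e)"
    obtain \<delta> where \<delta>: "power_linear S ?q \<delta>"
      "\<delta> (f [^]\<^bsub>S\<^esub> (?q - 1)) = f [^]\<^bsub>S\<^esub> (?q - p ^ k)"
      using S.ex_power_linear_of_stable[OF fid fS stable] by blast
    have \<delta>D: "\<delta> s \<in> carrier S" "\<delta> (s \<oplus>\<^bsub>S\<^esub> t) = \<delta> s \<oplus>\<^bsub>S\<^esub> \<delta> t"
      "\<delta> (a [^]\<^bsub>S\<^esub> ?q \<otimes>\<^bsub>S\<^esub> s) = a [^]\<^bsub>S\<^esub> ?q \<otimes>\<^bsub>S\<^esub> \<delta> s"
      if "s \<in> carrier S" "t \<in> carrier S" "a \<in> carrier S" for s t a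
      using \<delta>(1) that by (auto simp: power_linear_def)
    \<comment> \<open>Restricting to \<open>R\<close> and composing with the splitting keeps linearity over the powers of elements of
      \<open>R\<close>.\<close>
    have lin: "power_linear R ?q (\<lambda>x. \<beta> (\<delta> x))"
      unfolding power_linear_def
    proof (intro conjI ballI)
      fix s assume s: "s \<in> carrier R"
      then have sS: "s \<in> carrier S" using sub by blast
      show "\<beta> (\<delta> s) \<in> carrier R" using Pi_mem[OF \<beta>(1)] \<delta>D(1)[OF sS sS sS] by blast
      show "\<beta> (\<delta> (s \<oplus>\<^bsub>R\<^esub> t)) = \<beta> (\<delta> s) \<oplus>\<^bsub>R\<^esub> \<beta> (\<delta> t)" if t: "t \<in> carrier R" for t
      proof -
        have tS: "t \<in> carrier S" using t sub by blast
        have "\<delta> (s \<oplus>\<^bsub>R\<^esub> t) = \<delta> s \<oplus>\<^bsub>S\<^esub> \<delta> t" using \<delta>D(2)[OF sS tS tS] by (simp only: ops)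
        then show ?thesis using \<beta>(2)[OF \<delta>D(1)[OF sS sS sS] \<delta>D(1)[OF tS tS tS]] by (simp only:)
      qed
    next
      fix a s assume a: "a \<in> carrier R" and s: "s \<in> carrier R"
      then have aS: "a \<in> carrier S" and sS: "s \<in> carrier S" using sub by auto
      have "\<delta> (a [^]\<^bsub>R\<^esub> ?q \<otimes>\<^bsub>R\<^esub> s) = a [^]\<^bsub>R\<^esub> ?q \<otimes>\<^bsub>S\<^esub> \<delta> s"
        using \<delta>D(3)[OF sS sS aS] by (simp only: ops pow)
      then show "\<beta> (\<delta> (a [^]\<^bsub>R\<^esub> ?q \<otimes>\<^bsub>R\<^esub> s)) = a [^]\<^bsub>R\<^esub> ?q \<otimes>\<^bsub>R\<^esub> \<beta> (\<delta> s)"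
        using \<beta>(3)[OF R.nat_pow_closed[OF a] \<delta>D(1)[OF sS sS sS]] by (simp only:)
    qed
    have "\<beta> (\<delta> (f [^]\<^bsub>R\<^esub> (?q - 1))) = f [^]\<^bsub>R\<^esub> (?q - p ^ k)"
      using \<delta>(2) \<beta>(4)[OF R.nat_pow_closed[OF f, of "?q - p ^ k"]] by (simp only: pow)
    moreover have "p ^ k \<le> ?q" using prime_gt_0_nat[OF S.prime_p] by (simp add: power_add)
    moreover obtain ws where "set ws \<subseteq> carrier R"
      "carrier R \<subseteq> twisted_span R (\<lambda>a. a [^]\<^bsub>R\<^esub> ?q) {\<zero>\<^bsub>R\<^esub>} ws"
      using R.F_finite_span_iterate[OF bR, of "k + e"] by blast
    ultimately show "\<exists>\<delta>\<in>diff_ops R. diff_act R (powers R f) \<delta> (fraction R (powers R f) \<one>\<^bsub>R\<^esub> f) =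
        fraction R (powers R f) \<one>\<^bsub>R\<^esub> (f [^]\<^bsub>R\<^esub> (p ^ k))"
      using R.diff_act_power_linear[OF _ _ f lin] by blast
  qed
qed

end
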